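(* Let $m\ge1$ and $N\ge 2m+1$ be integers, let $\Omega\subset\mathbb{R}^N$ be a bounded smooth star shaped domain, and let $1\le p<\frac{N+2m}{N-2m}$. Let $f\in C(\mathbb{R})$, put $F(s)=\int_0^s f(t)\,dt$, and assume that there exist $q>\frac{N+2m}{N-2m}$, $s_0>0$ and $C_0>0$ such that $$f(s)s-(q+1)F(s)\ge 0\quad\text{for all } s\in\mathbb{R},\qquad\text{and}\qquad f(s)s\ge C_0|s|^{q+1}\quad\text{for all } |s|\le s_0 .$$ Then there exists $\underline{\lambda}>0$, depending on $p,q,m,f,N,\Omega$, such that for any real $\lambda<\underline{\lambda}$ the Dirichlet problem $$(-\Delta)^m u=f(u)+\lambda|u|^{p-1}u\quad\text{in }\Omega,\qquad u=\frac{\partial u}{\partial\nu}=\dots=\frac{\partial^{m-1}u}{\partial\nu^{m-1}}=0\quad\text{on }\partial\Omega,$$ has no nontrivial regular solution.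
   Context: Here $\nu$ is the outer unit normal on $\partial\Omega$. The domain $\Omega$ is star shaped in the sense that there is a point $y\in\mathbb{R}^N$ with $(x-y)\cdot\nu(x)\ge0$ for all $x\in\partial\Omega$. A regular solution is a function $u\in C^{2m}(\Omega)\cap C^{2m-1}(\overline{\Omega})$ satisfying the equation and the boundary conditions classically; nontrivial means not identically zero. *)

theory Defs
  imports "HOL-Analysis.Analysis"
begin

section \<open>Spaces of continuously differentiable functions\<close>

primrec Ck_on :: "nat \<Rightarrow> 'a::euclidean_space set \<Rightarrow> ('a \<Rightarrow> real) \<Rightarrow> bool" where
  "Ck_on 0 S u \<longleftrightarrow> continuous_on S u"
| "Ck_on (Suc k) S u \<longleftrightarrow>
     (\<forall>x\<in>S. u differentiable (at x)) \<and> (\<forall>v. Ck_on k S (\<lambda>x. frechet_derivative u (at x) v))"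

definition smooth_on :: "'a::euclidean_space set \<Rightarrow> ('a \<Rightarrow> real) \<Rightarrow> bool" where
  "smooth_on S u \<longleftrightarrow> (\<forall>k. Ck_on k S u)"

text \<open>For \<open>u\<close> of class \<open>C\<^sup>k\<close> and \<open>k = length vs\<close>, \<open>iter_deriv vs u x\<close> is the \<open>k\<close>-linear form
  \<open>D\<^sup>k u(x)\<close> applied to the vectors \<open>vs\<close>.\<close>

primrec iter_deriv :: "'a::euclidean_space list \<Rightarrow> ('a \<Rightarrow> real) \<Rightarrow> 'a \<Rightarrow> real" where
  "iter_deriv [] u = u"
| "iter_deriv (v # vs) u = (\<lambda>x. frechet_derivative (iter_deriv vs u) (at x) v)"

text \<open>\<open>C\<^sup>k\<close> up to the boundary of an open set \<open>\<Omega>\<close>: all derivatives of order at most \<open>k\<close>, taken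
  in \<open>\<Omega>\<close>, extend continuously to the closure; \<open>u\<close> itself is its own extension.\<close>

definition Ck_closure :: "nat \<Rightarrow> 'a::euclidean_space set \<Rightarrow> ('a \<Rightarrow> real) \<Rightarrow> bool" where
  "Ck_closure k \<Omega> u \<longleftrightarrow>
     continuous_on (closure \<Omega>) u \<and> Ck_on k \<Omega> u \<and>
     (\<forall>vs. length vs \<le> k \<longrightarrow>
        (\<exists>g. continuous_on (closure \<Omega>) g \<and> (\<forall>x\<in>\<Omega>. g x = iter_deriv vs u x)))"

section \<open>Smooth domains\<close>

definition grad :: "('a::euclidean_space \<Rightarrow> real) \<Rightarrow> 'a \<Rightarrow> 'a" where
  "grad u x = (\<Sum>b\<in>Basis. frechet_derivative u (at x) b *\<^sub>R b)"

text \<open>Since \<open>grad \<rho>\<close> does not vanish on \<open>U\<close>, the boundary of \<open>\<Omega>\<close> in \<open>U\<close> is exactly the smooth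
  hypersurface \<open>\<rho> = 0\<close>, and \<open>\<Omega>\<close> lies locally on one side of it.\<close>

definition defining_function ::
    "'a::euclidean_space set \<Rightarrow> 'a set \<Rightarrow> ('a \<Rightarrow> real) \<Rightarrow> bool" where
  "defining_function \<Omega> U \<rho> \<longleftrightarrow>
     open U \<and> smooth_on U \<rho> \<and> (\<forall>y\<in>U. grad \<rho> y \<noteq> 0) \<and> \<Omega> \<inter> U = {y\<in>U. \<rho> y < 0}"

definition smooth_domain :: "'a::euclidean_space set \<Rightarrow> bool" where
  "smooth_domain \<Omega> \<longleftrightarrow>
     open \<Omega> \<and> connected \<Omega> \<and> \<Omega> \<noteq> {} \<and>
     (\<forall>x\<in>frontier \<Omega>. \<exists>U \<rho>. x \<in> U \<and> defining_function \<Omega> U \<rho>)"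

text \<open>At a boundary point of a smooth domain the gradients of any two defining functions are
  positive multiples of each other, so the description below is unique.\<close>

definition outer_normal :: "'a::euclidean_space set \<Rightarrow> 'a \<Rightarrow> 'a" where
  "outer_normal \<Omega> x =
     (THE v. \<exists>U \<rho>. x \<in> U \<and> defining_function \<Omega> U \<rho> \<and> v = grad \<rho> x /\<^sub>R norm (grad \<rho> x))"

definition star_shaped :: "'a::euclidean_space set \<Rightarrow> bool" where
  "star_shaped \<Omega> \<longleftrightarrow> (\<exists>y. \<forall>x\<in>frontier \<Omega>. (x - y) \<bullet> outer_normal \<Omega> x \<ge> 0)"

section \<open>The Dirichlet problem\<close>

definition laplacian :: "('a::euclidean_space \<Rightarrow> real) \<Rightarrow> 'a \<Rightarrow> real" where
  "laplacian u x = (\<Sum>b\<in>Basis. iter_deriv [b, b] u x)"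

definition polyharmonic :: "nat \<Rightarrow> ('a::euclidean_space \<Rightarrow> real) \<Rightarrow> 'a \<Rightarrow> real" where
  "polyharmonic m = (\<lambda>u x. - laplacian u x) ^^ m"

text \<open>\<open>\<partial>\<^sup>j u / \<partial>\<nu>\<^sup>j\<close> at a boundary point \<open>x\<close> is \<open>D\<^sup>j u(x)[\<nu>(x), \<dots>, \<nu>(x)]\<close>, where
  \<open>D\<^sup>j u(x)\<close> is the value at \<open>x\<close> of the continuous extension of \<open>D\<^sup>j u\<close> from \<open>\<Omega>\<close>; the vector
  \<open>\<nu>(x)\<close> stays fixed while the limit is taken. For \<open>j = 0\<close> and \<open>u\<close> continuous on the closure,
  this is \<open>u x\<close>.\<close>

definition normal_deriv ::
    "nat \<Rightarrow> 'a::euclidean_space set \<Rightarrow> ('a \<Rightarrow> real) \<Rightarrow> 'a \<Rightarrow> real" where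
  "normal_deriv j \<Omega> u x =
     Lim (at x within \<Omega>) (iter_deriv (replicate j (outer_normal \<Omega> x)) u)"

definition regular_solution ::
    "nat \<Rightarrow> 'a::euclidean_space set \<Rightarrow> (real \<Rightarrow> real) \<Rightarrow> ('a \<Rightarrow> real) \<Rightarrow> bool" where
  "regular_solution m \<Omega> h u \<longleftrightarrow>
     Ck_on (2 * m) \<Omega> u \<and> Ck_closure (2 * m - 1) \<Omega> u \<and>
     (\<forall>x\<in>\<Omega>. polyharmonic m u x = h (u x)) \<and>
     (\<forall>x\<in>frontier \<Omega>. \<forall>j<m. normal_deriv j \<Omega> u x = 0)"

end

theory Submission
  imports Defs
begin

text \<open>
  Let \<open>h(s) = f(s) + \<lambda> |s|\<^sup>p\<^sup>-\<^sup>1 s\<close>, let \<open>H\<close> be its primitive, let \<open>\<alpha> = (N - 2m)/2\<close>, and extend \<open>u\<close> by zero to the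
  whole space. The energy form \<open>B(u, v) = \<integral> D\<^sup>m u \<cdot> D\<^sup>m v\<close> satisfies \<open>B(u, v) = \<integral> h(u) v\<close> for all
  \<open>v\<close> vanishing to order \<open>m\<close> on the boundary. For \<open>t > 1\<close> star-shapedness makes the dilation
  \<open>u\<^sub>t(x) = u(y + t (x - y))\<close> such a \<open>v\<close>, and \<open>t\<^sup>\<alpha> u\<^sub>t\<close> has the same energy as \<open>u\<close>. By Cauchy-Schwarz
  \<open>\<integral> h(u) (t\<^sup>\<alpha> u\<^sub>t - u) \<le> 0\<close>, and letting \<open>t\<close> tend to 1 gives the Pohozaev inequality
  \<open>\<alpha> \<integral> h(u) u \<le> N \<integral> H(u)\<close> without any boundary integral.

  The hypotheses on \<open>f\<close> propagate to \<open>f(s) s \<ge> C\<^sub>0 |s|\<^sup>q\<^sup>+\<^sup>1\<close> for all \<open>s\<close>, because \<open>F(s) / |s|\<^sup>q\<^sup>+\<^sup>1\<close> is monotone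
  in \<open>|s|\<close>. The Pohozaev inequality then bounds \<open>\<integral> f(u) u\<close>, hence \<open>\<integral> |u|\<^sup>q\<^sup>+\<^sup>1\<close> and, by the iterated Poincare
  inequality \<open>\<integral> u\<^sup>2 \<le> C B(u, u)\<close>, also \<open>\<integral> u\<^sup>2\<close>, by a constant times \<open>\<lambda> \<integral> |u|\<^sup>p\<^sup>+\<^sup>1\<close>. Since
  \<open>|s|\<^sup>p\<^sup>+\<^sup>1 \<le> s\<^sup>2 + |s|\<^sup>q\<^sup>+\<^sup>1\<close>, this forces \<open>u = 0\<close> for small \<open>\<lambda>\<close>.
\<close>

section \<open>Iterated directional derivatives\<close>

text \<open>The classical multiplier (x - y) . grad u produces boundary integrals and asks for the
  divergence theorem up to the boundary, although derivatives of order 2m are controlled only inside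
  \<Omega>. Comparing u with a dilate avoids both: every integration by parts has a test function
  that vanishes at the boundary and can be cut off, and only a one-sided derivative in t at 1 is
  taken. The price is an inequality in place of the identity; what is lost is the boundary term,
  which has a sign on a star shaped domain and would be discarded anyway. The critical exponent
  enters only through signs: N/(r+1) - \<alpha> is positive for r below (N+2m)/(N-2m) and negative
  above it. Once F is bounded by f(s) s/(q+1), the Pohozaev inequality therefore reads a \<integral>
  f(u) u \<le> \<lambda> b \<integral> |u|^(p+1) with a, b > 0. For nontrivial u the left side is
  positive, so \<lambda> \<le> 0 is excluded at once, and only small positive \<lambda> call for the
  Poincare inequality.\<close>

abbreviation dir_deriv :: "'a::euclidean_space \<Rightarrow> ('a \<Rightarrow> real) \<Rightarrow> 'a \<Rightarrow> real" where
  "dir_deriv v u \<equiv> \<lambda>x. frechet_derivative u (at x) v"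

text \<open>This holds even at points without a derivative: \<open>frechet_derivative\<close>
  chooses from the set of derivatives, and that set is the same for both functions.\<close>

lemma dir_deriv_cong:
  assumes "open S" "x \<in> S" "\<And>y. y \<in> S \<Longrightarrow> u y = w y"
  shows "frechet_derivative u (at x) = frechet_derivative w (at x)"
proof -
  have eq: "(u has_derivative D) (at x) \<longleftrightarrow> (w has_derivative D) (at x)" for D
    using assms has_derivative_transform_within_open[of _ D x UNIV S] by (metis (no_types, lifting))
  show ?thesis unfolding frechet_derivative_def eq ..
qed

lemma differentiable_cong_open:
  fixes u w :: "'a::euclidean_space \<Rightarrow> real"
  assumes "open S" "x \<in> S" "\<And>y. y \<in> S \<Longrightarrow> u y = w y" "u differentiable (at x)"
  shows "w differentiable (at x)"
  using assms has_derivative_transform_within_open[of u _ x UNIV S w] unfolding differentiable_def by blast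

lemma line_derivative:
  fixes u :: "'a::euclidean_space \<Rightarrow> real"
  assumes "u differentiable (at (x + t *\<^sub>R v))"
  shows "((\<lambda>t. u (x + t *\<^sub>R v)) has_real_derivative dir_deriv v u (x + t *\<^sub>R v)) (at t)"
proof -
  have u: "(u has_derivative frechet_derivative u (at (x + t *\<^sub>R v))) (at (x + t *\<^sub>R v))"
    using assms frechet_derivative_works by blast
  have "((\<lambda>t. x + t *\<^sub>R v) has_derivative (\<lambda>s. s *\<^sub>R v)) (at t)"
    by (auto intro!: derivative_eq_intros)
  from has_derivative_compose[OF this u]
  have "((\<lambda>t. u (x + t *\<^sub>R v)) has_derivative
      (\<lambda>s. frechet_derivative u (at (x + t *\<^sub>R v)) (s *\<^sub>R v))) (at t)" .
  moreover have "(\<lambda>s. frechet_derivative u (at (x + t *\<^sub>R v)) (s *\<^sub>R v))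
      = (*) (dir_deriv v u (x + t *\<^sub>R v))"
    using linear_frechet_derivative[OF assms] by (auto simp: linear_cmul mult.commute)
  ultimately show ?thesis by (simp add: has_field_derivative_def)
qed

lemma Ck_on_cong:
  assumes "open S" "\<And>x. x \<in> S \<Longrightarrow> u x = w x" "Ck_on k S u"
  shows "Ck_on k S w"
  using assms(2,3)
proof (induction k arbitrary: u w)
  case 0
  show ?case using continuous_on_eq[OF 0(2)[unfolded Ck_on.simps] 0(1)] by (simp only: Ck_on.simps)
next
  case (Suc k)
  have "Ck_on k S (dir_deriv v w)" for v
  proof (rule Suc.IH[of "dir_deriv v u"])
    show "dir_deriv v u x = dir_deriv v w x" if "x \<in> S" for x
      using dir_deriv_cong[OF \<open>open S\<close> that Suc.prems(1)] by (rule fun_cong)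
    show "Ck_on k S (dir_deriv v u)" using Suc.prems(2) by (simp only: Ck_on.simps)
  qed
  moreover have "w differentiable (at x)" if "x \<in> S" for x
    using differentiable_cong_open[OF \<open>open S\<close> that Suc.prems(1)] Suc.prems(2) that by (simp only: Ck_on.simps)
  ultimately show ?case by (simp only: Ck_on.simps) blast
qed

lemma Ck_on_Suc_imp: "Ck_on (Suc k) S u \<Longrightarrow> Ck_on k S u"
proof (induction k arbitrary: u)
  case 0
  then show ?case
    by (auto intro!: continuous_at_imp_continuous_on differentiable_imp_continuous_within)
next
  case (Suc k)
  then show ?case by (metis Ck_on.simps(2))
qed

lemma Ck_on_le: "Ck_on k S u \<Longrightarrow> j \<le> k \<Longrightarrow> Ck_on j S u"
  by (induction k rule: nat_induct) (auto simp del: Ck_on.simps(2) dest: Ck_on_Suc_imp simp: le_Suc_eq)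

lemma Ck_on_imp_continuous_on: "Ck_on k S u \<Longrightarrow> continuous_on S u"
  using Ck_on_le[of k S u 0] by simp

lemma Ck_on_subset: "Ck_on k S u \<Longrightarrow> T \<subseteq> S \<Longrightarrow> Ck_on k T u"
  by (induction k arbitrary: u) (auto intro: continuous_on_subset)

lemma Ck_on_iter_deriv: "Ck_on (k + length vs) S u \<Longrightarrow> Ck_on k S (iter_deriv vs u)"
proof (induction vs arbitrary: k)
  case (Cons v vs)
  then have "Ck_on (Suc k) S (iter_deriv vs u)" by (intro Cons.IH) (simp del: Ck_on.simps)
  then show ?case by (simp only: Ck_on.simps iter_deriv.simps)
qed simp

lemma iter_deriv_append: "iter_deriv (vs @ ws) u = iter_deriv vs (iter_deriv ws u)"
  by (induction vs) auto

text \<open>The mean value theorem is applied twice, in direction w to a difference along v and then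
  in direction v. The left side is symmetric in v and w while the right side is not; the symmetry of
  second derivatives comes from this contrast.\<close>

lemma second_difference:
  fixes u :: "'a::euclidean_space \<Rightarrow> real"
  assumes "Ck_on 2 S u" "0 < s" and S: "\<And>a b. 0 \<le> a \<Longrightarrow> a \<le> s \<Longrightarrow> 0 \<le> b \<Longrightarrow> b \<le> s \<Longrightarrow> x + a *\<^sub>R v + b *\<^sub>R w \<in> S"
  obtains a b where "0 < a" "a < s" "0 < b" "b < s"
    "u (x + s *\<^sub>R v + s *\<^sub>R w) - u (x + s *\<^sub>R v) - u (x + s *\<^sub>R w) + u x
      = s\<^sup>2 * iter_deriv [v, w] u (x + a *\<^sub>R v + b *\<^sub>R w)"
proof -
  have 2: "Ck_on (Suc (Suc 0)) S u" using assms(1) by (simp add: numeral_2_eq_2)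
  have d1: "u differentiable (at y)" if "y \<in> S" for y using 2 that by simp
  have d2: "dir_deriv w u differentiable (at y)" if "y \<in> S" for y using 2 that by simp
  define g where "g b = u ((x + s *\<^sub>R v) + b *\<^sub>R w) - u (x + b *\<^sub>R w)" for b
  have g: "(g has_real_derivative (dir_deriv w u ((x + s *\<^sub>R v) + b *\<^sub>R w) - dir_deriv w u (x + b *\<^sub>R w))) (at b)"
    if "0 \<le> b" "b \<le> s" for b
    unfolding g_def using S[of s b] S[of 0 b] that \<open>0 < s\<close>
    by (intro DERIV_diff line_derivative d1) auto
  from MVT2[OF \<open>0 < s\<close> g] obtain b where b: "0 < b" "b < s"
    and gb: "g s - g 0 = s * (dir_deriv w u ((x + s *\<^sub>R v) + b *\<^sub>R w) - dir_deriv w u (x + b *\<^sub>R w))" by auto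
  have k: "((\<lambda>a. dir_deriv w u ((x + b *\<^sub>R w) + a *\<^sub>R v)) has_real_derivative
      dir_deriv v (dir_deriv w u) ((x + b *\<^sub>R w) + a *\<^sub>R v)) (at a)" if "0 \<le> a" "a \<le> s" for a
    using S[of a b] that b by (intro line_derivative d2) (auto simp: algebra_simps)
  from MVT2[OF \<open>0 < s\<close> k] obtain a where a: "0 < a" "a < s"
    and ka: "dir_deriv w u ((x + b *\<^sub>R w) + s *\<^sub>R v) - dir_deriv w u ((x + b *\<^sub>R w) + 0 *\<^sub>R v)
       = s * dir_deriv v (dir_deriv w u) ((x + b *\<^sub>R w) + a *\<^sub>R v)" by auto
  have "g s - g 0 = s\<^sup>2 * iter_deriv [v, w] u (x + a *\<^sub>R v + b *\<^sub>R w)"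
    using gb ka by (simp add: power2_eq_square algebra_simps)
  then show ?thesis using a b that[of a b] by (simp add: g_def)
qed

lemma iter_deriv_swap:
  fixes u :: "'a::euclidean_space \<Rightarrow> real"
  assumes "open S" "Ck_on 2 S u" "x \<in> S"
  shows "iter_deriv [v, w] u x = iter_deriv [w, v] u x"
proof (rule ccontr)
  let ?A = "iter_deriv [v, w] u" and ?B = "iter_deriv [w, v] u"
  assume ne: "?A x \<noteq> ?B x"
  define e where "e = \<bar>?A x - ?B x\<bar> / 2"
  have "e > 0" using ne by (simp add: e_def)
  have cont: "continuous_on S ?A" "continuous_on S ?B"
    using assms(2) by (simp_all add: numeral_2_eq_2)
  obtain d0 where d0: "d0 > 0" "ball x d0 \<subseteq> S" using assms openE by blast
  obtain d1 where d1: "d1 > 0" "\<And>y. y \<in> S \<Longrightarrow> dist y x < d1 \<Longrightarrow> dist (?A y) (?A x) < e"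
    using cont(1) assms(3) \<open>e > 0\<close> unfolding continuous_on_iff by blast
  obtain d2 where d2: "d2 > 0" "\<And>y. y \<in> S \<Longrightarrow> dist y x < d2 \<Longrightarrow> dist (?B y) (?B x) < e"
    using cont(2) assms(3) \<open>e > 0\<close> unfolding continuous_on_iff by blast
  define d where "d = min d0 (min d1 d2)"
  \<comment> \<open>This keeps the parallelogram with sides s v and s w inside the ball of radius d;
    the summand 1 covers v = w = 0.\<close>
  define s where "s = d / (2 * (norm v + norm w + 1))"
  have d: "d > 0" "d \<le> d0" "d \<le> d1" "d \<le> d2" using d0 d1 d2 by (auto simp: d_def)
  have nv: "norm v + norm w + 1 > 0" by (smt (verit) norm_ge_zero)
  then have "s > 0" using d by (simp add: s_def)
  have near: "dist (x + a *\<^sub>R v + b *\<^sub>R w) x < d" if "0 \<le> a" "a \<le> s" "0 \<le> b" "b \<le> s" for a b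
  proof -
    have "dist (x + a *\<^sub>R v + b *\<^sub>R w) x \<le> norm (a *\<^sub>R v) + norm (b *\<^sub>R w)"
      by (simp add: dist_norm add.assoc) (metis norm_scaleR norm_triangle_ineq)
    also have "\<dots> \<le> s * norm v + s * norm w"
      using that by (auto intro!: add_mono mult_right_mono)
    also have "\<dots> \<le> s * (norm v + norm w + 1)" using \<open>s > 0\<close> by (simp add: algebra_simps)
    also have "\<dots> = d / 2" using nv by (simp add: s_def field_simps)
    also have "\<dots> < d" using d by simp
    finally show ?thesis .
  qed
  have inS: "x + a *\<^sub>R v + b *\<^sub>R w \<in> S" if "0 \<le> a" "a \<le> s" "0 \<le> b" "b \<le> s" for a b
    using near[OF that] d d0 by (auto simp: dist_commute)
  have inS': "x + a *\<^sub>R w + b *\<^sub>R v \<in> S" if "0 \<le> a" "a \<le> s" "0 \<le> b" "b \<le> s" for a b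
    using inS[of b a] that by (simp add: algebra_simps)
  let ?Q = "u (x + s *\<^sub>R v + s *\<^sub>R w) - u (x + s *\<^sub>R v) - u (x + s *\<^sub>R w) + u x"
  obtain a b where ab: "0 < a" "a < s" "0 < b" "b < s" "?Q = s\<^sup>2 * ?A (x + a *\<^sub>R v + b *\<^sub>R w)"
    using second_difference[of S u s x v w] assms(2) \<open>s > 0\<close> inS by metis
  obtain a' b' where ab': "0 < a'" "a' < s" "0 < b'" "b' < s"
    "u (x + s *\<^sub>R w + s *\<^sub>R v) - u (x + s *\<^sub>R w) - u (x + s *\<^sub>R v) + u x = s\<^sup>2 * ?B (x + a' *\<^sub>R w + b' *\<^sub>R v)"
    using second_difference[of S u s x w v] assms(2) \<open>s > 0\<close> inS' by metis
  have "s\<^sup>2 * ?A (x + a *\<^sub>R v + b *\<^sub>R w) = s\<^sup>2 * ?B (x + a' *\<^sub>R w + b' *\<^sub>R v)"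
    using ab(5) ab'(5) by (simp add: algebra_simps)
  then have eq: "?A (x + a *\<^sub>R v + b *\<^sub>R w) = ?B (x + b' *\<^sub>R v + a' *\<^sub>R w)"
    using \<open>s > 0\<close> by (simp add: algebra_simps)
  have "dist (?A (x + a *\<^sub>R v + b *\<^sub>R w)) (?A x) < e"
    using ab inS[of a b] near[of a b] d by (intro d1) auto
  moreover have "dist (?B (x + b' *\<^sub>R v + a' *\<^sub>R w)) (?B x) < e"
    using ab' inS[of b' a'] near[of b' a'] d by (intro d2) auto
  ultimately have "\<bar>?A x - ?B x\<bar> < 2 * e" using eq unfolding dist_real_def by linarith
  then show False by (simp add: e_def)
qed

lemma iter_deriv_move:
  assumes "open S" "Ck_on (Suc (length xs + length ys)) S u" "x \<in> S"
  shows "iter_deriv (xs @ a # ys) u x = iter_deriv (a # xs @ ys) u x"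
  using assms(2,3)
proof (induction xs arbitrary: x)
  case (Cons b xs)
  have IH: "iter_deriv (xs @ a # ys) u z = iter_deriv (a # xs @ ys) u z" if "z \<in> S" for z
    using Cons.IH[OF Ck_on_Suc_imp that] Cons.prems by (simp del: Ck_on.simps)
  have "iter_deriv ((b # xs) @ a # ys) u x = dir_deriv b (iter_deriv (a # xs @ ys) u) x"
    using dir_deriv_cong[OF assms(1) Cons.prems(2) IH] by simp
  also have "\<dots> = iter_deriv [b, a] (iter_deriv (xs @ ys) u) x" by simp
  also have "\<dots> = iter_deriv [a, b] (iter_deriv (xs @ ys) u) x"
  proof (rule iter_deriv_swap[OF assms(1) Ck_on_iter_deriv Cons.prems(2)])
    show "Ck_on (2 + length (xs @ ys)) S u" using Cons.prems(1) by (simp add: numeral_2_eq_2)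
  qed
  finally show ?case by simp
qed simp

text \<open>Selection sort on the list: \<open>iter_deriv_move\<close> brings the wanted vector to
  the front, and the induction hypothesis, being an identity on an open set, may be differentiated
  once more.\<close>

lemma iter_deriv_perm:
  assumes "open S" "mset vs = mset ws" "Ck_on (length vs) S u" "x \<in> S"
  shows "iter_deriv vs u x = iter_deriv ws u x"
  using assms(2-)
proof (induction vs arbitrary: ws x)
  case (Cons a vs)
  have "a \<in> set ws" using Cons.prems(1) by (metis list.set_intros(1) set_mset_mset)
  then obtain xs ys where ws: "ws = xs @ a # ys" by (meson split_list)
  have ms: "mset vs = mset (xs @ ys)" using Cons.prems(1) ws by simp
  then have len: "length vs = length (xs @ ys)" by (metis size_mset)
  have eq: "iter_deriv vs u z = iter_deriv (xs @ ys) u z" if "z \<in> S" for z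
    using Cons.IH[OF ms Ck_on_Suc_imp that] Cons.prems(2) by (simp del: Ck_on.simps)
  have "iter_deriv (a # vs) u x = iter_deriv (a # xs @ ys) u x"
    using dir_deriv_cong[OF assms(1) Cons.prems(3) eq] by simp
  also have "\<dots> = iter_deriv ws u x"
    using iter_deriv_move[OF assms(1) _ Cons.prems(3), of xs ys u a] Cons.prems(2) len ws
    by (simp del: Ck_on.simps)
  finally show ?case .
qed simp

text \<open>The constant factor lets one induction serve both the sign in
  \<open>polyharmonic_Suc\<close> and scalar multiples.\<close>

lemma Ck_on_sum:
  assumes "finite I" "\<And>i. i \<in> I \<Longrightarrow> Ck_on k S (g i)" "open S"
  shows "Ck_on k S (\<lambda>x. \<Sum>i\<in>I. c * g i x :: real)"
  using assms(2)
proof (induction k arbitrary: g)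
  case 0
  then show ?case by (auto intro!: continuous_intros)
next
  case (Suc k)
  have "(\<lambda>x. \<Sum>i\<in>I. c * g i x) differentiable (at x)" if "x \<in> S" for x
    using Suc.prems that assms(1) by (intro differentiable_sum differentiable_mult) auto
  moreover have "Ck_on k S (dir_deriv v (\<lambda>x. \<Sum>i\<in>I. c * g i x))" for v
  proof (rule Ck_on_cong[OF assms(3)])
    show "Ck_on k S (\<lambda>x. \<Sum>i\<in>I. c * dir_deriv v (g i) x)"
      using Suc.prems by (intro Suc.IH) auto
    fix x assume "x \<in> S"
    then have "((\<lambda>x. \<Sum>i\<in>I. c * g i x) has_derivative (\<lambda>v. \<Sum>i\<in>I. c * frechet_derivative (g i) (at x) v)) (at x)"
      using Suc.prems
      by (intro has_derivative_sum has_derivative_mult_right) (auto simp flip: frechet_derivative_works)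
    then show "(\<Sum>i\<in>I. c * dir_deriv v (g i) x) = dir_deriv v (\<lambda>x. \<Sum>i\<in>I. c * g i x) x"
      by (rule fun_cong[OF frechet_derivative_at])
  qed
  ultimately show ?case by simp
qed

lemma iter_deriv_sum:
  assumes "finite I" "\<And>i. i \<in> I \<Longrightarrow> Ck_on (length vs) S (g i)" "open S" "x \<in> S"
  shows "iter_deriv vs (\<lambda>x. \<Sum>i\<in>I. c * g i x) x = (\<Sum>i\<in>I. c * iter_deriv vs (g i) x)"
  using assms(2,4)
proof (induction vs arbitrary: x)
  case (Cons v vs)
  have IH: "iter_deriv vs (\<lambda>x. \<Sum>i\<in>I. c * g i x) z = (\<Sum>i\<in>I. c * iter_deriv vs (g i) z)" if "z \<in> S" for z
    using Cons.IH[OF Ck_on_Suc_imp that] Cons.prems by (simp del: Ck_on.simps)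
  have "Ck_on (Suc 0) S (iter_deriv vs (g i))" if "i \<in> I" for i
    using Cons.prems(1)[OF that] by (intro Ck_on_iter_deriv) (simp del: Ck_on.simps)
  then have "((\<lambda>x. \<Sum>i\<in>I. c * iter_deriv vs (g i) x) has_derivative
      (\<lambda>v. \<Sum>i\<in>I. c * frechet_derivative (iter_deriv vs (g i)) (at x) v)) (at x)"
    using Cons.prems(2)
    by (intro has_derivative_sum has_derivative_mult_right) (auto simp flip: frechet_derivative_works)
  then have "dir_deriv v (\<lambda>x. \<Sum>i\<in>I. c * iter_deriv vs (g i) x) x = (\<Sum>i\<in>I. c * iter_deriv (v # vs) (g i) x)"
    by (simp only: iter_deriv.simps frechet_derivative_at[symmetric])
  then show ?case using dir_deriv_cong[OF assms(3) Cons.prems(2) IH] by simp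
qed simp

section \<open>Integration by parts\<close>

lemma set_integrable_bounded_continuous:
  fixes f :: "'a::euclidean_space \<Rightarrow> real"
  assumes "open G" "bounded G" "continuous_on G f" "bounded (f ` G)"
  shows "set_integrable lborel G f"
proof -
  obtain B where B: "\<And>x. x \<in> G \<Longrightarrow> \<bar>f x\<bar> \<le> B"
    using assms(4) by (auto simp: bounded_iff)
  have m: "(\<lambda>x. indicator G x *\<^sub>R f x) \<in> borel_measurable borel"
    using assms by (intro borel_measurable_continuous_on_indicator) auto
  show ?thesis unfolding set_integrable_def
    by (rule integrableI_bounded_set[where A = G and B = B])
      (use assms B m emeasure_bounded_finite[OF assms(2)] in \<open>auto\<close>)
qed

section \<open>Null sets by translation, and integrals of derivatives over the whole space\<close>

lemma lborel_integral_affine: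
  fixes f :: "'a::euclidean_space \<Rightarrow> real"
  assumes [measurable]: "f \<in> borel_measurable borel" and "t \<noteq> 0"
  shows "(\<integral>x. f x \<partial>lborel) = \<bar>t\<bar> ^ DIM('a) * (\<integral>x. f (c + t *\<^sub>R x) \<partial>lborel)"
  by (subst lborel_affine[OF assms(2), of c]) (simp add: integral_density integral_distr)

text \<open>The translates of S by b/(j+1) are pairwise disjoint, have equal measure and lie in one
  ball; infinitely many equal measures with finite sum are 0.\<close>

lemma negligible_disjoint_translates:
  fixes S :: "'a::euclidean_space set"
  assumes "compact S" and dis: "\<And>x s. x \<in> S \<Longrightarrow> s > 0 \<Longrightarrow> x + s *\<^sub>R b \<notin> S"
  shows "negligible S"
proof -
  define T where "T j = (+) ((1 / real (Suc j)) *\<^sub>R b) ` S" for j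
  have S: "S \<in> lmeasurable" using assms(1) by (rule lmeasurable_compact)
  have T: "T j \<in> lmeasurable" for j
    unfolding T_def using compact_translation[OF assms(1)] by (intro lmeasurable_compact) auto
  have Teq: "emeasure lebesgue (T j) = ennreal (measure lebesgue S)" for j
    using T[of j] by (simp add: emeasure_eq_measure2 T_def measure_translation)
  have "T i \<inter> T j = {}" if "i < j" for i j
  proof -
    have "1 / real (Suc j) < 1 / real (Suc i)" using that by (simp add: frac_less2)
    have False if "x \<in> S" "y \<in> S" "(1 / real (Suc i)) *\<^sub>R b + x = (1 / real (Suc j)) *\<^sub>R b + y" for x y
    proof -
      have "y = x + (1 / real (Suc i) - 1 / real (Suc j)) *\<^sub>R b"
        using that(3) by (simp add: algebra_simps)
      then show False
        using dis[OF that(1), of "1 / real (Suc i) - 1 / real (Suc j)"] that(2) \<open>1 / real (Suc j) < _\<close> by simp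
    qed
    then show ?thesis by (auto simp: T_def)
  qed
  then have disj: "disjoint_family T"
    unfolding disjoint_family_on_def by (metis inf_commute linorder_neqE_nat)
  obtain R where R: "\<And>x. x \<in> S \<Longrightarrow> norm x \<le> R"
    using compact_imp_bounded[OF assms(1)] by (auto simp: bounded_iff)
  have "(\<Union>j. T j) \<subseteq> cball 0 (R + norm b)"
  proof
    fix z assume "z \<in> (\<Union>j. T j)"
    then obtain j x where z: "z = (1 / real (Suc j)) *\<^sub>R b + x" "x \<in> S" by (auto simp: T_def)
    have "norm z \<le> norm ((1 / real (Suc j)) *\<^sub>R b) + norm x" using z norm_triangle_ineq by blast
    also have "\<dots> \<le> 1 * norm b + R"
      unfolding norm_scaleR using R[OF z(2)] by (intro add_mono mult_right_mono) auto
    finally show "z \<in> cball 0 (R + norm b)" by simp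
  qed
  then have "emeasure lebesgue (\<Union>j. T j) \<le> emeasure lebesgue (cball (0::'a) (R + norm b))"
    by (intro emeasure_mono) auto
  also have "\<dots> < \<infinity>" using lmeasurable_cball[of "0::'a" "R + norm b"] by (simp add: fmeasurable_def)
  finally have fin: "emeasure lebesgue (\<Union>j. T j) \<noteq> top" by simp
  have "(\<Sum>j. emeasure lebesgue (T j)) = emeasure lebesgue (\<Union>j. T j)"
  proof (rule suminf_emeasure[OF _ disj])
    show "range T \<subseteq> sets lebesgue" using fmeasurableD[OF T] by (rule image_subsetI)
  qed
  then have "(\<Sum>j::nat. ennreal (measure lebesgue S)) \<noteq> top"
    using fin by (simp only: Teq not_False_eq_True)
  then have "summable (\<lambda>j::nat. measure lebesgue S)"
    by (rule summable_suminf_not_top[OF measure_nonneg])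
  then have "measure lebesgue S = 0" by (simp only: summable_const_iff)
  then show ?thesis using negligible_iff_measure0[OF S] by simp
qed

text \<open>Near a point where the derivative along b is nonzero, v is strictly monotone along b, so
  its zeros in a small closed ball meet each line parallel to b at most once. Such a set is disjoint
  from its translates along b, and this takes the place of the implicit function theorem.\<close>

lemma negligible_level_set:
  fixes v :: "'a::euclidean_space \<Rightarrow> real"
  assumes "open G" "Ck_on 1 G v"
  shows "negligible {x \<in> G. v x = 0 \<and> dir_deriv b v x \<noteq> 0}" (is "negligible ?E")
proof (subst locally_negligible_alt, rule ballI)
  fix x assume "x \<in> ?E"
  then have x: "x \<in> G" "dir_deriv b v x \<noteq> 0" by auto
  have diff: "v differentiable (at y)" if "y \<in> G" for y using assms(2) that by simp
  have cont: "continuous_on G (dir_deriv b v)" using assms(2) by simp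
  obtain d where d: "d > 0" "\<And>y. y \<in> G \<Longrightarrow> dist y x < d \<Longrightarrow> dist (dir_deriv b v y) (dir_deriv b v x) < \<bar>dir_deriv b v x\<bar>"
    using cont x unfolding continuous_on_iff by (metis zero_less_abs_iff)
  obtain r0 where r0: "r0 > 0" "cball x r0 \<subseteq> G" using assms(1) x(1) open_contains_cball by blast
  define r where "r = min r0 (d / 2)"
  have r: "r > 0" "cball x r \<subseteq> G" "r < d" using r0 d by (auto simp: r_def)
  have ne: "dir_deriv b v y \<noteq> 0" if "y \<in> cball x r" for y
    using d(2)[of y] r that by (auto simp: dist_commute dist_real_def)
  define S where "S = {y \<in> cball x r. v y = 0}"
  have "continuous_on (cball x r) v"
    using Ck_on_imp_continuous_on[OF assms(2)] r(2) continuous_on_subset by blast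
  then have "closed S" unfolding S_def
    by (intro continuous_closed_preimage_constant) auto
  then have "compact S" unfolding S_def
    by (metis (no_types, lifting) bounded_cball bounded_subset compact_eq_bounded_closed mem_Collect_eq subsetI)
  then have "negligible S"
  proof (rule negligible_disjoint_translates)
    fix y s assume y: "y \<in> S" and s: "(s::real) > 0"
    show "y + s *\<^sub>R b \<notin> S"
    proof
      assume ys: "y + s *\<^sub>R b \<in> S"
      have inc: "y + t *\<^sub>R b \<in> cball x r" if "0 \<le> t" "t \<le> s" for t
      proof -
        have "y + t *\<^sub>R b = (1 - t / s) *\<^sub>R y + (t / s) *\<^sub>R (y + s *\<^sub>R b)"
          using s by (simp add: algebra_simps)
        then show ?thesis
          using convexD_alt[OF convex_cball, of y x r "y + s *\<^sub>R b" "t / s"] y ys that s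
          by (auto simp: S_def)
      qed
      have "((\<lambda>t. v (y + t *\<^sub>R b)) has_real_derivative dir_deriv b v (y + t *\<^sub>R b)) (at t)"
        if "0 \<le> t" "t \<le> s" for t
        using inc[OF that] r diff by (intro line_derivative) auto
      from MVT2[OF s this] obtain t where t: "0 < t" "t < s"
        and "v (y + s *\<^sub>R b) - v (y + 0 *\<^sub>R b) = (s - 0) * dir_deriv b v (y + t *\<^sub>R b)" by blast
      then have "dir_deriv b v (y + t *\<^sub>R b) = 0" using y ys s by (auto simp: S_def)
      then show False using ne[OF inc[of t]] t by simp
    qed
  qed
  then have "negligible (?E \<inter> ball x r)" by (rule negligible_subset) (auto simp: S_def)
  then show "\<exists>U. openin (top_of_set ?E) U \<and> x \<in> U \<and> negligible U"
    using \<open>x \<in> ?E\<close> r(1) by (intro exI[of _ "?E \<inter> ball x r"]) (auto simp: openin_open)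
qed

text \<open>Every difference quotient integrates to 0 by translation invariance. A bounded
  derivative makes the quotients uniformly bounded, so dominated convergence passes to the
  derivative.\<close>

lemma integral_dir_deriv_eq_0:
  fixes z :: "'a::euclidean_space \<Rightarrow> real"
  assumes diff: "\<And>x. z differentiable (at x)" and cont: "continuous_on UNIV (dir_deriv b z)"
    and K: "bounded K" "\<And>x. x \<notin> K \<Longrightarrow> z x = 0"
  shows "(\<integral>x. dir_deriv b z x \<partial>lborel) = 0"
proof -
  obtain R where R: "\<And>x. x \<in> K \<Longrightarrow> norm x \<le> R" using K(1) by (auto simp: bounded_iff)
  have z0: "z x = 0" if "norm x > R" for x using R[of x] K(2)[of x] that by auto
  have "open {x::'a. norm x > R}" by (intro open_Collect_less continuous_intros)
  then have D0: "dir_deriv b z x = 0" if "norm x > R" for x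
    using dir_deriv_cong[of "{x. norm x > R}" x z "\<lambda>_. 0"] z0 that by simp
  have "bounded (dir_deriv b z ` cball 0 R)"
    using cont by (intro compact_imp_bounded compact_continuous_image) (auto intro: continuous_on_subset)
  then obtain M0 where M0: "\<And>x. norm x \<le> R \<Longrightarrow> \<bar>dir_deriv b z x\<bar> \<le> M0"
    unfolding bounded_iff by (metis image_eqI mem_cball_0 real_norm_def)
  define M where "M = max M0 0"
  have M: "\<bar>dir_deriv b z x\<bar> \<le> M" for x using M0[of x] D0[of x] by (cases "norm x \<le> R") (auto simp: M_def)
  have contz: "continuous_on UNIV z"
    using diff by (auto intro!: continuous_at_imp_continuous_on differentiable_imp_continuous_within)
  have [measurable]: "z \<in> borel_measurable borel" "dir_deriv b z \<in> borel_measurable borel"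
    using contz cont by (auto intro: borel_measurable_continuous_onI)
  have Lip: "\<bar>z (x + h *\<^sub>R b) - z x\<bar> \<le> M * h" if h: "h > 0" for x h
  proof -
    obtain t where "z (x + h *\<^sub>R b) - z (x + 0 *\<^sub>R b) = (h - 0) * dir_deriv b z (x + t *\<^sub>R b)"
      using MVT2[OF h, of "\<lambda>t. z (x + t *\<^sub>R b)", OF line_derivative[OF diff]] by blast
    then show ?thesis using M[of "x + t *\<^sub>R b"] h by (simp add: abs_mult mult.commute)
  qed
  define h where "h n = inverse (real (Suc n))" for n
  have h: "h n > 0" "h n \<le> 1" for n by (simp_all add: h_def inverse_le_1_iff)
  define q where "q n x = (z (x + h n *\<^sub>R b) - z x) / h n" for n x
  \<comment> \<open>The increments are at most 1, so all difference quotients vanish outside this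
    ball.\<close>
  define B where "B = cball (0::'a) (R + norm b)"
  have "(\<lambda>n. \<integral>x. q n x \<partial>lborel) \<longlonglongrightarrow> (\<integral>x. dir_deriv b z x \<partial>lborel)"
  proof (rule integral_dominated_convergence[where w = "\<lambda>x. indicator B x * M"])
    show "integrable lborel (\<lambda>x. indicator B x * M)"
      unfolding B_def using emeasure_bounded_finite[of "cball (0::'a) (R + norm b)"] by simp
    show "AE x in lborel. (\<lambda>n. q n x) \<longlonglongrightarrow> dir_deriv b z x"
    proof (rule AE_I2)
      fix x
      have "((\<lambda>t. z (x + t *\<^sub>R b)) has_real_derivative dir_deriv b z (x + 0 *\<^sub>R b)) (at 0)"
        by (rule line_derivative) (rule diff)
      then have lim: "((\<lambda>t. (z (x + t *\<^sub>R b) - z x) / t) \<longlongrightarrow> dir_deriv b z x) (at 0)"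
        by (simp add: DERIV_def)
      have "filterlim h (at 0) sequentially"
        unfolding filterlim_at h_def[abs_def] using LIMSEQ_inverse_real_of_nat by auto
      from filterlim_compose[OF lim this] show "(\<lambda>n. q n x) \<longlonglongrightarrow> dir_deriv b z x"
        by (simp add: q_def)
    qed
    fix n
    show "AE x in lborel. norm (q n x) \<le> indicator B x * M"
    proof (rule AE_I2)
      fix x
      show "norm (q n x) \<le> indicator B x * M"
      proof (cases "x \<in> B")
        case True
        then show ?thesis using Lip[OF h(1), of x n] h(1)[of n] by (simp add: q_def field_simps)
      next
        case False
        then have 1: "norm x > R + norm b" by (simp add: B_def)
        have "norm x \<le> norm (x + h n *\<^sub>R b) + norm (h n *\<^sub>R b)"
          by (metis add_diff_cancel_right' norm_triangle_ineq4)
        also have "norm (h n *\<^sub>R b) \<le> norm b"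
          using h[of n] by (simp add: mult_left_le_one_le)
        finally have "norm (x + h n *\<^sub>R b) > R" using 1 by simp
        moreover have "norm x > R" using 1 norm_ge_zero[of b] by linarith
        ultimately show ?thesis using False by (simp add: q_def z0)
      qed
    qed
  qed (auto simp: q_def[abs_def])
  moreover have "(\<integral>x. q n x \<partial>lborel) = 0" for n
  proof -
    have "set_integrable lborel (ball 0 (R + 1)) z"
    proof (rule set_integrable_bounded_continuous)
      have "bounded (z ` cball 0 (R + 1))"
        using contz by (intro compact_imp_bounded compact_continuous_image) (auto intro: continuous_on_subset)
      then show "bounded (z ` ball 0 (R + 1))" by (rule bounded_subset) auto
    qed (use contz in \<open>auto intro: continuous_on_subset\<close>)
    moreover have "indicator (ball 0 (R + 1)) x *\<^sub>R z x = z x" for x using z0[of x] by (auto simp: indicator_def)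
    ultimately have iz: "integrable lborel z" by (simp only: set_integrable_def)
    have "integrable lborel (\<lambda>x. z (x + h n *\<^sub>R b))"
      using integrable_distr_eq[of "(+) (h n *\<^sub>R b)" lborel borel z] iz
      by (simp add: lborel_distr_plus add.commute)
    moreover have "(\<integral>x. z x \<partial>lborel) = (\<integral>x. z (x + h n *\<^sub>R b) \<partial>lborel)"
      using lborel_integral_affine[of z 1 "h n *\<^sub>R b"] by (simp add: add.commute)
    ultimately show ?thesis using iz by (simp add: q_def)
  qed
  ultimately show ?thesis by (metis (mono_tags, lifting) LIMSEQ_unique tendsto_const tendsto_cong always_eventually)
qed

text \<open>\<open>cutoff e\<close> is an odd \<open>C\<^sup>1\<close> function with derivative \<open>cutoff' e\<close> that vanishes on \<open>[-e, e]\<close> and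
  tends to the identity as \<open>e\<close> tends to 0. Composed with a function vanishing on the boundary it has
  compact support, which replaces any regularity of the boundary in the divergence theorem.\<close>

definition soft :: "real \<Rightarrow> real \<Rightarrow> real" where
  "soft e s = sqrt ((max 0 (s - e))\<^sup>2 + e\<^sup>2) - e"

definition soft' :: "real \<Rightarrow> real \<Rightarrow> real" where
  "soft' e s = max 0 (s - e) / sqrt ((max 0 (s - e))\<^sup>2 + e\<^sup>2)"

definition cutoff :: "real \<Rightarrow> real \<Rightarrow> real" where
  "cutoff e s = soft e s - soft e (- s)"

definition cutoff' :: "real \<Rightarrow> real \<Rightarrow> real" where
  "cutoff' e s = soft' e s + soft' e (- s)"

text \<open>Squaring smooths the kink of the positive part. This is why \<open>soft\<close> uses the
  positive part squared under a root, and the added square of e keeps that root away from its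
  singularity at 0.\<close>

lemma DERIV_max_0_square: "((\<lambda>s. (max 0 s)\<^sup>2) has_real_derivative 2 * max 0 s) (at (s::real))"
proof -
  consider "s < 0" | "s = 0" | "s > 0" by linarith
  then show ?thesis
  proof cases
    case 1
    have "((\<lambda>s::real. 0) has_real_derivative 0) (at s)" by simp
    then have "((\<lambda>s. (max 0 s)\<^sup>2) has_real_derivative 0) (at s)"
      by (rule has_field_derivative_transform_within_open[of _ _ _ "{..<0}"]) (use 1 in auto)
    then show ?thesis using 1 by simp
  next
    case 2
    have "(\<lambda>h. ((max 0 (0 + h))\<^sup>2 - (max 0 0)\<^sup>2) / h) \<midarrow>0\<rightarrow> (0::real)"
    proof (rule Lim_null_comparison)
      show "\<forall>\<^sub>F h in at 0. norm (((max 0 (0 + h))\<^sup>2 - (max 0 0)\<^sup>2) / h) \<le> \<bar>h::real\<bar>"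
        by (intro always_eventually allI) (auto simp: max_def power2_eq_square)
      show "((\<lambda>h. \<bar>h\<bar>) \<longlongrightarrow> 0) (at (0::real))" by (auto intro!: tendsto_eq_intros)
    qed
    then show ?thesis using 2 by (simp add: DERIV_def)
  next
    case 3
    have "((\<lambda>s. s\<^sup>2) has_real_derivative 2 * s) (at s)" by (auto intro!: derivative_eq_intros)
    then have "((\<lambda>s. (max 0 s)\<^sup>2) has_real_derivative 2 * s) (at s)"
      by (rule has_field_derivative_transform_within_open[of _ _ _ "{0<..}"]) (use 3 in auto)
    then show ?thesis using 3 by simp
  qed
qed

lemma soft_denominator: "e > 0 \<Longrightarrow> 0 < (max 0 (s - e))\<^sup>2 + (e::real)\<^sup>2"
  by (simp add: add_nonneg_pos)

lemma DERIV_soft: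
  assumes "e > 0"
  shows "(soft e has_real_derivative soft' e s) (at s)"
proof -
  have 1: "((\<lambda>s. (max 0 (s - e))\<^sup>2) has_real_derivative 2 * max 0 (s - e)) (at s)"
    using DERIV_shift[of "\<lambda>s. (max 0 s)\<^sup>2" _ s "- e"] DERIV_max_0_square[of "s - e"] by simp
  have "((\<lambda>s. (max 0 (s - e))\<^sup>2 + e\<^sup>2) has_real_derivative 2 * max 0 (s - e)) (at s)"
    using DERIV_add[OF 1 DERIV_const] by simp
  from DERIV_diff[OF DERIV_chain2[OF DERIV_real_sqrt[OF soft_denominator[OF assms]] this] DERIV_const]
  have "((\<lambda>s. sqrt ((max 0 (s - e))\<^sup>2 + e\<^sup>2) - e) has_real_derivative
      (inverse (sqrt ((max 0 (s - e))\<^sup>2 + e\<^sup>2)) / 2) * (2 * max 0 (s - e))) (at s)"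
    by simp
  then show ?thesis by (simp add: soft_def[abs_def] soft'_def field_simps)
qed

lemma DERIV_cutoff:
  assumes "e > 0"
  shows "(cutoff e has_real_derivative cutoff' e s) (at s)"
proof -
  have "((\<lambda>s. soft e (- s)) has_real_derivative soft' e (- s) * (- 1)) (at s)"
    by (rule DERIV_chain2[OF DERIV_soft[OF assms]]) (auto intro!: derivative_eq_intros)
  then show ?thesis
    unfolding cutoff_def[abs_def] cutoff'_def using DERIV_diff[OF DERIV_soft[OF assms, of s]] by fastforce
qed

lemma continuous_on_cutoff': "e > 0 \<Longrightarrow> continuous_on UNIV (cutoff' e)"
  unfolding cutoff'_def[abs_def] soft'_def
  using soft_denominator[of e] by (intro continuous_intros) (auto simp: less_imp_neq[symmetric])

lemma continuous_on_cutoff: "e > 0 \<Longrightarrow> continuous_on UNIV (cutoff e)"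
  by (meson DERIV_continuous_on DERIV_cutoff has_field_derivative_at_within)

lemma cutoff_eq_0: "e > 0 \<Longrightarrow> \<bar>s\<bar> \<le> e \<Longrightarrow> cutoff e s = 0"
  by (simp add: cutoff_def soft_def)

lemma soft_bounds:
  assumes "e > 0"
  shows "0 \<le> soft e s" "soft e s \<le> \<bar>s\<bar>"
proof -
  let ?m = "max 0 (s - e)"
  have "e \<le> sqrt (?m\<^sup>2 + e\<^sup>2)" by (rule real_le_rsqrt) simp
  then show "0 \<le> soft e s" by (simp add: soft_def)
  have "sqrt (?m\<^sup>2 + e\<^sup>2) \<le> ?m + e"
    using sqrt_add_le_add_sqrt[of "?m\<^sup>2" "e\<^sup>2"] assms by simp
  then show "soft e s \<le> \<bar>s\<bar>" using assms by (auto simp: soft_def)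
qed

lemma abs_cutoff_le: "e > 0 \<Longrightarrow> \<bar>cutoff e s\<bar> \<le> \<bar>s\<bar>"
  using soft_bounds[of e s] soft_bounds[of e "- s"] unfolding cutoff_def by linarith

lemma soft'_bounds:
  assumes "e > 0"
  shows "0 \<le> soft' e s" "soft' e s \<le> 1"
proof -
  let ?m = "max 0 (s - e)"
  have "?m \<le> sqrt (?m\<^sup>2 + e\<^sup>2)" by (rule real_le_rsqrt) simp
  then show "soft' e s \<le> 1"
    unfolding soft'_def using soft_denominator[OF assms, of s] by (subst divide_le_eq_1_pos) auto
  show "0 \<le> soft' e s" unfolding soft'_def by (intro divide_nonneg_nonneg) auto
qed

lemma abs_cutoff'_le: "e > 0 \<Longrightarrow> \<bar>cutoff' e s\<bar> \<le> 2"
  using soft'_bounds[of e s] soft'_bounds[of e "- s"] by (auto simp: cutoff'_def)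

lemma tendsto_cutoff: "((\<lambda>e. cutoff e s) \<longlongrightarrow> s) (at_right 0)"
proof -
  \<comment> \<open>The formula still makes sense at e = 0, where it is the identity, so the limit
    is continuity in e.\<close>
  have "((\<lambda>e. cutoff e s) \<longlongrightarrow> cutoff 0 s) (at_right 0)"
    unfolding cutoff_def soft_def by (intro tendsto_intros)
  then show ?thesis by (simp add: cutoff_def soft_def max_def split: if_splits)
qed

lemma tendsto_soft': "((\<lambda>e. soft' e s) \<longlongrightarrow> (if s > 0 then 1 else 0)) (at_right 0)"
proof (cases "s > 0")
  case True
  have "((\<lambda>e. soft' e s) \<longlongrightarrow> soft' 0 s) (at_right 0)"
    unfolding soft'_def using True by (intro tendsto_intros) auto
  then show ?thesis using True by (simp add: soft'_def)
next
  case False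
  have "\<forall>\<^sub>F e in at_right 0. soft' e s = 0"
    using eventually_at_right_less[of "0::real"]
    by (rule eventually_mono) (use False in \<open>auto simp: soft'_def\<close>)
  then show ?thesis using False by (simp add: tendsto_eventually)
qed

lemma tendsto_cutoff': "((\<lambda>e. cutoff' e s) \<longlongrightarrow> (if s = 0 then 0 else 1)) (at_right 0)"
proof -
  have "((\<lambda>e. cutoff' e s) \<longlongrightarrow> (if s > 0 then 1 else 0) + (if - s > 0 then 1 else 0)) (at_right 0)"
    unfolding cutoff'_def by (intro tendsto_add tendsto_soft')
  then show ?thesis by (auto split: if_splits)
qed

text \<open>Continuity of \<open>zext G v\<close> on the whole space is how "continuous with
  boundary value 0" is expressed from here on, free of traces and of any regularity of the boundary
  of G.\<close>

definition zext :: "'a set \<Rightarrow> ('a \<Rightarrow> real) \<Rightarrow> 'a \<Rightarrow> real" where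
  "zext G v x = (if x \<in> G then v x else 0)"

lemma dir_deriv_mult_cutoff:
  fixes w v :: "'a::euclidean_space \<Rightarrow> real"
  assumes "e > 0" "w differentiable (at x)" "v differentiable (at x)"
  shows "(\<lambda>x. w x * cutoff e (v x)) differentiable (at x)"
    and "dir_deriv b (\<lambda>x. w x * cutoff e (v x)) x
      = dir_deriv b w x * cutoff e (v x) + w x * (cutoff' e (v x) * dir_deriv b v x)"
proof -
  let ?D = "\<lambda>b. w x * (cutoff' e (v x) * frechet_derivative v (at x) b) + frechet_derivative w (at x) b * cutoff e (v x)"
  have w: "(w has_derivative frechet_derivative w (at x)) (at x)"
    and v: "(v has_derivative frechet_derivative v (at x)) (at x)"
    using assms frechet_derivative_works by blast+
  have "(cutoff e has_derivative (*) (cutoff' e (v x))) (at (v x))"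
    using DERIV_cutoff[OF assms(1)] by (simp add: has_field_derivative_def)
  from has_derivative_compose[OF v this]
  have "((\<lambda>x. cutoff e (v x)) has_derivative (\<lambda>b. cutoff' e (v x) * frechet_derivative v (at x) b)) (at x)" .
  from has_derivative_mult[OF w this]
  have D: "((\<lambda>x. w x * cutoff e (v x)) has_derivative ?D) (at x)" .
  then show "(\<lambda>x. w x * cutoff e (v x)) differentiable (at x)" by (rule differentiableI)
  show "dir_deriv b (\<lambda>x. w x * cutoff e (v x)) x
      = dir_deriv b w x * cutoff e (v x) + w x * (cutoff' e (v x) * dir_deriv b v x)"
    using fun_cong[OF frechet_derivative_at[OF D], of b] by simp
qed

text \<open>The cutoff product vanishes wherever |v| < e, and the remaining set K is compact in G
  because the zero extension of v is continuous. Hence the product extended by 0 is continuously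
  differentiable on the whole space, as G and the complement of K form an open cover, and
  \<open>integral_dir_deriv_eq_0\<close> applies.\<close>

lemma integral_dir_deriv_cutoff:
  fixes w v :: "'a::euclidean_space \<Rightarrow> real" and b :: 'a
  assumes G: "open G" "bounded G" and C1: "Ck_on 1 G w" "Ck_on 1 G v"
    and zv: "continuous_on UNIV (zext G v)" and e: "e > 0"
  defines "d \<equiv> \<lambda>x. dir_deriv b w x * cutoff e (v x) + w x * (cutoff' e (v x) * dir_deriv b v x)"
  shows "set_integrable lborel G d" "(LINT x:G|lborel. d x) = 0"
proof -
  define z where "z = zext G (\<lambda>x. w x * cutoff e (v x))"
  define K where "K = {x. e \<le> \<bar>zext G v x\<bar>}"
  have "closed K" unfolding K_def by (intro closed_Collect_le continuous_intros zv)
  then have opK: "open (- K)" by auto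
  have KG: "K \<subseteq> G" using e by (auto simp: K_def zext_def split: if_splits)
  have bK: "bounded K" using bounded_subset[OF G(2) KG] .
  then have cK: "compact K" using \<open>closed K\<close> by (simp add: compact_eq_bounded_closed)
  have cov: "x \<in> - K" if "x \<notin> G" for x using KG that by auto
  have z0: "z x = 0" if "x \<in> - K" for x
    using that cutoff_eq_0[OF e, of "v x"] by (auto simp: z_def K_def zext_def)
  have dw: "w differentiable (at x)" "v differentiable (at x)" if "x \<in> G" for x
    using C1 that by auto
  have zdiff: "z differentiable (at x)" for x
  proof (cases "x \<in> G")
    case True
    show ?thesis
      by (rule differentiable_cong_open[OF G(1) True _ dir_deriv_mult_cutoff(1)[OF e dw[OF True]]])
        (simp add: z_def zext_def)
  next
    case False
    show ?thesis
      by (rule differentiable_cong_open[OF opK cov[OF False], of "\<lambda>_. 0"]) (simp_all add: z0)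
  qed
  have zG: "dir_deriv b z x = d x" if "x \<in> G" for x
  proof -
    have "dir_deriv b z x = dir_deriv b (\<lambda>x. w x * cutoff e (v x)) x"
      by (rule fun_cong[OF dir_deriv_cong[OF G(1) that]]) (simp add: z_def zext_def)
    then show ?thesis using dir_deriv_mult_cutoff(2)[OF e dw[OF that]] by (simp add: d_def)
  qed
  have zK: "dir_deriv b z x = 0" if "x \<in> - K" for x
    using fun_cong[OF dir_deriv_cong[OF opK that, of z "\<lambda>_. 0"], of b] z0 by simp
  have cwv: "continuous_on G w" "continuous_on G v" using C1 Ck_on_imp_continuous_on by blast+
  have cd: "continuous_on G d"
    unfolding d_def
    using C1 e cwv continuous_on_compose2[OF continuous_on_cutoff[OF e] cwv(2)]
      continuous_on_compose2[OF continuous_on_cutoff'[OF e] cwv(2)]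
    by (intro continuous_intros) auto
  have "continuous_on G (dir_deriv b z)" using continuous_on_eq[OF cd] zG by simp
  moreover have "continuous_on (- K) (dir_deriv b z)"
    by (rule continuous_on_eq[of _ "\<lambda>_. 0"]) (simp_all add: zK)
  ultimately have "continuous_on (G \<union> - K) (dir_deriv b z)"
    by (intro continuous_on_open_Un G(1) opK)
  moreover have "G \<union> - K = UNIV" using KG by auto
  ultimately have cz: "continuous_on UNIV (dir_deriv b z)" by simp
  have int0: "(\<integral>x. dir_deriv b z x \<partial>lborel) = 0"
    using z0 by (intro integral_dir_deriv_eq_0[OF zdiff cz bK]) auto
  have eq: "indicator G x *\<^sub>R d x = dir_deriv b z x" for x
    using zG[of x] zK[OF cov, of x] by (auto simp: indicator_def)
  show "(LINT x:G|lborel. d x) = 0" unfolding set_lebesgue_integral_def eq by (rule int0)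
  show "set_integrable lborel G d"
  proof (rule set_integrable_bounded_continuous[OF G cd])
    have "bounded (dir_deriv b z ` K)"
      using cz cK by (intro compact_imp_bounded compact_continuous_image) (auto intro: continuous_on_subset)
    then have "bounded (insert 0 (dir_deriv b z ` K))" by simp
    then show "bounded (d ` G)"
    proof (rule bounded_subset, intro image_subsetI)
      fix x assume "x \<in> G"
      then show "d x \<in> insert 0 (dir_deriv b z ` K)" using zK[of x] by (cases "x \<in> K") (auto simp flip: zG)
    qed
  qed
qed

section \<open>Removing the cutoff: integration by parts on a bounded open set\<close>

lemma set_integral_sum:
  fixes f :: "'i \<Rightarrow> 'a \<Rightarrow> real"
  assumes "\<And>i. i \<in> I \<Longrightarrow> set_integrable M G (f i)"
  shows "(LINT x:G|M. \<Sum>i\<in>I. f i x) = (\<Sum>i\<in>I. LINT x:G|M. f i x)"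
  using assms unfolding set_lebesgue_integral_def set_integrable_def scaleR_sum_right
  by (rule Bochner_Integration.integral_sum)

lemma bounded_image_mult:
  fixes f h :: "'a \<Rightarrow> real"
  assumes "bounded (f ` G)" "bounded (h ` G)"
  shows "bounded ((\<lambda>x. f x * h x) ` G)"
proof -
  obtain A B where "\<And>x. x \<in> G \<Longrightarrow> \<bar>f x\<bar> \<le> A" "\<And>x. x \<in> G \<Longrightarrow> \<bar>h x\<bar> \<le> B"
    using assms unfolding bounded_iff by (metis image_eqI real_norm_def)
  then have "\<bar>f x * h x\<bar> \<le> A * B" if "x \<in> G" for x
    unfolding abs_mult using that by (intro mult_mono) (auto intro: order_trans[OF abs_ge_zero])
  then show ?thesis by (auto simp: bounded_iff)
qed

lemma bounded_image_sum:
  fixes f :: "'i \<Rightarrow> 'a \<Rightarrow> real"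
  assumes "\<And>i. i \<in> I \<Longrightarrow> bounded (f i ` G)"
  shows "bounded ((\<lambda>x. \<Sum>i\<in>I. f i x) ` G)"
  using assms
proof (induction I rule: infinite_finite_induct)
  case (insert i I)
  have "bounded ((\<lambda>x. f i x + (\<Sum>i\<in>I. f i x)) ` G)"
    using insert by (intro bounded_plus_comp) auto
  then show ?case using insert.hyps by simp
qed (auto simp: bounded_iff)

text \<open>Only the divergence of \<open>W\<close> is assumed bounded, not the individual derivatives: for a regular
  solution the derivatives of order \<open>2m\<close> may blow up at the boundary. In the limit of the cutoffs the
  factor \<open>cutoff' e (v x)\<close> is lost where \<open>v = 0\<close>, which is harmless since \<open>{v = 0, Dv \<noteq> 0}\<close> is a null set.\<close>

theorem integration_by_parts:
  fixes W :: "'a::euclidean_space \<Rightarrow> 'a \<Rightarrow> real" and v :: "'a \<Rightarrow> real"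
  assumes G: "open G" "bounded G"
    and W: "\<And>b. b \<in> Basis \<Longrightarrow> Ck_on 1 G (W b)" "\<And>b. b \<in> Basis \<Longrightarrow> bounded (W b ` G)"
    and divW: "bounded ((\<lambda>x. \<Sum>b\<in>Basis. dir_deriv b (W b) x) ` G)"
    and v: "Ck_on 1 G v" "\<And>b. b \<in> Basis \<Longrightarrow> bounded (dir_deriv b v ` G)"
    and zv: "continuous_on UNIV (zext G v)"
  shows "(LINT x:G|lborel. (\<Sum>b\<in>Basis. dir_deriv b (W b) x) * v x)
     = - (LINT x:G|lborel. \<Sum>b\<in>Basis. W b x * dir_deriv b v x)"
proof -
  let ?div = "\<lambda>x. \<Sum>b\<in>Basis. dir_deriv b (W b) x"
  let ?g = "\<lambda>x. \<Sum>b\<in>Basis. W b x * dir_deriv b v x"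
  have cv: "continuous_on G v" and cdv: "continuous_on G (dir_deriv b v)" for b
    using Ck_on_imp_continuous_on[OF v(1)] v(1) by auto
  have cW: "continuous_on G (W b)" "continuous_on G (dir_deriv b (W b))" if "b \<in> Basis" for b
    using Ck_on_imp_continuous_on[OF W(1)[OF that]] W(1)[OF that] by auto
  have cdiv: "continuous_on G ?div" and cg: "continuous_on G ?g"
    using cW cdv by (intro continuous_intros; simp)+
  have bv: "bounded (v ` G)"
  proof -
    have "bounded (zext G v ` closure G)"
      using zv G by (intro compact_imp_bounded compact_continuous_image) (auto intro: continuous_on_subset)
    then show ?thesis
      by (rule bounded_subset) (use closure_subset in \<open>force simp: zext_def\<close>)
  qed
  have bg: "bounded (?g ` G)"
    using W v by (intro bounded_image_sum bounded_image_mult) auto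
  obtain Bd where Bd: "\<And>x. x \<in> G \<Longrightarrow> \<bar>?div x\<bar> \<le> Bd" using divW by (auto simp: bounded_iff)
  obtain Bg where Bg: "\<And>x. x \<in> G \<Longrightarrow> \<bar>?g x\<bar> \<le> Bg" using bg by (auto simp: bounded_iff)
  obtain Bv where Bv: "\<And>x. x \<in> G \<Longrightarrow> \<bar>v x\<bar> \<le> Bv" using bv by (auto simp: bounded_iff)
  define h where "h n = inverse (real (Suc n))" for n
  have h: "h n > 0" for n by (simp add: h_def)
  have limh: "filterlim h (at_right 0) sequentially"
    unfolding filterlim_at h_def[abs_def] using LIMSEQ_inverse_real_of_nat by auto
  define A where "A n x = ?div x * cutoff (h n) (v x)" for n x
  define C where "C n x = ?g x * cutoff' (h n) (v x)" for n x
  have cA: "continuous_on G (A n)" for n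
    unfolding A_def by (intro continuous_on_mult cdiv continuous_on_compose2[OF continuous_on_cutoff[OF h] cv]) auto
  have cC: "continuous_on G (C n)" for n
    unfolding C_def by (intro continuous_on_mult cg continuous_on_compose2[OF continuous_on_cutoff'[OF h] cv]) auto
  have bA: "\<bar>A n x\<bar> \<le> Bd * Bv" if "x \<in> G" for n x
    unfolding A_def abs_mult
    using Bd[OF that] order_trans[OF abs_cutoff_le[OF h] Bv[OF that]] by (intro mult_mono) auto
  have bC: "\<bar>C n x\<bar> \<le> Bg * 2" if "x \<in> G" for n x
    unfolding C_def abs_mult
    using Bg[OF that] abs_cutoff'_le[OF h] by (intro mult_mono) auto
  have iA: "set_integrable lborel G (A n)" for n
    by (rule set_integrable_bounded_continuous[OF G cA]) (auto simp: bounded_iff intro!: exI bA)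
  have iC: "set_integrable lborel G (C n)" for n
    by (rule set_integrable_bounded_continuous[OF G cC]) (auto simp: bounded_iff intro!: exI bC)
  \<comment> \<open>By the product rule, \<open>A n\<close> + \<open>C n\<close> is the divergence
    of the field with components W b * cutoff (h n) (v).\<close>
  have sum0: "(LINT x:G|lborel. A n x) + (LINT x:G|lborel. C n x) = 0" for n
  proof -
    let ?d = "\<lambda>b x. dir_deriv b (W b) x * cutoff (h n) (v x) + W b x * (cutoff' (h n) (v x) * dir_deriv b v x)"
    have d: "set_integrable lborel G (?d b)" "(LINT x:G|lborel. ?d b x) = 0" if "b \<in> Basis" for b
      using integral_dir_deriv_cutoff[OF G W(1)[OF that] v(1) zv h, of b n] by auto
    have "A n x + C n x = (\<Sum>b\<in>Basis. ?d b x)" for x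
      unfolding A_def C_def sum_distrib_right sum.distrib by (simp add: mult_ac)
    then have "(LINT x:G|lborel. A n x + C n x) = (LINT x:G|lborel. \<Sum>b\<in>Basis. ?d b x)" by simp
    also have "\<dots> = (\<Sum>b\<in>Basis. LINT x:G|lborel. ?d b x)"
      using d(1) by (rule set_integral_sum)
    also have "\<dots> = 0" using d(2) by simp
    finally show ?thesis using iA iC by (simp add: set_integral_add)
  qed
  \<comment> \<open>The limit f may be discontinuous, since for C it carries the factor that
    vanishes on v = 0; its measurability is inherited from the sequence.\<close>
  have dct: "(\<lambda>n. LINT x:G|lborel. F n x) \<longlonglongrightarrow> (LINT x:G|lborel. f x)"
    if cF: "\<And>n. continuous_on G (F n)" and bF: "\<And>n x. x \<in> G \<Longrightarrow> \<bar>F n x\<bar> \<le> B"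
      and lim: "\<And>x. x \<in> G \<Longrightarrow> (\<lambda>n. F n x) \<longlonglongrightarrow> f x" for F :: "nat \<Rightarrow> 'a \<Rightarrow> real" and f B
  proof -
    have F[measurable]: "(\<lambda>x. indicator G x *\<^sub>R F n x) \<in> borel_measurable borel" for n
      using G(1) cF by (intro borel_measurable_continuous_on_indicator) auto
    have l: "(\<lambda>n. indicator G x *\<^sub>R F n x) \<longlonglongrightarrow> indicator G x *\<^sub>R f x" for x
      using lim[of x] by (cases "x \<in> G") auto
    have f: "(\<lambda>x. indicator G x *\<^sub>R f x) \<in> borel_measurable borel"
      by (rule borel_measurable_LIMSEQ_real[OF l F])
    show ?thesis
      unfolding set_lebesgue_integral_def
    proof (rule integral_dominated_convergence[where w = "\<lambda>x. indicator G x * B"])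
      show "integrable lborel (\<lambda>x. indicator G x * B)"
        using emeasure_bounded_finite[OF G(2)] G(1) by simp
      show "AE x in lborel. norm (indicator G x *\<^sub>R F n x) \<le> indicator G x * B" for n
        using bF by (auto simp: indicator_def)
    qed (use f F l in simp_all)
  qed
  have "(\<lambda>n. LINT x:G|lborel. A n x) \<longlonglongrightarrow> (LINT x:G|lborel. ?div x * v x)"
    unfolding A_def
    by (rule dct[OF cA[unfolded A_def] bA[unfolded A_def]], assumption)
      (intro tendsto_mult tendsto_const filterlim_compose[OF tendsto_cutoff limh])
  moreover have "(\<lambda>n. LINT x:G|lborel. C n x) \<longlonglongrightarrow> (LINT x:G|lborel. ?g x * (if v x = 0 then 0 else 1))"
    unfolding C_def
    by (rule dct[OF cC[unfolded C_def] bC[unfolded C_def]], assumption)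
      (intro tendsto_mult tendsto_const filterlim_compose[OF tendsto_cutoff' limh])
  ultimately have "(\<lambda>n. 0) \<longlonglongrightarrow> (LINT x:G|lborel. ?div x * v x) + (LINT x:G|lborel. ?g x * (if v x = 0 then 0 else 1))"
    using tendsto_add sum0 by fastforce
  then have "(LINT x:G|lborel. ?div x * v x) + (LINT x:G|lborel. ?g x * (if v x = 0 then 0 else 1)) = 0"
    by (simp add: LIMSEQ_const_iff)
  moreover have "(LINT x:G|lborel. ?g x * (if v x = 0 then 0 else 1)) = (LINT x:G|lborel. ?g x)"
  proof -
    \<comment> \<open>Negligibility refers to the completed measure; the return to
      \<open>lborel\<close> is made on the level of AE statements.\<close>
    have "AE x in lebesgue. \<forall>b\<in>Basis. \<not> (x \<in> G \<and> v x = 0 \<and> dir_deriv b v x \<noteq> 0)"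
    proof (subst AE_ball_countable)
      show "countable (Basis :: 'a set)" by (simp add: countable_finite)
      show "\<forall>b\<in>Basis. AE x in lebesgue. \<not> (x \<in> G \<and> v x = 0 \<and> dir_deriv b v x \<noteq> 0)"
      proof
        fix b :: 'a
        have "{x \<in> G. v x = 0 \<and> dir_deriv b v x \<noteq> 0} \<in> null_sets lebesgue"
          using negligible_level_set[OF G(1) v(1)] by (simp add: negligible_iff_null_sets)
        from AE_not_in[OF this] show "AE x in lebesgue. \<not> (x \<in> G \<and> v x = 0 \<and> dir_deriv b v x \<noteq> 0)" by simp
      qed
    qed
    then have "AE x in lborel. \<forall>b\<in>Basis. \<not> (x \<in> G \<and> v x = 0 \<and> dir_deriv b v x \<noteq> 0)"
      by (simp only: AE_completion_iff)
    then have ae: "AE x in lborel. indicator G x *\<^sub>R (?g x * (if v x = 0 then 0 else 1)) = indicator G x *\<^sub>R ?g x"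
      by eventually_elim (auto simp: indicator_def intro!: sum.neutral)
    have m1: "(\<lambda>x. indicator G x *\<^sub>R ?g x) \<in> borel_measurable borel"
      using G(1) cg by (intro borel_measurable_continuous_on_indicator) auto
    \<comment> \<open>Measurability of v is available only after multiplication by the indicator of
      G, so the test v = 0 is made on that product; outside G both sides are 0.\<close>
    have "(\<lambda>x. indicator G x *\<^sub>R v x) \<in> borel_measurable borel"
      using G(1) cv by (intro borel_measurable_continuous_on_indicator) auto
    then have "(\<lambda>x. (indicator G x *\<^sub>R ?g x) * (if indicator G x *\<^sub>R v x = 0 then 0 else 1)) \<in> borel_measurable borel"
      using m1 by measurable
    moreover have "(indicator G x *\<^sub>R ?g x) * (if indicator G x *\<^sub>R v x = 0 then 0 else 1)
       = indicator G x *\<^sub>R (?g x * (if v x = 0 then 0 else 1))" for x by (auto simp: indicator_def)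
    ultimately have m2: "(\<lambda>x. indicator G x *\<^sub>R (?g x * (if v x = 0 then 0 else 1))) \<in> borel_measurable borel"
      by (simp only:)
    show ?thesis unfolding set_lebesgue_integral_def using m1 m2 ae by (intro integral_cong_AE) auto
  qed
  ultimately show ?thesis by simp
qed

section \<open>The boundary of a smooth domain\<close>

lemma grad_inner:
  assumes "\<rho> differentiable (at x)"
  shows "grad \<rho> x \<bullet> v = dir_deriv v \<rho> x"
proof -
  have lin: "linear (frechet_derivative \<rho> (at x))" using linear_frechet_derivative[OF assms] .
  have "dir_deriv v \<rho> x = frechet_derivative \<rho> (at x) (\<Sum>b\<in>Basis. (v \<bullet> b) *\<^sub>R b)"
    by (simp add: euclidean_representation)
  also have "\<dots> = (\<Sum>b\<in>Basis. (v \<bullet> b) * dir_deriv b \<rho> x)"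
    using lin by (simp add: linear_sum linear_cmul)
  finally show ?thesis by (simp add: grad_def inner_sum_left inner_commute[of v] mult.commute)
qed

lemma defining_functionD:
  assumes "defining_function \<Omega> U \<rho>"
  shows "open U" "\<And>k. Ck_on k U \<rho>" "\<And>y. y \<in> U \<Longrightarrow> \<rho> differentiable (at y)"
    "\<And>y. y \<in> U \<Longrightarrow> grad \<rho> y \<noteq> 0" "\<And>y. y \<in> U \<Longrightarrow> y \<in> \<Omega> \<longleftrightarrow> \<rho> y < 0"
proof -
  have "Ck_on 1 U \<rho>" using assms by (simp add: defining_function_def smooth_on_def del: Ck_on.simps)
  then show "\<And>y. y \<in> U \<Longrightarrow> \<rho> differentiable (at y)" by simp
qed (use assms in \<open>auto simp: defining_function_def smooth_on_def\<close>)

lemma defining_function_eq_0: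
  assumes df: "defining_function \<Omega> U \<rho>" and "open \<Omega>" and x: "x \<in> frontier \<Omega>" "x \<in> U"
  shows "\<rho> x = 0"
proof (rule antisym)
  have "x \<notin> \<Omega>" using assms(2) x(1) by (simp add: frontier_def interior_open)
  then show "0 \<le> \<rho> x" using defining_functionD(5)[OF df x(2)] by simp
  show "\<rho> x \<le> 0"
  proof (rule ccontr)
    assume "\<not> \<rho> x \<le> 0"
    have "continuous_on U \<rho>" using Ck_on_imp_continuous_on[OF defining_functionD(2)[OF df]] .
    then have "open (U \<inter> \<rho> -` {0<..})"
      by (rule continuous_open_preimage[OF _ defining_functionD(1)[OF df] open_greaterThan])
    moreover have "x \<in> U \<inter> \<rho> -` {0<..}" using x \<open>\<not> \<rho> x \<le> 0\<close> by simp
    moreover have "x \<in> closure \<Omega>" using x(1) by (simp add: frontier_def)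
    ultimately obtain y where "y \<in> \<Omega>" "y \<in> U \<inter> \<rho> -` {0<..}"
      unfolding closure_iff_nhds_not_empty by (metis disjoint_iff order_refl)
    then show False using defining_functionD(5)[OF df] by fastforce
  qed
qed

lemma sign_along_direction:
  assumes "\<rho> differentiable (at x)" "\<rho> x = 0" "open U" "x \<in> U"
  shows "grad \<rho> x \<bullet> v < 0 \<Longrightarrow> \<exists>d>0. \<forall>s. 0 < s \<longrightarrow> s < d \<longrightarrow> x + s *\<^sub>R v \<in> U \<and> \<rho> (x + s *\<^sub>R v) < 0"
    and "grad \<rho> x \<bullet> v > 0 \<Longrightarrow> \<exists>d>0. \<forall>s. 0 < s \<longrightarrow> s < d \<longrightarrow> x + s *\<^sub>R v \<in> U \<and> \<rho> (x + s *\<^sub>R v) > 0"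
proof -
  have D: "((\<lambda>t. \<rho> (x + t *\<^sub>R v)) has_real_derivative grad \<rho> x \<bullet> v) (at 0)"
    using line_derivative[of \<rho> x 0 v] assms(1) by (simp add: grad_inner)
  have "continuous (at 0) (\<lambda>t. x + t *\<^sub>R v)" by (intro continuous_intros)
  then have "\<exists>d>0. \<forall>s. dist s 0 < d \<longrightarrow> x + s *\<^sub>R v \<in> U"
    using assms(3,4) unfolding continuous_at_open
    by (metis (no_types, lifting) add.right_neutral open_contains_ball_eq mem_ball dist_commute scale_zero_left subset_eq)
  then obtain d0 where d0: "d0 > 0" "\<And>s. \<bar>s\<bar> < d0 \<Longrightarrow> x + s *\<^sub>R v \<in> U" by (auto simp: dist_real_def)
  show "\<exists>d>0. \<forall>s. 0 < s \<longrightarrow> s < d \<longrightarrow> x + s *\<^sub>R v \<in> U \<and> \<rho> (x + s *\<^sub>R v) < 0" if neg: "grad \<rho> x \<bullet> v < 0"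
  proof -
    obtain d where "d > 0" "\<And>h. h > 0 \<Longrightarrow> h < d \<Longrightarrow> \<rho> (x + h *\<^sub>R v) < \<rho> x"
      using DERIV_neg_dec_right[OF D neg] by auto
    then show ?thesis using d0 assms(2) by (intro exI[of _ "min d d0"]) auto
  qed
  show "\<exists>d>0. \<forall>s. 0 < s \<longrightarrow> s < d \<longrightarrow> x + s *\<^sub>R v \<in> U \<and> \<rho> (x + s *\<^sub>R v) > 0" if pos: "grad \<rho> x \<bullet> v > 0"
  proof -
    obtain d where "d > 0" "\<And>h. h > 0 \<Longrightarrow> h < d \<Longrightarrow> \<rho> (x + h *\<^sub>R v) > \<rho> x"
      using DERIV_pos_inc_right[OF D pos] by auto
    then show ?thesis using d0 assms(2) by (intro exI[of _ "min d d0"]) auto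
  qed
qed

lemma inner_lt_1_if_unit:
  fixes a b :: "'a::real_inner"
  assumes "norm a = 1" "norm b = 1" "a \<noteq> b"
  shows "a \<bullet> b < 1"
proof -
  have "0 < (norm (a - b))\<^sup>2" using assms(3) by simp
  also have "(norm (a - b))\<^sup>2 = (norm a)\<^sup>2 + (norm b)\<^sup>2 - 2 * (a \<bullet> b)"
    unfolding power2_norm_eq_inner by (simp add: inner_diff_left inner_diff_right inner_commute)
  finally show ?thesis using assms(1,2) by simp
qed

text \<open>If the unit gradients n and n' differed, then n . n' < 1, and the direction n' - n would
  lead into \<Omega> according to \<rho> and out of it according to \<rho>'.\<close>

lemma unit_grad_unique:
  assumes "open \<Omega>" "x \<in> frontier \<Omega>"
    and df1: "defining_function \<Omega> U \<rho>" "x \<in> U" and df2: "defining_function \<Omega> U' \<rho>'" "x \<in> U'"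
  shows "grad \<rho> x /\<^sub>R norm (grad \<rho> x) = grad \<rho>' x /\<^sub>R norm (grad \<rho>' x)"
proof (rule ccontr)
  let ?n = "grad \<rho> x /\<^sub>R norm (grad \<rho> x)" and ?n' = "grad \<rho>' x /\<^sub>R norm (grad \<rho>' x)"
  assume ne: "?n \<noteq> ?n'"
  have g: "grad \<rho> x \<noteq> 0" "grad \<rho>' x \<noteq> 0" using defining_functionD(4) df1 df2 by blast+
  then have unit: "norm ?n = 1" "norm ?n' = 1" by simp_all
  have lt: "?n \<bullet> ?n' < 1" using inner_lt_1_if_unit[OF unit ne] .
  define v where "v = ?n' - ?n"
  have nn: "?n \<bullet> ?n = 1" "?n' \<bullet> ?n' = 1" using unit by (simp_all only: dot_square_norm) simp_all
  have "?n \<bullet> v < 0" using lt nn by (simp only: v_def inner_diff_right)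
  then have 1: "grad \<rho> x \<bullet> v < 0" using g by (simp add: field_simps zero_less_mult_iff mult_less_0_iff)
  have "?n' \<bullet> v > 0" using lt nn by (simp only: v_def inner_diff_right inner_commute[of ?n' ?n])
  then have 2: "grad \<rho>' x \<bullet> v > 0" using g by (simp add: field_simps zero_less_mult_iff)
  obtain d where d: "d > 0" "\<And>s. 0 < s \<Longrightarrow> s < d \<Longrightarrow> x + s *\<^sub>R v \<in> U \<and> \<rho> (x + s *\<^sub>R v) < 0"
    using sign_along_direction(1)[OF defining_functionD(3)[OF df1] defining_function_eq_0[OF df1(1) assms(1,2) df1(2)] defining_functionD(1)[OF df1(1)] df1(2) 1] by blast
  obtain d' where d': "d' > 0" "\<And>s. 0 < s \<Longrightarrow> s < d' \<Longrightarrow> x + s *\<^sub>R v \<in> U' \<and> \<rho>' (x + s *\<^sub>R v) > 0"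
    using sign_along_direction(2)[OF defining_functionD(3)[OF df2] defining_function_eq_0[OF df2(1) assms(1,2) df2(2)] defining_functionD(1)[OF df2(1)] df2(2) 2] by blast
  define s where "s = min d d' / 2"
  have s: "0 < s" "s < d" "s < d'" using d(1) d'(1) by (auto simp: s_def)
  show False
    using d(2)[OF s(1,2)] d'(2)[OF s(1,3)] defining_functionD(5)[OF df1(1)] defining_functionD(5)[OF df2(1)]
    by fastforce
qed

lemma outer_normal_eq:
  assumes "open \<Omega>" "x \<in> frontier \<Omega>" "defining_function \<Omega> U \<rho>" "x \<in> U"
  shows "outer_normal \<Omega> x = grad \<rho> x /\<^sub>R norm (grad \<rho> x)"
  unfolding outer_normal_def
  by (rule the_equality) (use assms unit_grad_unique[OF assms(1,2)] in blast)+

text \<open>A segment either runs inside G, where the mean value theorem applies, or meets a point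
  outside G, where the extension is 0. In the second case each endpoint is compared with that point,
  up to the first exit from G. This is how a nonconvex G is handled.\<close>

lemma zext_lipschitz:
  fixes w :: "'a::euclidean_space \<Rightarrow> real"
  assumes G: "open G" and w: "Ck_on 1 G w" "\<And>b. b \<in> Basis \<Longrightarrow> bounded (dir_deriv b w ` G)"
    and cont: "continuous_on UNIV (zext G w)"
  obtains M where "M \<ge> 0" "\<And>x y. \<bar>zext G w x - zext G w y\<bar> \<le> M * norm (x - y)"
proof -
  have "\<forall>b\<in>Basis. \<exists>B. \<forall>x\<in>G. \<bar>dir_deriv b w x\<bar> \<le> B" using w(2) by (auto simp: bounded_iff)
  then obtain B where B: "\<And>b x. b \<in> Basis \<Longrightarrow> x \<in> G \<Longrightarrow> \<bar>dir_deriv b w x\<bar> \<le> B b" by metis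
  define M where "M = (\<Sum>b\<in>Basis. \<bar>B b\<bar>)"
  have M0: "M \<ge> 0" by (simp add: M_def sum_nonneg)
  have dw: "w differentiable (at x)" if "x \<in> G" for x using w(1) that by simp
  have M: "\<bar>dir_deriv v w x\<bar> \<le> M * norm v" if x: "x \<in> G" for x v
  proof -
    have lin: "linear (frechet_derivative w (at x))" using linear_frechet_derivative[OF dw[OF x]] .
    have "dir_deriv v w x = frechet_derivative w (at x) (\<Sum>b\<in>Basis. (v \<bullet> b) *\<^sub>R b)"
      by (simp add: euclidean_representation)
    also have "\<dots> = (\<Sum>b\<in>Basis. (v \<bullet> b) * dir_deriv b w x)"
      using lin by (simp add: linear_sum linear_cmul)
    also have "\<bar>\<dots>\<bar> \<le> (\<Sum>b\<in>Basis. norm v * \<bar>B b\<bar>)"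
    proof (rule sum_abs[THEN order_trans], rule sum_mono)
      fix b :: 'a assume b: "b \<in> Basis"
      show "\<bar>(v \<bullet> b) * dir_deriv b w x\<bar> \<le> norm v * \<bar>B b\<bar>"
        unfolding abs_mult using Basis_le_norm[OF b, of v] B[OF b x] by (intro mult_mono) auto
    qed
    finally show ?thesis by (simp add: M_def sum_distrib_left mult.commute)
  qed
  let ?W = "zext G w"
  \<comment> \<open>The last point, at parameter T, may lie outside G; there the mean value theorem
    asks only for continuity, which the extension has.\<close>
  have seg: "\<bar>?W (x + T *\<^sub>R v) - ?W x\<bar> \<le> T * (M * norm v)"
    if T: "T \<ge> 0" and inG: "\<And>t. 0 \<le> t \<Longrightarrow> t < T \<Longrightarrow> x + t *\<^sub>R v \<in> G" for x v T
  proof (cases "T = 0")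
    case False
    have D: "((\<lambda>t. ?W (x + t *\<^sub>R v)) has_real_derivative dir_deriv v w (x + t *\<^sub>R v)) (at t)"
      if "0 < t" "t < T" for t
    proof -
      have t: "x + t *\<^sub>R v \<in> G" using inG that by simp
      have "?W differentiable (at (x + t *\<^sub>R v))"
        by (rule differentiable_cong_open[OF G t _ dw[OF t]]) (simp add: zext_def)
      moreover have "frechet_derivative ?W (at (x + t *\<^sub>R v)) = frechet_derivative w (at (x + t *\<^sub>R v))"
        by (rule dir_deriv_cong[OF G t]) (simp add: zext_def)
      ultimately show ?thesis using line_derivative[of ?W x t v] by simp
    qed
    have "continuous_on {0..T} (\<lambda>t. ?W (x + t *\<^sub>R v))"
      by (intro continuous_on_compose2[OF cont] continuous_intros) auto
    then obtain l z where z: "0 < z" "z < T" "((\<lambda>t. ?W (x + t *\<^sub>R v)) has_real_derivative l) (at z)"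
      "?W (x + T *\<^sub>R v) - ?W (x + 0 *\<^sub>R v) = (T - 0) * l"
      using MVT[of 0 T "\<lambda>t. ?W (x + t *\<^sub>R v)"] False T D real_differentiable_def
      by (metis order_le_less)
    then have "l = dir_deriv v w (x + z *\<^sub>R v)" using DERIV_unique D by blast
    then have "\<bar>l\<bar> \<le> M * norm v" using M[of "x + z *\<^sub>R v" v] inG z by simp
    then show ?thesis using z(4) T by (simp add: abs_mult mult_left_mono)
  qed simp
  have out: "\<bar>?W x\<bar> \<le> M * norm (x - y)" if y: "y \<notin> G" for x y
  proof (cases "x \<in> G")
    case True
    define v where "v = y - x"
    define S where "S = {t \<in> {0..1}. x + t *\<^sub>R v \<in> - G}"
    have "closed S" unfolding S_def
      using G by (intro continuous_closed_preimage[unfolded vimage_def Int_def mem_Collect_eq] continuous_intros) auto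
    moreover have "1 \<in> S" using y by (simp add: S_def v_def)
    moreover have bS: "bdd_below S" unfolding S_def by (rule bdd_belowI[of _ 0]) auto
    ultimately have I: "Inf S \<in> S" using closed_contains_Inf by blast
    define T where "T = Inf S"
    have T: "0 \<le> T" "T \<le> 1" "x + T *\<^sub>R v \<notin> G" using I by (auto simp: S_def T_def)
    have "x + t *\<^sub>R v \<in> G" if "0 \<le> t" "t < T" for t
      using that T cInf_lower[OF _ bS, of t] by (auto simp: S_def T_def)
    then have "\<bar>?W (x + T *\<^sub>R v) - ?W x\<bar> \<le> T * (M * norm v)" using T by (intro seg) auto
    also have "\<dots> \<le> 1 * (M * norm v)" using T M0 by (intro mult_right_mono) auto
    finally show ?thesis using T(3) by (simp add: zext_def v_def norm_minus_commute)
  next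
    case False
    then show ?thesis using M0 by (simp add: zext_def)
  qed
  have "\<bar>?W x - ?W y\<bar> \<le> M * norm (x - y)" for x y
  proof (cases "\<forall>t\<in>{0..<1}. x + t *\<^sub>R (y - x) \<in> G")
    case True
    then have "\<bar>?W (x + 1 *\<^sub>R (y - x)) - ?W x\<bar> \<le> 1 * (M * norm (y - x))" by (intro seg) auto
    then show ?thesis by (simp add: norm_minus_commute abs_minus_commute)
  next
    case False
    \<comment> \<open>The extension vanishes at the splitting point, and the lengths of the two
      pieces add up to \<open>norm (y - x)\<close>.\<close>
    then obtain t where t: "0 \<le> t" "t < 1" "x + t *\<^sub>R (y - x) \<notin> G" by auto
    let ?z = "x + t *\<^sub>R (y - x)"
    have "\<bar>?W x - ?W y\<bar> \<le> \<bar>?W x\<bar> + \<bar>?W y\<bar>" by simp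
    also have "\<dots> \<le> M * norm (x - ?z) + M * norm (y - ?z)" by (intro add_mono out t(3))
    also have "x - ?z = - (t *\<^sub>R (y - x))" by simp
    also have "y - ?z = (1 - t) *\<^sub>R (y - x)" by (simp add: algebra_simps)
    also have "M * norm (- (t *\<^sub>R (y - x))) + M * norm ((1 - t) *\<^sub>R (y - x)) = M * norm (y - x)"
      unfolding norm_minus_cancel norm_scaleR using t by (simp flip: distrib_left distrib_right)
    finally show ?thesis by (simp add: norm_minus_commute)
  qed
  with M0 show ?thesis by (rule that)
qed

text \<open>For \<open>n = grad \<rho> x\<close> and small \<open>s\<close> the point \<open>x + s (\<tau> - e n)\<close> lies in \<open>\<Omega>\<close> and \<open>x + s (\<tau> + e n)\<close>
  outside, at distance \<open>2 s e |n|\<close>; as the zero extension of \<open>w\<close> is Lipschitz, the derivative of \<open>w\<close> in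
  direction \<open>\<tau> - e n\<close> is \<open>O(e)\<close>.\<close>

lemma tangential_derivative_eq_0:
  fixes w :: "'a::euclidean_space \<Rightarrow> real"
  assumes \<Omega>: "open \<Omega>" and w: "Ck_on 1 \<Omega> w" "\<And>b. b \<in> Basis \<Longrightarrow> bounded (dir_deriv b w ` \<Omega>)"
    and cont: "continuous_on UNIV (zext \<Omega> w)"
    and x: "x \<in> frontier \<Omega>" and df: "defining_function \<Omega> U \<rho>" "x \<in> U"
    and g: "\<And>v. (dir_deriv v w \<longlongrightarrow> g v) (at x within \<Omega>)"
    and \<tau>: "grad \<rho> x \<bullet> \<tau> = 0"
  shows "g \<tau> = 0"
proof -
  define n where "n = grad \<rho> x"
  have n0: "n \<noteq> 0" using defining_functionD(4)[OF df] by (simp add: n_def)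
  have xn: "x \<notin> \<Omega>" using \<Omega> x by (simp add: frontier_def interior_open)
  have nt: "\<not> trivial_limit (at x within \<Omega>)"
    using x xn by (auto simp: trivial_limit_within frontier_def closure_def)
  have dw: "w differentiable (at y)" if "y \<in> \<Omega>" for y using w(1) that by simp
  obtain M where M: "M \<ge> 0" "\<And>x y. \<bar>zext \<Omega> w x - zext \<Omega> w y\<bar> \<le> M * norm (x - y)"
    using zext_lipschitz[OF \<Omega> w cont] by metis
  note sgn = sign_along_direction[OF defining_functionD(3)[OF df] defining_function_eq_0[OF df(1) \<Omega> x df(2)]
      defining_functionD(1)[OF df(1)] df(2)]
  have key: "\<bar>g \<tau> - e * g n\<bar> \<le> 2 * M * e * norm n" if e: "e > 0" for e
  proof -
    define d where "d = \<tau> - e *\<^sub>R n"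
    define d' where "d' = \<tau> + e *\<^sub>R n"
    have "n \<bullet> n > 0" using n0 by simp
    then have "grad \<rho> x \<bullet> d < 0" "grad \<rho> x \<bullet> d' > 0"
      using \<tau> e by (simp_all add: d_def d'_def inner_diff_right inner_add_right n_def[symmetric])
    then obtain r r' where r: "r > 0" "\<And>s. 0 < s \<Longrightarrow> s < r \<Longrightarrow> x + s *\<^sub>R d \<in> U \<and> \<rho> (x + s *\<^sub>R d) < 0"
      and r': "r' > 0" "\<And>s. 0 < s \<Longrightarrow> s < r' \<Longrightarrow> x + s *\<^sub>R d' \<in> U \<and> \<rho> (x + s *\<^sub>R d') > 0"
      using sgn(1)[of d] sgn(2)[of d'] by metis
    have inO: "x + s *\<^sub>R d \<in> \<Omega>" if "0 < s" "s < r" for s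
      using r(2)[OF that] defining_functionD(5)[OF df(1)] by blast
    have outO: "x + s *\<^sub>R d' \<notin> \<Omega>" if "0 < s" "s < r'" for s
      using r'(2)[OF that] defining_functionD(5)[OF df(1)] by fastforce
    have small: "\<exists>z. 0 < z \<and> z < s \<and> \<bar>dir_deriv d w (x + z *\<^sub>R d)\<bar> \<le> 2 * M * e * norm n"
      if s: "0 < s" "s < r" "s < r'" for s
    proof -
      let ?W = "\<lambda>t. zext \<Omega> w (x + t *\<^sub>R d)"
      have D: "(?W has_real_derivative dir_deriv d w (x + t *\<^sub>R d)) (at t)" if "0 < t" "t < r" for t
      proof -
        have t: "x + t *\<^sub>R d \<in> \<Omega>" using inO that by simp
        have "zext \<Omega> w differentiable (at (x + t *\<^sub>R d))"
          by (rule differentiable_cong_open[OF \<Omega> t _ dw[OF t]]) (simp add: zext_def)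
        moreover have "frechet_derivative (zext \<Omega> w) (at (x + t *\<^sub>R d)) = frechet_derivative w (at (x + t *\<^sub>R d))"
          by (rule dir_deriv_cong[OF \<Omega> t]) (simp add: zext_def)
        ultimately show ?thesis using line_derivative[of "zext \<Omega> w" x t d] by simp
      qed
      have "continuous_on {0..s} ?W"
        by (intro continuous_on_compose2[OF cont] continuous_intros) auto
      moreover have "?W differentiable (at t)" if "0 < t" "t < s" for t
        using D[of t] that s(2) by (auto simp: real_differentiable_def)
      ultimately obtain l z where z: "0 < z" "z < s" "(?W has_real_derivative l) (at z)" "?W s - ?W 0 = (s - 0) * l"
        using MVT[of 0 s ?W] s by blast
      then have l: "l = dir_deriv d w (x + z *\<^sub>R d)" using DERIV_unique[OF z(3) D] s(2) by simp
      have "?W 0 = 0" using xn by (simp add: zext_def)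
      moreover have "zext \<Omega> w (x + s *\<^sub>R d') = 0" using outO s by (simp add: zext_def)
      ultimately have "\<bar>s * l\<bar> \<le> M * norm ((x + s *\<^sub>R d) - (x + s *\<^sub>R d'))"
        using M(2)[of "x + s *\<^sub>R d" "x + s *\<^sub>R d'"] z(4) by simp
      also have "(x + s *\<^sub>R d) - (x + s *\<^sub>R d') = - ((2 * s * e) *\<^sub>R n)"
        by (simp add: d_def d'_def algebra_simps flip: scaleR_2)
      also have "M * norm (- ((2 * s * e) *\<^sub>R n)) = s * (2 * M * e * norm n)"
        using s e by (simp add: abs_mult)
      finally have "\<bar>l\<bar> \<le> 2 * M * e * norm n" using s by (simp add: abs_mult)
      then show ?thesis using z l by blast
    qed
    \<comment> \<open>Otherwise the derivative along d would exceed the bound at all points of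
      \<Omega> near x, whereas \<open>small\<close> supplies points arbitrarily close to x where it
      does not.\<close>
    have "\<bar>g d\<bar> \<le> 2 * M * e * norm n"
    proof (rule ccontr)
      assume "\<not> ?thesis"
      then have "\<forall>\<^sub>F y in at x within \<Omega>. \<bar>dir_deriv d w y\<bar> > 2 * M * e * norm n"
        using order_tendstoD(1)[OF tendsto_rabs[OF g[of d]], of "2 * M * e * norm n"] by simp
      then obtain a where a: "a > 0" "\<And>y. y \<in> \<Omega> \<Longrightarrow> y \<noteq> x \<Longrightarrow> dist y x < a \<Longrightarrow> \<bar>dir_deriv d w y\<bar> > 2 * M * e * norm n"
        unfolding eventually_at by blast
      have nd: "norm d + 1 > 0" using norm_ge_zero[of d] by linarith
      obtain q where q: "q > 0" "q * (norm d + 1) = a" using a(1) nd by (metis divide_pos_pos nonzero_eq_divide_eq less_irrefl)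
      define s where "s = min (min r r') q / 2"
      have s: "0 < s" "s < r" "s < r'" "s < q" using r(1) r'(1) q(1) by (auto simp: s_def)
      from small[OF s(1-3)] obtain z where z: "0 < z" "z < s" "\<bar>dir_deriv d w (x + z *\<^sub>R d)\<bar> \<le> 2 * M * e * norm n" by blast
      have "z * norm d \<le> z * (norm d + 1)" using z by (simp add: algebra_simps)
      also have "\<dots> < q * (norm d + 1)" using z s nd by (intro mult_strict_right_mono) auto
      also have "\<dots> = a" by (rule q)
      finally have "dist (x + z *\<^sub>R d) x < a" using z by (simp add: dist_norm)
      moreover have "x + z *\<^sub>R d \<in> \<Omega>" using inO z s by simp
      moreover have "x + z *\<^sub>R d \<noteq> x" using \<open>x + z *\<^sub>R d \<in> \<Omega>\<close> xn by metis
      ultimately show False using a(2) z(3) by fastforce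
    qed
    moreover have "g d = g \<tau> - e * g n"
    proof (rule tendsto_unique[OF nt g])
      have "((\<lambda>y. dir_deriv \<tau> w y - e * dir_deriv n w y) \<longlongrightarrow> g \<tau> - e * g n) (at x within \<Omega>)"
        by (intro tendsto_intros g)
      moreover have "\<forall>\<^sub>F y in at x within \<Omega>. dir_deriv \<tau> w y - e * dir_deriv n w y = dir_deriv d w y"
        using linear_frechet_derivative[OF dw] 
        by (auto simp: eventually_at_filter d_def linear_diff linear_cmul intro!: always_eventually)
      ultimately show "(dir_deriv d w \<longlongrightarrow> g \<tau> - e * g n) (at x within \<Omega>)"
        using tendsto_cong by fast
    qed
    ultimately show ?thesis by simp
  qed
  have "\<bar>g \<tau>\<bar> \<le> 0 + e" if "e > 0" for e
  proof -
    \<comment> \<open>K collects the coefficients of the two terms of order c that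
      \<open>key\<close> leaves, so that c = e / K makes their sum at most e.\<close>
    define K where "K = \<bar>g n\<bar> + 2 * M * norm n + 1"
    have K: "K > 0" using M(1) by (simp add: K_def add_nonneg_pos)
    define c where "c = e / K"
    have c: "c > 0" "c * K = e" using that K by (simp_all add: c_def)
    have "\<bar>g \<tau>\<bar> \<le> \<bar>g \<tau> - c * g n\<bar> + \<bar>c * g n\<bar>"
      using abs_triangle_ineq[of "g \<tau> - c * g n" "c * g n"] by simp
    also have "\<bar>c * g n\<bar> = c * \<bar>g n\<bar>" using c by (simp add: abs_mult)
    also have "\<bar>g \<tau> - c * g n\<bar> + c * \<bar>g n\<bar> \<le> 2 * M * c * norm n + c * \<bar>g n\<bar>"
      using key[OF c(1)] by simp
    also have "\<dots> \<le> c * K" using c(1) by (simp add: K_def algebra_simps)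
    finally show ?thesis using c by simp
  qed
  then have "\<bar>g \<tau>\<bar> \<le> 0" by (rule field_le_epsilon)
  then show ?thesis by simp
qed

section \<open>Boundary values of the derivatives of order below m\<close>

lemma continuous_zext:
  fixes w :: "'a::euclidean_space \<Rightarrow> real"
  assumes "open G" "continuous_on G w" "\<And>x. x \<in> frontier G \<Longrightarrow> (w \<longlongrightarrow> 0) (at x within G)"
  shows "continuous_on UNIV (zext G w)"
proof (rule continuous_at_imp_continuous_on, rule ballI)
  fix x
  consider "x \<in> G" | "x \<in> - closure G" | "x \<in> frontier G" "x \<notin> G" using assms(1) by (auto simp: frontier_def interior_open)
  then show "isCont (zext G w) x"
  proof cases
    case 1
    have "continuous_on G (zext G w)"
      by (rule continuous_on_eq[OF assms(2)]) (simp add: zext_def)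
    then show ?thesis using 1 assms(1) continuous_on_eq_continuous_at by blast
  next
    case 2
    have "continuous_on (- closure G) (zext G w)"
      by (rule continuous_on_eq[of _ "\<lambda>_. 0"]) (use closure_subset in \<open>auto simp: zext_def\<close>)
    then show ?thesis using 2 continuous_on_eq_continuous_at[of "- closure G"] by blast
  next
    case 3
    have "(zext G w \<longlongrightarrow> 0) (at x within G)"
      using assms(3)[OF 3(1)] by (rule Lim_transform_eventually) (auto simp: eventually_at_filter zext_def)
    moreover have "(zext G w \<longlongrightarrow> 0) (at x within - G)"
      by (rule Lim_transform_eventually[OF tendsto_const]) (auto simp: eventually_at_filter zext_def)
    ultimately have "(zext G w \<longlongrightarrow> 0) (at x within (G \<union> - G))" by (simp only: Lim_within_Un)
    then show ?thesis using 3 by (simp add: isCont_def zext_def)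
  qed
qed

lemma smooth_domainD:
  assumes "smooth_domain \<Omega>"
  shows "open \<Omega>" "connected \<Omega>" "\<Omega> \<noteq> {}"
    "\<And>x. x \<in> frontier \<Omega> \<Longrightarrow> \<exists>U \<rho>. x \<in> U \<and> defining_function \<Omega> U \<rho>"
  using assms by (auto simp: smooth_domain_def)

lemma not_trivial_limit_frontier:
  assumes "open \<Omega>" "x \<in> frontier \<Omega>"
  shows "\<not> trivial_limit (at x within \<Omega>)" "x \<notin> \<Omega>"
  using assms by (auto simp: trivial_limit_within frontier_def closure_def interior_open)

lemma Ck_closure_bounded:
  assumes "Ck_closure k \<Omega> u" "bounded \<Omega>" "length vs \<le> k"
  shows "bounded (iter_deriv vs u ` \<Omega>)"
proof -
  obtain g where g: "continuous_on (closure \<Omega>) g" "\<forall>x\<in>\<Omega>. g x = iter_deriv vs u x"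
    using assms unfolding Ck_closure_def by blast
  have "bounded (g ` closure \<Omega>)"
    using g(1) assms(2) by (intro compact_imp_bounded compact_continuous_image) auto
  then show ?thesis by (rule bounded_subset) (use g(2) closure_subset in force)
qed

text \<open>\<open>Lim\<close> is a definite description, so the boundary condition written with
  \<open>normal_deriv\<close> carries information only once the limit is known to exist.\<close>

lemma Ck_closure_limit:
  assumes "Ck_closure k \<Omega> u" "open \<Omega>" "x \<in> frontier \<Omega>" "length vs \<le> k"
  shows "(iter_deriv vs u \<longlongrightarrow> Lim (at x within \<Omega>) (iter_deriv vs u)) (at x within \<Omega>)"
proof -
  obtain g where g: "continuous_on (closure \<Omega>) g" "\<forall>x\<in>\<Omega>. g x = iter_deriv vs u x"
    using assms unfolding Ck_closure_def by blast
  have "x \<in> closure \<Omega>" using assms(3) by (simp add: frontier_def)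
  then have "(g \<longlongrightarrow> g x) (at x within closure \<Omega>)" using g(1) by (simp add: continuous_on_def)
  then have "(g \<longlongrightarrow> g x) (at x within \<Omega>)" by (rule tendsto_within_subset[OF _ closure_subset])
  then have "(iter_deriv vs u \<longlongrightarrow> g x) (at x within \<Omega>)"
    by (rule Lim_transform_eventually) (use g(2) in \<open>auto simp: eventually_at_filter\<close>)
  then show ?thesis using tendsto_Lim[OF not_trivial_limit_frontier(1)[OF assms(2,3)]] by metis
qed

text \<open>Induction on the order. If all derivatives of order k vanish on the boundary, their
  tangential derivatives vanish there too, so in a boundary value of order k + 1 the outermost
  vector v may be replaced by its normal part (v . \<nu>) \<nu>. Symmetry brings each vector to the
  outermost place in turn, and what remains is a multiple of the pure normal derivative.\<close>

lemma boundary_derivatives_vanish: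
  fixes u :: "'a::euclidean_space \<Rightarrow> real"
  assumes sd: "smooth_domain \<Omega>" and bd: "bounded \<Omega>" and Ck: "Ck_closure K \<Omega> u" and "m \<le> K"
    and nd: "\<And>x j. x \<in> frontier \<Omega> \<Longrightarrow> j < m \<Longrightarrow> normal_deriv j \<Omega> u x = 0"
    and "length vs < m" and x: "x \<in> frontier \<Omega>"
  shows "(iter_deriv vs u \<longlongrightarrow> 0) (at x within \<Omega>)"
proof -
  note \<Omega> = smooth_domainD(1)[OF sd]
  have CkO: "Ck_on K \<Omega> u" using Ck by (simp add: Ck_closure_def)
  have "k < m \<Longrightarrow> \<forall>vs x. length vs = k \<longrightarrow> x \<in> frontier \<Omega> \<longrightarrow> (iter_deriv vs u \<longlongrightarrow> 0) (at x within \<Omega>)" for k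
  proof (induction k)
    case 0
    show ?case
      using nd[OF _ 0] Ck_closure_limit[OF Ck \<Omega>, of _ "[]"] by (auto simp: normal_deriv_def)
  next
    case (Suc k)
    show ?case
    proof (intro allI impI)
      fix vs :: "'a list" and x assume len: "length vs = Suc k" and x: "x \<in> frontier \<Omega>"
      define L where "L vs = Lim (at x within \<Omega>) (iter_deriv vs u)" for vs
      have L: "(iter_deriv vs u \<longlongrightarrow> L vs) (at x within \<Omega>)" if "length vs \<le> K" for vs
        unfolding L_def by (rule Ck_closure_limit[OF Ck \<Omega> x that])
      note nt = not_trivial_limit_frontier(1)[OF \<Omega> x]
      obtain U \<rho> where df: "defining_function \<Omega> U \<rho>" "x \<in> U" using smooth_domainD(4)[OF sd x] by blast
      define \<nu> where "\<nu> = outer_normal \<Omega> x"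
      have \<nu>: "\<nu> = grad \<rho> x /\<^sub>R norm (grad \<rho> x)" unfolding \<nu>_def by (rule outer_normal_eq[OF \<Omega> x df])
      have g0: "grad \<rho> x \<noteq> 0" using defining_functionD(4)[OF df] .
      have normal: "L (v # ws) = (v \<bullet> \<nu>) * L (\<nu> # ws)" if ws: "length ws = k" for v ws
      proof -
        have C1: "Ck_on 1 \<Omega> (iter_deriv ws u)"
          using Ck_on_le[OF CkO, of "1 + length ws"] ws Suc.prems \<open>m \<le> K\<close> by (intro Ck_on_iter_deriv) simp
        have bdw: "bounded (dir_deriv b (iter_deriv ws u) ` \<Omega>)" for b
          using Ck_closure_bounded[OF Ck bd, of "b # ws"] ws Suc.prems \<open>m \<le> K\<close> by simp
        have cz: "continuous_on UNIV (zext \<Omega> (iter_deriv ws u))"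
          using Suc ws by (intro continuous_zext[OF \<Omega> Ck_on_imp_continuous_on[OF C1]]) auto
        have lim: "(dir_deriv b (iter_deriv ws u) \<longlongrightarrow> L (b # ws)) (at x within \<Omega>)" for b
          using L[of "b # ws"] ws Suc.prems \<open>m \<le> K\<close> by simp
        let ?\<tau> = "v - (v \<bullet> \<nu>) *\<^sub>R \<nu>"
        have "grad \<rho> x \<bullet> ?\<tau> = 0"
          using g0 by (simp add: \<nu> inner_diff_right inner_commute[of v] dot_square_norm power2_eq_square field_simps)
        then have "L (?\<tau> # ws) = 0"
          by (rule tangential_derivative_eq_0[OF \<Omega> C1 bdw cz x df lim])
        moreover have "L (?\<tau> # ws) = L (v # ws) - (v \<bullet> \<nu>) * L (\<nu> # ws)"
        proof (rule tendsto_unique[OF nt lim])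
          have "((\<lambda>y. dir_deriv v (iter_deriv ws u) y - (v \<bullet> \<nu>) * dir_deriv \<nu> (iter_deriv ws u) y)
              \<longlongrightarrow> L (v # ws) - (v \<bullet> \<nu>) * L (\<nu> # ws)) (at x within \<Omega>)"
            by (intro tendsto_intros lim)
          then show "(dir_deriv ?\<tau> (iter_deriv ws u) \<longlongrightarrow> L (v # ws) - (v \<bullet> \<nu>) * L (\<nu> # ws)) (at x within \<Omega>)"
          proof (rule Lim_transform_eventually)
            have "iter_deriv ws u differentiable (at y)" if "y \<in> \<Omega>" for y using C1 that by simp
            from linear_frechet_derivative[OF this]
            show "\<forall>\<^sub>F y in at x within \<Omega>. dir_deriv v (iter_deriv ws u) y - (v \<bullet> \<nu>) * dir_deriv \<nu> (iter_deriv ws u) y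
               = dir_deriv ?\<tau> (iter_deriv ws u) y"
              by (auto simp: eventually_at_filter linear_diff linear_cmul)
          qed
        qed
        ultimately show ?thesis by simp
      qed
      \<comment> \<open>Symmetry of derivatives inside \<Omega> passes to the limit at x.\<close>
      have perm: "L vs = L ws" if ms: "mset vs = mset ws" and "length vs \<le> K" for vs ws
      proof -
        have "length ws \<le> K" using that by (metis size_mset)
        moreover have "(iter_deriv ws u \<longlongrightarrow> L vs) (at x within \<Omega>)"
          using L[OF that(2)] by (rule Lim_transform_eventually)
            (use iter_deriv_perm[OF \<Omega> ms Ck_on_le[OF CkO that(2)]] in \<open>auto simp: eventually_at_filter\<close>)
        ultimately show ?thesis using tendsto_unique[OF nt] L by blast
      qed
      \<comment> \<open>Entries already replaced by the normal are moved to the end of the list, so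
        the induction runs over those still to be replaced.\<close>
      have "L (ws @ replicate j \<nu>) = 0" if "length ws + j = Suc k" for ws j
        using that
      proof (induction ws arbitrary: j)
        case Nil
        then show ?case using nd[OF x Suc.prems] by (simp add: L_def normal_deriv_def \<nu>_def)
      next
        case (Cons w ws)
        have "L ((w # ws) @ replicate j \<nu>) = (w \<bullet> \<nu>) * L (\<nu> # ws @ replicate j \<nu>)"
          using normal[of "ws @ replicate j \<nu>" w] Cons.prems by simp
        also have "L (\<nu> # ws @ replicate j \<nu>) = L (ws @ replicate (Suc j) \<nu>)"
          using Cons.prems Suc.prems \<open>m \<le> K\<close> by (intro perm) auto
        also have "\<dots> = 0" using Cons.prems by (intro Cons.IH) simp
        finally show ?case by simp
      qed
      from this[of vs 0] have "L vs = 0" using len by simp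
      then show "(iter_deriv vs u \<longlongrightarrow> 0) (at x within \<Omega>)"
        using L[of vs] len Suc.prems \<open>m \<le> K\<close> by simp
    qed
  qed
  then show ?thesis using assms by blast
qed

section \<open>Rays towards the centre of a star shaped domain\<close>

lemma defining_function_frontier:
  assumes df: "defining_function \<Omega> U \<rho>" "x \<in> U" and "\<rho> x = 0"
  shows "x \<in> frontier \<Omega>"
proof -
  let ?v = "- grad \<rho> x"
  have "grad \<rho> x \<bullet> ?v < 0" using defining_functionD(4)[OF df] by simp
  then obtain d where d: "d > 0" "\<And>s. 0 < s \<Longrightarrow> s < d \<Longrightarrow> x + s *\<^sub>R ?v \<in> U \<and> \<rho> (x + s *\<^sub>R ?v) < 0"
    using sign_along_direction(1)[OF defining_functionD(3)[OF df] assms(3) defining_functionD(1)[OF df(1)] df(2)] by blast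
  have lim: "((\<lambda>s. x + s *\<^sub>R ?v) \<longlongrightarrow> x + 0 *\<^sub>R ?v) (at_right 0)" by (intro tendsto_intros)
  have "\<forall>\<^sub>F s in at_right 0. x + s *\<^sub>R ?v \<in> \<Omega>"
    unfolding eventually_at_right_field
  proof (intro exI[of _ d] conjI allI impI d(1))
    fix s assume "0 < s" "s < d"
    then show "x + s *\<^sub>R ?v \<in> \<Omega>" using d(2) defining_functionD(5)[OF df(1)] by blast
  qed
  then have ev: "\<forall>\<^sub>F s in at_right 0. x + s *\<^sub>R ?v \<in> closure \<Omega>"
    by (rule eventually_mono) (use closure_subset in auto)
  have "x \<in> closure \<Omega>" using Lim_in_closed_set[OF closed_closure ev _ lim] by simp
  moreover have "x \<notin> \<Omega>" using defining_functionD(5)[OF df] assms(3) by simp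
  ultimately show ?thesis using interior_subset by (auto simp: frontier_def)
qed

text \<open>Star-shapedness is not strict, so rays may be tangent to the boundary. Along a ray, however,
  \<open>\<psi> = \<rho> \<circ> ray\<close> satisfies \<open>\<psi>' \<ge> Q \<psi>\<close> on the inner side, so that \<open>\<psi>\<close> cannot reach 0 from
  negative values when moving towards the centre.\<close>

lemma radial_derivative_lower_bound:
  fixes \<Omega> :: "'a::euclidean_space set"
  assumes \<Omega>: "open \<Omega>" and star: "\<And>x. x \<in> frontier \<Omega> \<Longrightarrow> (x - y) \<bullet> outer_normal \<Omega> x \<ge> 0"
    and df: "defining_function \<Omega> U \<rho>" and z: "z \<in> U" "\<rho> z = 0"
  obtains \<delta> K where "\<delta> > 0" "K \<ge> 0" "ball z \<delta> \<subseteq> U"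
    "\<And>w. w \<in> ball z \<delta> \<Longrightarrow> \<rho> w \<le> 0 \<Longrightarrow> dir_deriv (w - y) \<rho> w \<ge> K * \<rho> w"
proof -
  note U = defining_functionD(1)[OF df] and d\<rho> = defining_functionD(3)[OF df]
  have C2: "Ck_on 2 U \<rho>" using defining_functionD(2)[OF df] .
  define n where "n = grad \<rho> z"
  \<comment> \<open>The slope of \<rho> along n at z is n . n; half of it remains a lower bound near
    z.\<close>
  define c where "c = (n \<bullet> n) / 2"
  have n0: "n \<noteq> 0" using defining_functionD(4)[OF df z(1)] by (simp add: n_def)
  then have c: "c > 0" by (simp add: c_def)
  define \<kappa> where "\<kappa> w = (\<Sum>b\<in>Basis. ((w - y) \<bullet> b) * dir_deriv b \<rho> w)" for w
  have \<kappa>: "\<kappa> w = dir_deriv (w - y) \<rho> w" if "w \<in> U" for w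
    unfolding grad_inner[OF d\<rho>[OF that], symmetric] by (simp add: \<kappa>_def grad_def inner_sum_left inner_commute[of "w - y"] mult.commute)
  define \<kappa>' where "\<kappa>' w = (\<Sum>b\<in>Basis. (n \<bullet> b) * dir_deriv b \<rho> w + ((w - y) \<bullet> b) * dir_deriv n (dir_deriv b \<rho>) w)" for w
  have d2: "dir_deriv b \<rho> differentiable (at w)" if "w \<in> U" for b w
    using C2 that by (simp add: numeral_2_eq_2)
  have D\<kappa>: "((\<lambda>t. \<kappa> (w + t *\<^sub>R n)) has_real_derivative \<kappa>' (w + t *\<^sub>R n)) (at t)" if "w + t *\<^sub>R n \<in> U" for w t
    unfolding \<kappa>_def \<kappa>'_def
  proof (rule DERIV_sum)
    fix b :: 'a
    have "((\<lambda>t. (w + t *\<^sub>R n - y) \<bullet> b) has_real_derivative n \<bullet> b) (at t)"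
      by (simp add: inner_diff_left inner_add_left) (auto intro!: derivative_eq_intros)
    from DERIV_mult[OF this line_derivative[OF d2[OF that]]]
    show "((\<lambda>t. ((w + t *\<^sub>R n - y) \<bullet> b) * dir_deriv b \<rho> (w + t *\<^sub>R n)) has_real_derivative
      (n \<bullet> b) * dir_deriv b \<rho> (w + t *\<^sub>R n) + ((w + t *\<^sub>R n - y) \<bullet> b) * dir_deriv n (dir_deriv b \<rho>) (w + t *\<^sub>R n)) (at t)"
      by (simp add: mult.commute add.commute)
  qed
  have c1: "continuous_on U (dir_deriv v \<rho>)" for v
    using Ck_on_le[OF C2, of 1] by simp
  have c2: "continuous_on U (dir_deriv v (dir_deriv b \<rho>))" for v b
    using C2 by (simp add: numeral_2_eq_2)
  have c\<rho>: "continuous_on U \<rho>" using Ck_on_imp_continuous_on[OF C2] .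
  have c\<kappa>': "continuous_on U \<kappa>'" unfolding \<kappa>'_def by (intro continuous_intros c1 c2)
  define K1 where "K1 = \<bar>\<kappa>' z\<bar> + 1"
  have "\<forall>\<^sub>F w in nhds z. w \<in> U \<and> dir_deriv n \<rho> w > c \<and> \<kappa>' w < K1"
  proof (intro eventually_conj)
    show "\<forall>\<^sub>F w in nhds z. w \<in> U" using U z(1) by (rule eventually_nhds_in_open)
    have "dir_deriv n \<rho> z > c" using n0 by (simp add: grad_inner[OF d\<rho>[OF z(1)], symmetric] n_def[symmetric] c_def)
    then show "\<forall>\<^sub>F w in nhds z. dir_deriv n \<rho> w > c"
      using c1[of n] U z(1) by (metis continuous_on_eq_continuous_at isCont_def order_tendstoD(1) tendsto_at_iff_tendsto_nhds)
    have "\<kappa>' z < K1" by (simp add: K1_def)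
    then show "\<forall>\<^sub>F w in nhds z. \<kappa>' w < K1"
      using c\<kappa>' U z(1) by (metis continuous_on_eq_continuous_at isCont_def order_tendstoD(2) tendsto_at_iff_tendsto_nhds)
  qed
  then obtain r where r: "r > 0" "\<And>w. dist w z < r \<Longrightarrow> w \<in> U \<and> dir_deriv n \<rho> w > c \<and> \<kappa>' w < K1"
    unfolding eventually_nhds_metric by blast
  have "(\<rho> \<longlongrightarrow> 0) (nhds z)"
    using c\<rho> U z by (metis continuous_on_eq_continuous_at isCont_def tendsto_at_iff_tendsto_nhds)
  \<comment> \<open>This bound on \<rho> w will keep T * norm n below r/2, so that the path from w
    along n stays where the estimates hold.\<close>
  moreover have "- (c * r / (2 * norm n)) < 0" using c r(1) n0 by simp
  ultimately have "\<forall>\<^sub>F w in nhds z. \<rho> w > - (c * r / (2 * norm n))" by (rule order_tendstoD(1))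
  then obtain r2 where r2: "r2 > 0" "\<And>w. dist w z < r2 \<Longrightarrow> \<rho> w > - (c * r / (2 * norm n))"
    unfolding eventually_nhds_metric by blast
  define \<delta> where "\<delta> = min (r / 2) r2"
  show ?thesis
  proof (rule that[of \<delta> "K1 / c"])
    show "\<delta> > 0" using r r2 by (simp add: \<delta>_def)
    show "K1 / c \<ge> 0" using c by (simp add: K1_def)
    show "ball z \<delta> \<subseteq> U" using r by (auto simp: \<delta>_def dist_commute)
    fix w assume w: "w \<in> ball z \<delta>" "\<rho> w \<le> 0"
    \<comment> \<open>Climbing along n at slope at least c, \<rho> reaches 0 from \<rho> w no later
      than at parameter T.\<close>
    define T where "T = - \<rho> w / c"
    have T0: "T \<ge> 0" using w c by (simp add: T_def divide_nonpos_pos)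
    have "\<rho> w > - (c * r / (2 * norm n))" using w r2 by (auto simp: \<delta>_def dist_commute)
    then have "T * norm n < r / 2" using c n0 by (simp add: T_def field_simps)
    have near: "dist (w + t *\<^sub>R n) z < r" if "0 \<le> t" "t \<le> T" for t
    proof -
      have "dist (w + t *\<^sub>R n) z \<le> dist (w + t *\<^sub>R n) w + dist w z" by (rule dist_triangle)
      also have "dist (w + t *\<^sub>R n) w = t * norm n" using that by (simp add: dist_norm)
      also have "t * norm n \<le> T * norm n" using that by (intro mult_right_mono) auto
      also have "T * norm n + dist w z < r / 2 + r / 2"
        using w \<open>T * norm n < r / 2\<close> by (intro add_strict_mono) (auto simp: \<delta>_def dist_commute)
      finally show ?thesis by simp
    qed
    have D: "((\<lambda>t. \<rho> (w + t *\<^sub>R n)) has_real_derivative dir_deriv n \<rho> (w + t *\<^sub>R n)) (at t)"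
      if "0 \<le> t" "t \<le> T" for t using r(2)[OF near[OF that]] by (intro line_derivative d\<rho>) simp
    have "\<rho> (w + T *\<^sub>R n) - c * T \<ge> \<rho> (w + 0 *\<^sub>R n) - c * 0"
    proof (rule DERIV_nonneg_imp_nondecreasing[OF T0, of "\<lambda>t. \<rho> (w + t *\<^sub>R n) - c * t"])
      fix t assume t: "0 \<le> t" "t \<le> T"
      show "\<exists>l. ((\<lambda>t. \<rho> (w + t *\<^sub>R n) - c * t) has_real_derivative l) (at t) \<and> 0 \<le> l"
        using r(2)[OF near[OF t]]
        by (intro exI[of _ "dir_deriv n \<rho> (w + t *\<^sub>R n) - c"])
           (auto intro!: derivative_eq_intros D[OF t])
    qed
    then have "\<rho> (w + T *\<^sub>R n) \<ge> 0" using c by (simp add: T_def)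
    moreover have "continuous_on {0..T} (\<lambda>t. \<rho> (w + t *\<^sub>R n))"
      using D by (meson DERIV_continuous_on atLeastAtMost_iff has_field_derivative_at_within)
    ultimately obtain t0 where t0: "0 \<le> t0" "t0 \<le> T" "\<rho> (w + t0 *\<^sub>R n) = 0"
      using IVT'[of "\<lambda>t. \<rho> (w + t *\<^sub>R n)" 0 0 T] w(2) T0 by auto
    let ?p = "w + t0 *\<^sub>R n"
    have pU: "?p \<in> U" using r(2)[OF near[OF t0(1,2)]] by simp
    have pf: "?p \<in> frontier \<Omega>" by (rule defining_function_frontier[OF df pU t0(3)])
    have "(?p - y) \<bullet> (grad \<rho> ?p /\<^sub>R norm (grad \<rho> ?p)) \<ge> 0"
      using star[OF pf] by (simp only: outer_normal_eq[OF \<Omega> pf df pU])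
    then have "grad \<rho> ?p \<bullet> (?p - y) \<ge> 0"
      using defining_functionD(4)[OF df pU] by (simp add: inner_commute zero_le_mult_iff)
    then have p0: "\<kappa> ?p \<ge> 0" using \<kappa>[OF pU] grad_inner[OF d\<rho>[OF pU]] by simp
    \<comment> \<open>At the boundary point ?p the star condition gives \<kappa> \<ge> 0. Going back
      to w lowers \<kappa> by at most K1 * t0, and t0 \<le> T makes this at most a multiple of -
      \<rho> w.\<close>
    have "\<kappa> ?p - K1 * t0 \<le> \<kappa> (w + 0 *\<^sub>R n) - K1 * 0"
    proof (rule DERIV_nonpos_imp_nonincreasing[OF t0(1), of "\<lambda>t. \<kappa> (w + t *\<^sub>R n) - K1 * t"])
      fix t assume t: "0 \<le> t" "t \<le> t0"
      have t': "0 \<le> t" "t \<le> T" using t t0 by auto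
      show "\<exists>l. ((\<lambda>t. \<kappa> (w + t *\<^sub>R n) - K1 * t) has_real_derivative l) (at t) \<and> l \<le> 0"
        using r(2)[OF near[OF t']]
        by (intro exI[of _ "\<kappa>' (w + t *\<^sub>R n) - K1"])
           (auto intro!: derivative_eq_intros D\<kappa>)
    qed
    then have "\<kappa> w \<ge> - (K1 * t0)" using p0 by simp
    moreover have "K1 * t0 \<le> K1 * T" using t0 by (intro mult_left_mono) (auto simp: K1_def)
    moreover have "- (K1 * T) = K1 / c * \<rho> w" by (simp add: T_def)
    moreover have "w \<in> U" using r(2)[OF near[of 0]] T0 by simp
    ultimately show "dir_deriv (w - y) \<rho> w \<ge> K1 / c * \<rho> w" using \<kappa> by simp
  qed
qed

text \<open>If the segment left \<Omega>, let T be the largest parameter of an outside point. There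
  \<psi> = 0, and just beyond T \<psi> < 0. But \<psi>' \<ge> Q \<psi> makes \<psi>(t) exp(-Q t)
  nondecreasing, hence \<psi> \<ge> 0 beyond T. The restriction s > 0 keeps T away from 0, where Q =
  K/T would be lost; whether y lies in \<Omega> is left open.\<close>

theorem star_shaped_scaling:
  fixes \<Omega> :: "'a::euclidean_space set"
  assumes sd: "smooth_domain \<Omega>" and star: "\<And>x. x \<in> frontier \<Omega> \<Longrightarrow> (x - y) \<bullet> outer_normal \<Omega> x \<ge> 0"
    and x: "x \<in> \<Omega>" and s: "0 < s" "s \<le> 1"
  shows "y + s *\<^sub>R (x - y) \<in> \<Omega>"
proof (rule ccontr)
  assume out: "y + s *\<^sub>R (x - y) \<notin> \<Omega>"
  note \<Omega> = smooth_domainD(1)[OF sd]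
  define d where "d = x - y"
  define S where "S = {t \<in> {s..1}. y + t *\<^sub>R d \<in> - \<Omega>}"
  have "closed S" unfolding S_def
    using \<Omega> by (intro continuous_closed_preimage[unfolded vimage_def Int_def mem_Collect_eq] continuous_intros) auto
  moreover have "s \<in> S" using out s by (simp add: S_def d_def)
  moreover have bS: "bdd_above S" unfolding S_def by (rule bdd_aboveI[of _ 1]) auto
  ultimately have I: "Sup S \<in> S" using closed_contains_Sup by blast
  define T where "T = Sup S"
  have T: "s \<le> T" "T \<le> 1" "y + T *\<^sub>R d \<notin> \<Omega>" using I by (auto simp: S_def T_def)
  have "T \<noteq> 1" using T(3) x by (auto simp: d_def)
  then have T1: "T < 1" using T by simp
  have T0: "T > 0" using T s by simp
  have inO: "y + t *\<^sub>R d \<in> \<Omega>" if "T < t" "t \<le> 1" for t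
    using that T cSup_upper[OF _ bS, of t] by (auto simp: S_def T_def)
  define z where "z = y + T *\<^sub>R d"
  have lim: "((\<lambda>t. y + t *\<^sub>R d) \<longlongrightarrow> z) (at_right T)" unfolding z_def by (intro tendsto_intros)
  have "\<forall>\<^sub>F t in at_right T. y + t *\<^sub>R d \<in> \<Omega>"
    unfolding eventually_at_right_field using T1 inO by (meson less_imp_le)
  then have ev: "\<forall>\<^sub>F t in at_right T. y + t *\<^sub>R d \<in> closure \<Omega>"
    by (rule eventually_mono) (use closure_subset in auto)
  have "z \<in> closure \<Omega>"
    by (rule Lim_in_closed_set[OF closed_closure ev _ lim]) simp
  then have zf: "z \<in> frontier \<Omega>" using T(3) \<Omega> by (simp add: frontier_def z_def interior_open)
  obtain U \<rho> where df: "defining_function \<Omega> U \<rho>" "z \<in> U" using smooth_domainD(4)[OF sd zf] by blast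
  have z0: "\<rho> z = 0" by (rule defining_function_eq_0[OF df(1) \<Omega> zf df(2)])
  obtain \<delta> K where \<delta>: "\<delta> > 0" "K \<ge> 0" "ball z \<delta> \<subseteq> U"
    and lower: "\<And>w. w \<in> ball z \<delta> \<Longrightarrow> \<rho> w \<le> 0 \<Longrightarrow> dir_deriv (w - y) \<rho> w \<ge> K * \<rho> w"
    using radial_derivative_lower_bound[OF \<Omega> star df(1) df(2) z0] by metis
  have nd: "norm d + 1 > 0" using norm_ge_zero[of d] by linarith
  obtain e where e: "e > 0" "e * (norm d + 1) = \<delta> / 2"
    using half_gt_zero[OF \<delta>(1)] nd by (metis divide_pos_pos nonzero_eq_divide_eq less_irrefl)
  define T' where "T' = min 1 (T + e)"
  have T': "T < T'" "T' \<le> 1" using T1 e by (auto simp: T'_def)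
  have inB: "y + t *\<^sub>R d \<in> ball z \<delta>" if "T \<le> t" "t \<le> T'" for t
  proof -
    have "dist (y + t *\<^sub>R d) z = (t - T) * norm d"
      using that by (simp add: z_def dist_norm flip: scaleR_diff_left)
    also have "\<dots> \<le> (t - T) * (norm d + 1)" using that by (intro mult_left_mono) auto
    also have "\<dots> \<le> e * (norm d + 1)"
      using that nd by (intro mult_right_mono) (auto simp: T'_def)
    also have "\<dots> = \<delta> / 2" by (rule e)
    also have "\<dots> < \<delta>" using \<delta> by simp
    finally show ?thesis by (simp add: dist_commute)
  qed
  \<comment> \<open>The lower bound concerns the direction w - y = t d. Dividing by t and using t
    \<ge> T together with \<psi> \<le> 0 gives the rate K / T.\<close>
  define Q where "Q = K / T"
  let ?\<psi> = "\<lambda>t. \<rho> (y + t *\<^sub>R d)"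
  have "?\<psi> T * exp (- Q * T) \<le> ?\<psi> T' * exp (- Q * T')"
  proof (rule DERIV_nonneg_imp_nondecreasing[of T T' "\<lambda>t. ?\<psi> t * exp (- Q * t)"])
    show "T \<le> T'" using T' by simp
    fix t assume t: "T \<le> t" "t \<le> T'"
    have wU: "y + t *\<^sub>R d \<in> U" using inB[OF t] \<delta> by blast
    have neg: "?\<psi> t \<le> 0"
    proof (cases "t = T")
      case True
      then show ?thesis using z0 by (simp add: z_def)
    next
      case False
      then have "y + t *\<^sub>R d \<in> \<Omega>" using inO t T' by simp
      then show ?thesis using defining_functionD(5)[OF df(1) wU] by simp
    qed
    have lin: "linear (frechet_derivative \<rho> (at (y + t *\<^sub>R d)))"
      using linear_frechet_derivative[OF defining_functionD(3)[OF df(1) wU]] .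
    have "K * ?\<psi> t \<le> dir_deriv (y + t *\<^sub>R d - y) \<rho> (y + t *\<^sub>R d)" by (rule lower[OF inB[OF t] neg])
    also have "\<dots> = t * dir_deriv d \<rho> (y + t *\<^sub>R d)" using lin by (simp add: linear_cmul)
    finally have 1: "K * ?\<psi> t / t \<le> dir_deriv d \<rho> (y + t *\<^sub>R d)"
      using t T0 by (simp add: field_simps)
    have "K / t \<le> K / T" using t T0 \<delta>(2) by (intro divide_left_mono) auto
    then have "(K / T) * ?\<psi> t \<le> (K / t) * ?\<psi> t" using neg by (rule mult_right_mono_neg)
    then have 2: "Q * ?\<psi> t \<le> dir_deriv d \<rho> (y + t *\<^sub>R d)" using 1 by (simp add: Q_def)
    have "((\<lambda>t. ?\<psi> t * exp (- Q * t)) has_real_derivative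
        (dir_deriv d \<rho> (y + t *\<^sub>R d) - Q * ?\<psi> t) * exp (- Q * t)) (at t)"
      by (auto intro!: derivative_eq_intros line_derivative[OF defining_functionD(3)[OF df(1) wU]] simp: algebra_simps)
    then show "\<exists>l. ((\<lambda>t. ?\<psi> t * exp (- Q * t)) has_real_derivative l) (at t) \<and> 0 \<le> l" using 2 by (intro exI conjI) auto
  qed
  then have "?\<psi> T' \<ge> 0" using z0 by (simp add: z_def zero_le_mult_iff)
  moreover have "y + T' *\<^sub>R d \<in> \<Omega>" using inO T' by simp
  moreover have "y + T' *\<^sub>R d \<in> U" using inB[of T'] T' \<delta> by auto
  ultimately show False using defining_functionD(5)[OF df(1)] by fastforce
qed

section \<open>Weak formulation and energy\<close>

text \<open>Ordered index tuples: summing products of derivatives over them gives the full inner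
  product of the tensors of k-th derivatives, each mixed derivative counted with its
  multiplicity.\<close>

definition basis_lists :: "nat \<Rightarrow> 'a::euclidean_space list set" where
  "basis_lists k = {bs. length bs = k \<and> set bs \<subseteq> Basis}"

lemma finite_basis_lists: "finite (basis_lists k)"
  using finite_lists_length_eq[OF finite_Basis, of k] by (simp add: basis_lists_def conj_commute)

lemma length_basis_lists: "bs \<in> basis_lists k \<Longrightarrow> length bs = k"
  by (simp add: basis_lists_def)

lemma basis_lists_0: "basis_lists 0 = {[]}"
  by (auto simp: basis_lists_def)

lemma sum_basis_lists_Suc:
  fixes f :: "'a::euclidean_space list \<Rightarrow> 'b::comm_monoid_add"
  shows "(\<Sum>bs\<in>basis_lists (Suc k). f bs) = (\<Sum>bs\<in>basis_lists k. \<Sum>b\<in>Basis. f (b # bs))"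
proof -
  have "basis_lists (Suc k) = (\<lambda>(bs, b). b # bs) ` (basis_lists k \<times> (Basis :: 'a set))"
  proof
    show "basis_lists (Suc k) \<subseteq> (\<lambda>(bs, b). b # bs) ` (basis_lists k \<times> (Basis :: 'a set))"
    proof
      fix bs :: "'a list" assume "bs \<in> basis_lists (Suc k)"
      then show "bs \<in> (\<lambda>(bs, b). b # bs) ` (basis_lists k \<times> Basis)"
        by (cases bs) (auto simp: basis_lists_def)
    qed
  qed (auto simp: basis_lists_def)
  moreover have "inj_on (\<lambda>(bs, b). b # bs) (basis_lists k \<times> (Basis :: 'a set))" by (auto simp: inj_on_def)
  ultimately show ?thesis by (simp add: sum.reindex sum.cartesian_product case_prod_unfold)
qed

lemma polyharmonic_0: "polyharmonic 0 u = u"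
  by (simp add: polyharmonic_def)

lemma polyharmonic_Suc:
  "polyharmonic (Suc k) u = (\<lambda>x. \<Sum>b\<in>Basis. - 1 * iter_deriv [b, b] (polyharmonic k u) x)"
  by (simp add: polyharmonic_def laplacian_def sum_negf)

lemma Ck_on_polyharmonic:
  assumes "open G" "Ck_on (k + 2 * j) G u"
  shows "Ck_on k G (polyharmonic j u)"
  using assms(2)
proof (induction j arbitrary: k)
  case (Suc j)
  have "Ck_on (k + length [b, b]) G (polyharmonic j u)" for b :: 'a
    using Suc by (simp del: Ck_on.simps)
  then have "Ck_on k G (iter_deriv [b, b] (polyharmonic j u))" for b by (rule Ck_on_iter_deriv)
  then show ?case unfolding polyharmonic_Suc by (intro Ck_on_sum assms(1)) auto
qed (simp add: polyharmonic_0)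

text \<open>With both copies of b outermost the left side is visibly minus the divergence of the
  field with components \<open>iter_deriv (b # vs) (polyharmonic j u)\<close>, the form to which
  integration by parts applies.\<close>

lemma iter_deriv_polyharmonic_Suc:
  assumes "open G" "Ck_on (length vs + 2 * Suc j) G u" "x \<in> G"
  shows "iter_deriv vs (polyharmonic (Suc j) u) x = - (\<Sum>b\<in>Basis. iter_deriv (b # b # vs) (polyharmonic j u) x)"
proof -
  have C: "Ck_on (length vs + 2) G (polyharmonic j u)"
    using assms by (intro Ck_on_polyharmonic) (auto simp del: Ck_on.simps simp: add.assoc)
  have "Ck_on (length vs + length [b, b]) G (polyharmonic j u)" for b :: 'a
    using C by (simp del: Ck_on.simps)
  then have "Ck_on (length vs) G (iter_deriv [b, b] (polyharmonic j u))" for b by (rule Ck_on_iter_deriv)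
  then have "iter_deriv vs (polyharmonic (Suc j) u) x
      = (\<Sum>b\<in>Basis. - 1 * iter_deriv vs (iter_deriv [b, b] (polyharmonic j u)) x)"
    unfolding polyharmonic_Suc by (intro iter_deriv_sum[OF _ _ assms(1,3)]) auto
  also have "\<dots> = (\<Sum>b\<in>Basis. - 1 * iter_deriv (b # b # vs) (polyharmonic j u) x)"
  proof (rule sum.cong[OF refl])
    fix b :: 'a
    have "iter_deriv (vs @ [b, b]) (polyharmonic j u) x = iter_deriv (b # b # vs) (polyharmonic j u) x"
      using C by (intro iter_deriv_perm[OF assms(1) _ _ assms(3)]) (auto simp del: Ck_on.simps)
    then show "- 1 * iter_deriv vs (iter_deriv [b, b] (polyharmonic j u)) x = - 1 * iter_deriv (b # b # vs) (polyharmonic j u) x"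
      by (simp only: iter_deriv_append)
  qed
  finally show ?thesis by (simp add: sum_negf)
qed

lemma bounded_image_cong: "bounded (f ` G) \<Longrightarrow> (\<And>x. x \<in> G \<Longrightarrow> f x = g x) \<Longrightarrow> bounded (g ` G)"
  by (metis image_cong)

lemma bounded_polyharmonic:
  fixes u :: "'a::euclidean_space \<Rightarrow> real"
  assumes "open G" "Ck_on (length vs + 2 * j) G u"
    "\<And>ws. length ws = length vs + 2 * j \<Longrightarrow> bounded (iter_deriv ws u ` G)"
  shows "bounded (iter_deriv vs (polyharmonic j u) ` G)"
  using assms(2,3)
proof (induction j arbitrary: vs)
  case (Suc j)
  have "bounded (iter_deriv (b # b # vs) (polyharmonic j u) ` G)" for b
    using Suc.prems by (intro Suc.IH) (auto simp del: Ck_on.simps)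
  then have "bounded ((\<lambda>x. \<Sum>b\<in>Basis. iter_deriv (b # b # vs) (polyharmonic j u) x) ` G)"
    by (intro bounded_image_sum)
  then have "bounded ((\<lambda>x. - (\<Sum>b\<in>Basis. iter_deriv (b # b # vs) (polyharmonic j u) x)) ` G)"
    by (simp add: bounded_iff)
  then show ?case
    by (rule bounded_image_cong) (use iter_deriv_polyharmonic_Suc[OF assms(1) Suc.prems(1)] in simp)
qed (simp add: polyharmonic_0)

text \<open>S k interpolates between the two sides. Each step unfolds one factor of the polyharmonic
  operator into two derivatives, leaves one on u and moves the other to v. Boundary contributions
  are absent since only derivatives of v of order below m are left undifferentiated.\<close>

theorem weak_formulation:
  fixes u v :: "'a::euclidean_space \<Rightarrow> real"
  assumes G: "open G" "bounded G"
    and u: "Ck_on (2 * m) G u" "\<And>vs. length vs < 2 * m \<Longrightarrow> bounded (iter_deriv vs u ` G)"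
      "bounded (polyharmonic m u ` G)"
    and v: "Ck_on m G v" "\<And>vs. length vs \<le> m \<Longrightarrow> bounded (iter_deriv vs v ` G)"
      "\<And>vs. length vs < m \<Longrightarrow> continuous_on UNIV (zext G (iter_deriv vs v))"
  shows "(LINT x:G|lborel. polyharmonic m u x * v x)
    = (\<Sum>bs\<in>basis_lists m. LINT x:G|lborel. iter_deriv bs u x * iter_deriv bs v x)"
proof -
  define S where "S k = (\<Sum>bs\<in>basis_lists k. LINT x:G|lborel. iter_deriv bs (polyharmonic (m - k) u) x * iter_deriv bs v x)" for k
  have step: "S k = S (Suc k)" if k: "k < m" for k
  proof -
    define j where "j = m - Suc k"
    have j: "m - k = Suc j" "m - Suc k = j" "k + Suc j = m" using k by (auto simp: j_def)
    have main: "(LINT x:G|lborel. iter_deriv bs (polyharmonic (m - k) u) x * iter_deriv bs v x)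
      = (\<Sum>b\<in>Basis. LINT x:G|lborel. iter_deriv (b # bs) (polyharmonic (m - Suc k) u) x * iter_deriv (b # bs) v x)"
      if "bs \<in> basis_lists k" for bs
    proof -
      have len: "length bs = k" using length_basis_lists[OF that] .
      let ?g = "polyharmonic j u"
      let ?w = "iter_deriv bs v"
      have Cg: "Ck_on (Suc (Suc k)) G ?g"
        using k j(3) by (intro Ck_on_polyharmonic G Ck_on_le[OF u(1)]) auto
      have W1: "Ck_on 1 G (iter_deriv (b # bs) ?g)" for b
        using Cg len by (intro Ck_on_iter_deriv) (simp del: Ck_on.simps)
      have W2: "bounded (iter_deriv (b # bs) ?g ` G)" for b
        using j(3) len by (intro bounded_polyharmonic G Ck_on_le[OF u(1)] u(2)) auto
      have div: "iter_deriv bs (polyharmonic (Suc j) u) x = - (\<Sum>b\<in>Basis. dir_deriv b (iter_deriv (b # bs) ?g) x)"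
        if "x \<in> G" for x
        using iter_deriv_polyharmonic_Suc[OF G(1) Ck_on_le[OF u(1)] that, of bs j] j(3) len by simp
      have "bounded (iter_deriv bs (polyharmonic (Suc j) u) ` G)"
      \<comment> \<open>This divergence has order 2m - k in u. Only for k = 0 is the order 2m, and
        then it is the polyharmonic operator itself, whose boundedness is a separate
        assumption.\<close>
      proof (cases "k = 0")
        case True
        then show ?thesis using u(3) j len by simp
      next
        case False
        then show ?thesis
          using j(3) len by (intro bounded_polyharmonic G Ck_on_le[OF u(1)] u(2)) auto
      qed
      then have "bounded ((\<lambda>x. - iter_deriv bs (polyharmonic (Suc j) u) x) ` G)" by (simp add: bounded_iff)
      then have W3: "bounded ((\<lambda>x. \<Sum>b\<in>Basis. dir_deriv b (iter_deriv (b # bs) ?g) x) ` G)"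
        by (rule bounded_image_cong) (simp add: div)
      have w1: "Ck_on 1 G ?w" using len k by (intro Ck_on_iter_deriv Ck_on_le[OF v(1)]) auto
      have w2: "bounded (dir_deriv b ?w ` G)" for b using v(2)[of "b # bs"] len k by simp
      have w3: "continuous_on UNIV (zext G ?w)" using v(3) len k by simp
      have cW: "continuous_on G (iter_deriv (b # bs) ?g)" "continuous_on G (dir_deriv b ?w)" for b
        using Ck_on_imp_continuous_on[OF W1] w1 by auto
      have "(LINT x:G|lborel. iter_deriv bs (polyharmonic (Suc j) u) x * ?w x)
         = (LINT x:G|lborel. - ((\<Sum>b\<in>Basis. dir_deriv b (iter_deriv (b # bs) ?g) x) * ?w x))"
        using G(1) div by (intro set_lebesgue_integral_cong) auto
      also have "\<dots> = - (LINT x:G|lborel. (\<Sum>b\<in>Basis. dir_deriv b (iter_deriv (b # bs) ?g) x) * ?w x)"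
        by (simp add: set_lebesgue_integral_def)
      also have "\<dots> = (LINT x:G|lborel. \<Sum>b\<in>Basis. iter_deriv (b # bs) ?g x * dir_deriv b ?w x)"
        using integration_by_parts[of G "\<lambda>b. iter_deriv (b # bs) ?g" ?w, OF G W1 W2 W3 w1 w2 w3] by simp
      also have "\<dots> = (\<Sum>b\<in>Basis. LINT x:G|lborel. iter_deriv (b # bs) ?g x * dir_deriv b ?w x)"
        by (intro set_integral_sum set_integrable_bounded_continuous[OF G] continuous_on_mult cW bounded_image_mult W2 w2)
      finally show ?thesis by (simp add: j)
    qed
    show ?thesis unfolding S_def sum_basis_lists_Suc by (rule sum.cong[OF refl main])
  qed
  have "k \<le> m \<Longrightarrow> S 0 = S k" for k by (induction k) (use step in auto)
  from this[of m] show ?thesis by (simp add: S_def basis_lists_0 polyharmonic_0)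
qed

text \<open>Integrating by parts with the field (x . b) w in direction b and 0 in the others gives
  \<integral> w^2 = -2 \<integral> (x . b) w D_b w. The factor 4 R^2 comes from completing the
  square.\<close>

lemma Poincare_inequality:
  fixes w :: "'a::euclidean_space \<Rightarrow> real"
  assumes G: "open G" and R: "\<And>x. x \<in> G \<Longrightarrow> norm x \<le> R" and b: "b \<in> Basis"
    and w: "Ck_on 1 G w" "\<And>c. bounded (dir_deriv c w ` G)" "bounded (w ` G)"
    and zw: "continuous_on UNIV (zext G w)"
  shows "(LINT x:G|lborel. (w x)\<^sup>2) \<le> 4 * R\<^sup>2 * (LINT x:G|lborel. (dir_deriv b w x)\<^sup>2)"
proof -
  have bG: "bounded G" using R by (auto simp: bounded_iff)
  define W where "W c x = (if c = b then (x \<bullet> b) * w x else 0)" for c x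
  have dw: "w differentiable (at x)" if "x \<in> G" for x using w(1) that by simp
  have D: "((\<lambda>x. (x \<bullet> b) * w x) has_derivative (\<lambda>h. (x \<bullet> b) * dir_deriv h w x + (h \<bullet> b) * w x)) (at x)"
    if "x \<in> G" for x
    using dw[OF that] unfolding frechet_derivative_works
    by (intro has_derivative_mult) (auto intro!: derivative_eq_intros)
  have dirW: "dir_deriv h (W c) x = (if c = b then (x \<bullet> b) * dir_deriv h w x + (h \<bullet> b) * w x else 0)"
    if "x \<in> G" for h c x
    using fun_cong[OF frechet_derivative_at[OF D[OF that]], of h]
    by (cases "c = b") (auto simp: W_def[abs_def])
  have diffW: "W c differentiable (at x)" if "x \<in> G" for c x
    using D[OF that] by (cases "c = b") (auto simp: W_def[abs_def] differentiable_def)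
  have cw: "continuous_on G w" "continuous_on G (dir_deriv c w)" for c
    using Ck_on_imp_continuous_on[OF w(1)] w(1) by auto
  have cdW: "continuous_on G (dir_deriv h (W c))" for h c
  proof -
    have "continuous_on G (\<lambda>x. if c = b then (x \<bullet> b) * dir_deriv h w x + (h \<bullet> b) * w x else 0)"
      by (cases "c = b") (auto intro!: continuous_intros cw)
    then show ?thesis by (rule continuous_on_eq) (simp add: dirW)
  qed
  have CW: "Ck_on 1 G (W c)" for c using diffW cdW by simp
  have bx: "bounded ((\<lambda>x. x \<bullet> b) ` G)"
    unfolding bounded_iff using R Basis_le_norm[OF b] by (auto intro!: exI[of _ R] intro: order_trans)
  have bW: "bounded (W c ` G)" for c
  proof (cases "c = b")
    case True
    then show ?thesis using bounded_image_mult[OF bx w(3)] by (simp add: W_def[abs_def])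
  qed (auto simp: W_def[abs_def] bounded_iff)
  have divW: "(\<Sum>c\<in>Basis. dir_deriv c (W c) x) = (x \<bullet> b) * dir_deriv b w x + w x" if "x \<in> G" for x
  proof -
    have "(\<Sum>c\<in>Basis. dir_deriv c (W c) x) = (\<Sum>c\<in>Basis. if c = b then (x \<bullet> b) * dir_deriv b w x + w x else 0)"
      using b by (intro sum.cong) (auto simp: dirW[OF that])
    also have "\<dots> = (x \<bullet> b) * dir_deriv b w x + w x" using b by simp
    finally show ?thesis .
  qed
  have bdiv: "bounded ((\<lambda>x. \<Sum>c\<in>Basis. dir_deriv c (W c) x) ` G)"
  proof (rule bounded_image_cong)
    show "bounded ((\<lambda>x. (x \<bullet> b) * dir_deriv b w x + w x) ` G)"
      by (intro bounded_plus_comp bounded_image_mult bx w)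
  qed (simp add: divW)
  let ?P = "\<lambda>x. (x \<bullet> b) * dir_deriv b w x * w x"
  have int: "set_integrable lborel G (\<lambda>x. w x * w x)" "set_integrable lborel G ?P"
    "set_integrable lborel G (\<lambda>x. dir_deriv b w x * dir_deriv b w x)"
    by (intro set_integrable_bounded_continuous[OF G bG] continuous_intros bounded_image_mult cw bx w)+
  have "(LINT x:G|lborel. (\<Sum>c\<in>Basis. dir_deriv c (W c) x) * w x) = - (LINT x:G|lborel. \<Sum>c\<in>Basis. W c x * dir_deriv c w x)"
    by (rule integration_by_parts[OF G bG CW bW bdiv w(1,2) zw])
  moreover have "(LINT x:G|lborel. (\<Sum>c\<in>Basis. dir_deriv c (W c) x) * w x) = (LINT x:G|lborel. ?P x + w x * w x)"
    using G divW by (intro set_lebesgue_integral_cong) (auto simp: algebra_simps)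
  moreover have "(LINT x:G|lborel. \<Sum>c\<in>Basis. W c x * dir_deriv c w x) = (LINT x:G|lborel. ?P x)"
  proof -
    have "(\<Sum>c\<in>Basis. W c x * dir_deriv c w x) = (\<Sum>c\<in>Basis. if c = b then ?P x else 0)" for x
      by (intro sum.cong) (auto simp: W_def)
    then show ?thesis using b by simp
  qed
  ultimately have eq: "(LINT x:G|lborel. w x * w x) = - 2 * (LINT x:G|lborel. ?P x)"
    using int by (simp add: set_integral_add)
  \<comment> \<open>The integrand dominates the square of w + 2 (x . b) D_b w; by \<open>eq\<close>
    its first two terms integrate to minus the integral of w squared.\<close>
  have "0 \<le> (LINT x:G|lborel. w x * w x + 4 * ?P x + 4 * R\<^sup>2 * (dir_deriv b w x * dir_deriv b w x))"
    unfolding set_lebesgue_integral_def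
  proof (rule Bochner_Integration.integral_nonneg)
    fix x
    have "0 \<le> w x * w x + 4 * ?P x + 4 * R\<^sup>2 * (dir_deriv b w x * dir_deriv b w x)" if x: "x \<in> G"
    proof -
      have "\<bar>x \<bullet> b\<bar> \<le> R" using R[OF x] Basis_le_norm[OF b, of x] by simp
      then have "(x \<bullet> b)\<^sup>2 \<le> R\<^sup>2" by (metis abs_ge_zero power2_abs power_mono)
      then have "(x \<bullet> b)\<^sup>2 * (dir_deriv b w x)\<^sup>2 \<le> R\<^sup>2 * (dir_deriv b w x)\<^sup>2" by (intro mult_right_mono) auto
      moreover have "0 \<le> (w x + 2 * ((x \<bullet> b) * dir_deriv b w x))\<^sup>2" by simp
      ultimately show ?thesis by (simp add: power2_eq_square algebra_simps)
    qed
    then show "0 \<le> indicator G x *\<^sub>R (w x * w x + 4 * ?P x + 4 * R\<^sup>2 * (dir_deriv b w x * dir_deriv b w x))"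
      by (simp add: indicator_def)
  qed
  also have "\<dots> = (LINT x:G|lborel. w x * w x) + 4 * (LINT x:G|lborel. ?P x)
      + 4 * R\<^sup>2 * (LINT x:G|lborel. dir_deriv b w x * dir_deriv b w x)"
    using int by (simp add: set_integral_add)
  finally show ?thesis using eq by (simp add: power2_eq_square)
qed

text \<open>The same direction b is used m times, so that the right side is a single term of the
  energy.\<close>

lemma Poincare_inequality_iterated:
  fixes u :: "'a::euclidean_space \<Rightarrow> real"
  assumes G: "open G" and R: "\<And>x. x \<in> G \<Longrightarrow> norm x \<le> R" and b: "b \<in> Basis"
    and u: "Ck_on m G u" "\<And>vs. length vs \<le> m \<Longrightarrow> bounded (iter_deriv vs u ` G)"
      "\<And>vs. length vs < m \<Longrightarrow> continuous_on UNIV (zext G (iter_deriv vs u))"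
  shows "(LINT x:G|lborel. (u x)\<^sup>2) \<le> (4 * R\<^sup>2) ^ m * (LINT x:G|lborel. (iter_deriv (replicate m b) u x)\<^sup>2)"
proof -
  have "k \<le> m \<Longrightarrow> (LINT x:G|lborel. (u x)\<^sup>2) \<le> (4 * R\<^sup>2) ^ k * (LINT x:G|lborel. (iter_deriv (replicate k b) u x)\<^sup>2)" for k
  proof (induction k)
    case (Suc k)
    let ?w = "iter_deriv (replicate k b) u"
    have "(LINT x:G|lborel. (?w x)\<^sup>2) \<le> 4 * R\<^sup>2 * (LINT x:G|lborel. (dir_deriv b ?w x)\<^sup>2)"
    proof (rule Poincare_inequality[OF G R b])
      show "Ck_on 1 G ?w" using Suc.prems by (intro Ck_on_iter_deriv Ck_on_le[OF u(1)]) auto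
      show "bounded (dir_deriv c ?w ` G)" for c using u(2)[of "c # replicate k b"] Suc.prems by simp
      show "bounded (?w ` G)" "continuous_on UNIV (zext G ?w)" using u Suc.prems by auto
    qed
    then have "(4 * R\<^sup>2) ^ k * (LINT x:G|lborel. (?w x)\<^sup>2) \<le> (4 * R\<^sup>2) ^ k * (4 * R\<^sup>2 * (LINT x:G|lborel. (dir_deriv b ?w x)\<^sup>2))"
      by (intro mult_left_mono) auto
    moreover have "(LINT x:G|lborel. (u x)\<^sup>2) \<le> (4 * R\<^sup>2) ^ k * (LINT x:G|lborel. (?w x)\<^sup>2)"
      using Suc by simp
    ultimately have "(LINT x:G|lborel. (u x)\<^sup>2) \<le> (4 * R\<^sup>2) ^ k * (4 * R\<^sup>2 * (LINT x:G|lborel. (dir_deriv b ?w x)\<^sup>2))"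
      by (rule order_trans[rotated])
    then show ?case by (simp only: power_Suc2 mult.assoc replicate_Suc iter_deriv.simps)
  qed simp
  then show ?thesis by simp
qed

section \<open>Derivatives and integrals under dilations\<close>

lemma Ck_on_cmult:
  assumes "open S" "Ck_on k S g"
  shows "Ck_on k S (\<lambda>x. c * g x :: real)"
  using Ck_on_sum[of "{()}" k S "\<lambda>_. g" c] assms by simp

text \<open>The preimage of \<Omega> is the domain on which a function on \<Omega> composed with the
  dilation lives; for t > 1 it is \<Omega> shrunk towards y by the factor 1/t.\<close>

definition dilation :: "'a::euclidean_space \<Rightarrow> real \<Rightarrow> 'a \<Rightarrow> 'a" where
  "dilation y t x = y + t *\<^sub>R (x - y)"

context
  fixes \<Omega> :: "'a::euclidean_space set" and y :: 'a and t :: real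
  assumes \<Omega>: "open \<Omega>" and t: "t > 0"
begin

lemma dilation_affine: "dilation y t x = (y - t *\<^sub>R y) + t *\<^sub>R x"
  by (simp add: dilation_def algebra_simps)

lemma open_dilation_vimage: "open (dilation y t -` \<Omega>)"
  unfolding dilation_def by (intro open_vimage \<Omega> continuous_intros)

lemma dir_deriv_dilation:
  fixes g :: "'a \<Rightarrow> real"
  assumes "g differentiable (at (dilation y t x))"
  shows "(\<lambda>x. g (dilation y t x)) differentiable (at x)"
    "dir_deriv v (\<lambda>x. g (dilation y t x)) x = t * dir_deriv v g (dilation y t x)"
proof -
  have g: "(g has_derivative frechet_derivative g (at (dilation y t x))) (at (dilation y t x))"
    using assms frechet_derivative_works by blast
  have "(dilation y t has_derivative (\<lambda>h. t *\<^sub>R h)) (at x)"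
    unfolding dilation_def by (auto intro!: derivative_eq_intros)
  from has_derivative_compose[OF this g]
  have D: "((\<lambda>x. g (dilation y t x)) has_derivative (\<lambda>h. frechet_derivative g (at (dilation y t x)) (t *\<^sub>R h))) (at x)" .
  then show "(\<lambda>x. g (dilation y t x)) differentiable (at x)" by (rule differentiableI)
  show "dir_deriv v (\<lambda>x. g (dilation y t x)) x = t * dir_deriv v g (dilation y t x)"
    using fun_cong[OF frechet_derivative_at[OF D], of v] linear_frechet_derivative[OF assms]
    by (simp add: linear_cmul)
qed

lemma Ck_on_dilation:
  assumes "Ck_on k \<Omega> g"
  shows "Ck_on k (dilation y t -` \<Omega>) (\<lambda>x. g (dilation y t x))"
  using assms
proof (induction k arbitrary: g)
  case 0
  then have "continuous_on \<Omega> g" by simp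
  moreover have "continuous_on (dilation y t -` \<Omega>) (dilation y t)" unfolding dilation_def[abs_def] by (intro continuous_intros)
  ultimately have "continuous_on (dilation y t -` \<Omega>) (\<lambda>x. g (dilation y t x))" by (rule continuous_on_compose2) auto
  then show ?case by simp
next
  case (Suc k)
  have "Ck_on k (dilation y t -` \<Omega>) (dir_deriv v (\<lambda>x. g (dilation y t x)))" for v
  proof (rule Ck_on_cong[OF open_dilation_vimage])
    show "Ck_on k (dilation y t -` \<Omega>) (\<lambda>x. t * dir_deriv v g (dilation y t x))"
      using Suc by (intro Ck_on_cmult open_dilation_vimage) auto
    show "t * dir_deriv v g (dilation y t x) = dir_deriv v (\<lambda>x. g (dilation y t x)) x" if "x \<in> dilation y t -` \<Omega>" for x
      using Suc.prems that by (simp add: dir_deriv_dilation)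
  qed
  then show ?case using Suc.prems by (auto intro!: dir_deriv_dilation)
qed

lemma iter_deriv_dilation:
  assumes "Ck_on (length vs) \<Omega> g" "x \<in> dilation y t -` \<Omega>"
  shows "iter_deriv vs (\<lambda>x. g (dilation y t x)) x = t ^ length vs * iter_deriv vs g (dilation y t x)"
  using assms
proof (induction vs arbitrary: x)
  case (Cons v vs)
  have IH: "iter_deriv vs (\<lambda>x. g (dilation y t x)) z = t ^ length vs * iter_deriv vs g (dilation y t z)" if "z \<in> dilation y t -` \<Omega>" for z
    using Cons.IH[OF Ck_on_Suc_imp that] Cons.prems(1) by (simp del: Ck_on.simps)
  have "Ck_on (Suc 0) \<Omega> (iter_deriv vs g)"
    using Cons.prems(1) by (intro Ck_on_iter_deriv) (simp del: Ck_on.simps)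
  then have "Ck_on (Suc 0) \<Omega> (\<lambda>x. t ^ length vs * iter_deriv vs g x)" by (rule Ck_on_cmult[OF \<Omega>])
  moreover have "iter_deriv vs g differentiable (at (dilation y t x))"
    using Cons.prems(2) \<open>Ck_on (Suc 0) \<Omega> (iter_deriv vs g)\<close> by simp
  ultimately have D: "(\<lambda>x. t ^ length vs * iter_deriv vs g x) differentiable (at (dilation y t x))"
     "(iter_deriv vs g has_derivative frechet_derivative (iter_deriv vs g) (at (dilation y t x))) (at (dilation y t x))"
    using Cons.prems(2) by (auto simp: frechet_derivative_works)
  have "iter_deriv (v # vs) (\<lambda>x. g (dilation y t x)) x = dir_deriv v (\<lambda>x. t ^ length vs * iter_deriv vs g (dilation y t x)) x"
    using dir_deriv_cong[OF open_dilation_vimage Cons.prems(2) IH] by simp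
  also have "\<dots> = t * dir_deriv v (\<lambda>x. t ^ length vs * iter_deriv vs g x) (dilation y t x)"
    by (rule dir_deriv_dilation(2)[OF D(1)])
  also have "dir_deriv v (\<lambda>x. t ^ length vs * iter_deriv vs g x) (dilation y t x) = t ^ length vs * dir_deriv v (iter_deriv vs g) (dilation y t x)"
    using fun_cong[OF frechet_derivative_at[OF has_derivative_mult_right[OF D(2), of "t ^ length vs"]], of v] by simp
  finally show ?case by simp
qed simp

lemma integral_dilation:
  assumes "continuous_on \<Omega> g"
  shows "(LINT x:dilation y t -` \<Omega>|lborel. g (dilation y t x)) = (LINT x:\<Omega>|lborel. g x) / t ^ DIM('a)"
proof -
  have "(\<lambda>x. indicator \<Omega> x *\<^sub>R g x) \<in> borel_measurable borel"
    using \<Omega> assms by (intro borel_measurable_continuous_on_indicator) auto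
  from lborel_integral_affine[OF this, of t "y - t *\<^sub>R y"] t
  have "(LINT x:\<Omega>|lborel. g x) = t ^ DIM('a) * (\<integral>x. indicator \<Omega> (dilation y t x) *\<^sub>R g (dilation y t x) \<partial>lborel)"
    by (simp add: set_lebesgue_integral_def dilation_affine)
  moreover have "indicator \<Omega> (dilation y t x) = (indicator (dilation y t -` \<Omega>) x :: real)" for x by (simp add: indicator_def)
  ultimately show ?thesis using t by (simp add: set_lebesgue_integral_def)
qed

end

section \<open>The Pohozaev inequality\<close>

lemma set_integral_mono_nonneg_subset:
  fixes g :: "'a \<Rightarrow> real"
  assumes "set_integrable M A g" "set_integrable M B g" "A \<subseteq> B" "\<And>x. x \<in> B \<Longrightarrow> 0 \<le> g x"
  shows "(LINT x:A|M. g x) \<le> (LINT x:B|M. g x)"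
  using assms unfolding set_integrable_def set_lebesgue_integral_def
  by (intro integral_mono) (auto simp: indicator_def)

text \<open>Cauchy-Schwarz in the form a b \<le> (k/2) a^2 + (1/(2k)) b^2. The weight k = t powr
  (-N/2) is the factor by which the dilation scales the L2 norm, so both halves get the same
  bound.\<close>

lemma dilation_Cauchy_Schwarz:
  fixes a :: "'a::euclidean_space \<Rightarrow> real"
  assumes \<Omega>: "open \<Omega>" "bounded \<Omega>" and t: "t > 0" and sub: "dilation y t -` \<Omega> \<subseteq> \<Omega>"
    and a: "continuous_on \<Omega> a" "bounded (a ` \<Omega>)"
  shows "(LINT x:dilation y t -` \<Omega>|lborel. a x * a (dilation y t x)) \<le> t powr (- real DIM('a) / 2) * (LINT x:\<Omega>|lborel. (a x)\<^sup>2)"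
proof -
  let ?G = "dilation y t -` \<Omega>" and ?d = "dilation y t"
  define k where "k = t powr (- real DIM('a) / 2)"
  have k: "k > 0" using t by (simp add: k_def)
  have kk: "1 / k / t ^ DIM('a) = k"
  proof -
    have "k * k * t ^ DIM('a) = 1"
      using t by (simp add: k_def flip: powr_add powr_realpow)
    then show ?thesis using k t by (simp add: field_simps)
  qed
  have G: "open ?G" "bounded ?G" using open_dilation_vimage[OF \<Omega>(1) t] bounded_subset[OF \<Omega>(2) sub] by auto
  have cd: "continuous_on ?G ?d" unfolding dilation_def[abs_def] by (intro continuous_intros)
  have c1: "continuous_on ?G a" using a(1) sub by (rule continuous_on_subset)
  have c2: "continuous_on ?G (\<lambda>x. a (?d x))" by (rule continuous_on_compose2[OF a(1) cd]) auto
  have b1: "bounded (a ` ?G)" using a(2) sub by (meson bounded_subset image_mono)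
  have b2: "bounded ((\<lambda>x. a (?d x)) ` ?G)" by (rule bounded_subset[OF a(2)]) auto
  note si = set_integrable_bounded_continuous[OF G] 
  have i1: "set_integrable lborel ?G (\<lambda>x. (a x)\<^sup>2)" and i2: "set_integrable lborel ?G (\<lambda>x. (a (?d x))\<^sup>2)"
    and i3: "set_integrable lborel ?G (\<lambda>x. a x * a (?d x))"
    unfolding power2_eq_square by (intro si continuous_intros bounded_image_mult c1 c2 b1 b2)+
  have i4: "set_integrable lborel \<Omega> (\<lambda>x. (a x)\<^sup>2)"
    unfolding power2_eq_square by (intro set_integrable_bounded_continuous \<Omega> continuous_intros bounded_image_mult a)
  define A where "A = (LINT x:\<Omega>|lborel. (a x)\<^sup>2)"
  have 1: "(LINT x:?G|lborel. (a x)\<^sup>2) \<le> A"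
    unfolding A_def by (rule set_integral_mono_nonneg_subset[OF i1 i4 sub]) auto
  have 2: "(LINT x:?G|lborel. (a (?d x))\<^sup>2) = A / t ^ DIM('a)"
    unfolding A_def using a(1) by (intro integral_dilation[OF \<Omega>(1) t] continuous_intros)
  have "(LINT x:?G|lborel. a x * a (?d x)) \<le> (LINT x:?G|lborel. k / 2 * (a x)\<^sup>2 + 1 / k / 2 * (a (?d x))\<^sup>2)"
  proof (rule set_integral_mono[OF i3])
    show "set_integrable lborel ?G (\<lambda>x. k / 2 * (a x)\<^sup>2 + 1 / k / 2 * (a (?d x))\<^sup>2)"
      using i1 i2 by (intro set_integral_add set_integrable_mult_right) auto
    fix x
    have "0 \<le> (k * a x - a (?d x))\<^sup>2" by simp
    then have "2 * k * (a x * a (?d x)) \<le> k\<^sup>2 * (a x)\<^sup>2 + (a (?d x))\<^sup>2"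
      by (simp add: power2_eq_square algebra_simps)
    then show "a x * a (?d x) \<le> k / 2 * (a x)\<^sup>2 + 1 / k / 2 * (a (?d x))\<^sup>2"
      using k by (simp add: field_simps power2_eq_square)
  qed
  also have "\<dots> = k / 2 * (LINT x:?G|lborel. (a x)\<^sup>2) + 1 / k / 2 * (LINT x:?G|lborel. (a (?d x))\<^sup>2)"
    using i1 i2 by (subst set_integral_add) (auto intro!: set_integrable_mult_right)
  also have "\<dots> \<le> k / 2 * A + 1 / k / 2 * (A / t ^ DIM('a))"
    using 1 k unfolding 2 by (intro add_right_mono mult_left_mono) auto
  also have "1 / k / 2 * (A / t ^ DIM('a)) = (1 / k / t ^ DIM('a)) / 2 * A" by simp
  finally show ?thesis unfolding kk by (simp add: k_def A_def mult.commute)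
qed

context
  fixes \<Omega> :: "'a::euclidean_space set" and m :: nat and h :: "real \<Rightarrow> real" and u :: "'a \<Rightarrow> real"
  assumes smooth: "smooth_domain \<Omega>" and bounded: "bounded \<Omega>" and m: "m \<ge> 1"
    and reg: "regular_solution m \<Omega> h u" and h: "continuous_on UNIV h"
begin

lemma open_domain: "open \<Omega>"
  using smooth_domainD(1)[OF smooth] .

text \<open>Boundedness of \<open>polyharmonic m u\<close> comes from the equation, u being bounded
  and h continuous; regularity up to the boundary reaches only order 2m - 1.\<close>

lemma solution_facts:
  shows "Ck_on (2 * m) \<Omega> u" "\<And>vs. length vs < 2 * m \<Longrightarrow> bounded (iter_deriv vs u ` \<Omega>)"
    "\<And>vs. length vs < m \<Longrightarrow> continuous_on UNIV (zext \<Omega> (iter_deriv vs u))"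
    "\<And>x. x \<in> \<Omega> \<Longrightarrow> polyharmonic m u x = h (u x)"
    "continuous_on \<Omega> u" "bounded (u ` \<Omega>)" "continuous_on UNIV (zext \<Omega> u)"
    "bounded (polyharmonic m u ` \<Omega>)"
proof -
  show C: "Ck_on (2 * m) \<Omega> u" using reg by (simp add: regular_solution_def)
  show p: "polyharmonic m u x = h (u x)" if "x \<in> \<Omega>" for x
    using reg that by (simp add: regular_solution_def)
  have Ck: "Ck_closure (2 * m - 1) \<Omega> u" using reg by (simp add: regular_solution_def)
  show b: "bounded (iter_deriv vs u ` \<Omega>)" if "length vs < 2 * m" for vs
    using that by (intro Ck_closure_bounded[OF Ck bounded]) simp
  show z: "continuous_on UNIV (zext \<Omega> (iter_deriv vs u))" if "length vs < m" for vs
  proof (rule continuous_zext[OF open_domain])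
    show "continuous_on \<Omega> (iter_deriv vs u)"
      using that by (intro Ck_on_imp_continuous_on[of 0] Ck_on_iter_deriv Ck_on_le[OF C]) simp
    show "(iter_deriv vs u \<longlongrightarrow> 0) (at x within \<Omega>)" if "x \<in> frontier \<Omega>" for x
      using reg \<open>length vs < m\<close> that
      by (intro boundary_derivatives_vanish[OF smooth bounded Ck]) (auto simp: regular_solution_def)
  qed
  show "continuous_on \<Omega> u" using Ck_on_imp_continuous_on[OF C] .
  show bu: "bounded (u ` \<Omega>)" using b[of "[]"] m by simp
  show "continuous_on UNIV (zext \<Omega> u)" using z[of "[]"] m by simp
  have "compact (closure (u ` \<Omega>))" using bu by simp
  then have "bounded (h ` closure (u ` \<Omega>))"
    using h by (intro compact_imp_bounded compact_continuous_image) (auto intro: continuous_on_subset)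
  then show "bounded (polyharmonic m u ` \<Omega>)"
    by (rule bounded_subset) (use closure_subset p in force)
qed

lemma energy_identity:
  "(LINT x:\<Omega>|lborel. h (u x) * u x) = (\<Sum>bs\<in>basis_lists m. LINT x:\<Omega>|lborel. (iter_deriv bs u x)\<^sup>2)"
proof -
  have "(LINT x:\<Omega>|lborel. h (u x) * u x) = (LINT x:\<Omega>|lborel. polyharmonic m u x * u x)"
    using solution_facts(4) open_domain by (intro set_lebesgue_integral_cong) auto
  also have "\<dots> = (\<Sum>bs\<in>basis_lists m. LINT x:\<Omega>|lborel. iter_deriv bs u x * iter_deriv bs u x)"
    using m solution_facts by (intro weak_formulation open_domain bounded Ck_on_le[OF solution_facts(1)]) auto
  finally show ?thesis by (simp add: power2_eq_square)
qed

lemma energy_ge_L2: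
  assumes "\<And>x. x \<in> \<Omega> \<Longrightarrow> norm x \<le> R"
  shows "(LINT x:\<Omega>|lborel. (u x)\<^sup>2) \<le> (4 * R\<^sup>2) ^ m * (LINT x:\<Omega>|lborel. h (u x) * u x)"
proof -
  obtain b :: 'a where b: "b \<in> Basis" by (meson SOME_Basis)
  have "(LINT x:\<Omega>|lborel. (u x)\<^sup>2) \<le> (4 * R\<^sup>2) ^ m * (LINT x:\<Omega>|lborel. (iter_deriv (replicate m b) u x)\<^sup>2)"
    using m solution_facts by (intro Poincare_inequality_iterated[OF open_domain assms b] Ck_on_le[OF solution_facts(1)]) auto
  also have "(LINT x:\<Omega>|lborel. (iter_deriv (replicate m b) u x)\<^sup>2) \<le> (LINT x:\<Omega>|lborel. h (u x) * u x)"
    unfolding energy_identity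
  proof (rule member_le_sum)
    show "replicate m b \<in> basis_lists m" using b by (auto simp: basis_lists_def)
    show "0 \<le> (LINT x:\<Omega>|lborel. (iter_deriv bs u x)\<^sup>2)" for bs
      unfolding set_lebesgue_integral_def by (intro Bochner_Integration.integral_nonneg) simp
  qed (rule finite_basis_lists)
  finally show ?thesis by (simp add: mult_left_mono)
qed

text \<open>The exponent is -\<alpha>: the m derivatives of the dilated function contribute t^m and
  Cauchy-Schwarz contributes t powr (-N/2).\<close>

lemma dilation_energy_le:
  assumes t: "t > 0" and sub: "dilation y t -` \<Omega> \<subseteq> \<Omega>"
  shows "(LINT x:\<Omega>|lborel. h (u x) * zext \<Omega> u (dilation y t x))
    \<le> t powr (real m - real DIM('a) / 2) * (LINT x:\<Omega>|lborel. h (u x) * u x)"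
proof -
  let ?G = "dilation y t -` \<Omega>" and ?d = "dilation y t"
  define v where "v x = u (?d x)" for x
  have G: "open ?G" "bounded ?G" using open_dilation_vimage[OF open_domain t] bounded_subset[OF bounded sub] by auto
  have Cm: "Ck_on m \<Omega> u" using Ck_on_le[OF solution_facts(1)] by simp
  have dv: "iter_deriv vs v x = t ^ length vs * iter_deriv vs u (?d x)" if "x \<in> ?G" "length vs \<le> m" for vs x
    unfolding v_def using that by (intro iter_deriv_dilation[OF open_domain t Ck_on_le[OF Cm]]) auto
  have "(LINT x:\<Omega>|lborel. h (u x) * zext \<Omega> u (?d x)) = (LINT x:?G|lborel. polyharmonic m u x * v x)"
    unfolding set_lebesgue_integral_def
    by (rule Bochner_Integration.integral_cong)
       (use sub solution_facts(4) in \<open>auto simp: indicator_def zext_def v_def\<close>)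
  also have "\<dots> = (\<Sum>bs\<in>basis_lists m. LINT x:?G|lborel. iter_deriv bs u x * iter_deriv bs v x)"
  \<comment> \<open>The equation is tested on the shrunken domain: there the dilated function is m
    times continuously differentiable and vanishes to order m at the boundary, while u keeps its
    bounds by restriction.\<close>
  proof (rule weak_formulation[OF G])
    show "Ck_on (2 * m) ?G u" using Ck_on_subset[OF solution_facts(1) sub] .
    show "bounded (iter_deriv vs u ` ?G)" if "length vs < 2 * m" for vs
      using solution_facts(2)[OF that] sub by (meson bounded_subset image_mono)
    show "bounded (polyharmonic m u ` ?G)"
      using solution_facts(8) sub by (meson bounded_subset image_mono)
    show "Ck_on m ?G v" unfolding v_def by (rule Ck_on_dilation[OF open_domain t Cm])
    fix vs :: "'a list"
    show "bounded (iter_deriv vs v ` ?G)" if l: "length vs \<le> m"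
    proof -
      have "bounded ((\<lambda>x. iter_deriv vs u (?d x)) ` ?G)"
        by (rule bounded_subset[OF solution_facts(2)[of vs]]) (use l m in auto)
      then have "bounded ((\<lambda>x. t ^ length vs * iter_deriv vs u (?d x)) ` ?G)"
        by (intro bounded_image_mult) (auto simp: bounded_iff)
      then show ?thesis by (rule bounded_image_cong) (use l in \<open>simp add: dv\<close>)
    qed
    show "continuous_on UNIV (zext ?G (iter_deriv vs v))" if l: "length vs < m"
    proof -
      have cd: "continuous_on UNIV ?d" unfolding dilation_def[abs_def] by (intro continuous_intros)
      have "continuous_on UNIV (\<lambda>x. t ^ length vs * zext \<Omega> (iter_deriv vs u) (?d x))"
        by (intro continuous_intros continuous_on_compose2[OF solution_facts(3)[OF l] cd]) auto
      moreover have "t ^ length vs * zext \<Omega> (iter_deriv vs u) (?d x) = zext ?G (iter_deriv vs v) x" for x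
        using dv[of x vs] l by (simp add: zext_def)
      ultimately show ?thesis by simp
    qed
  qed
  also have "\<dots> \<le> (\<Sum>bs\<in>basis_lists m. t powr (real m - real DIM('a) / 2) * (LINT x:\<Omega>|lborel. (iter_deriv bs u x)\<^sup>2))"
  proof (rule sum_mono)
    fix bs :: "'a list" assume "bs \<in> basis_lists m"
    then have len: "length bs = m" by (rule length_basis_lists)
    have "(LINT x:?G|lborel. iter_deriv bs u x * iter_deriv bs v x)
        = (LINT x:?G|lborel. t ^ m * (iter_deriv bs u x * iter_deriv bs u (?d x)))"
      using G len by (intro set_lebesgue_integral_cong) (auto simp: dv)
    also have "\<dots> = t ^ m * (LINT x:?G|lborel. iter_deriv bs u x * iter_deriv bs u (?d x))" by simp
    also have "\<dots> \<le> t ^ m * (t powr (- real DIM('a) / 2) * (LINT x:\<Omega>|lborel. (iter_deriv bs u x)\<^sup>2))"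
    proof (intro mult_left_mono dilation_Cauchy_Schwarz open_domain bounded t sub)
      show "continuous_on \<Omega> (iter_deriv bs u)"
        using len by (intro Ck_on_imp_continuous_on[of 0] Ck_on_iter_deriv Ck_on_le[OF Cm]) simp
      show "bounded (iter_deriv bs u ` \<Omega>)" using solution_facts(2) len m by simp
    qed (use t in simp)
    also have "\<dots> = t powr (real m - real DIM('a) / 2) * (LINT x:\<Omega>|lborel. (iter_deriv bs u x)\<^sup>2)"
      using t by (simp add: powr_realpow[symmetric] powr_add[symmetric] mult.assoc[symmetric])
    finally show "(LINT x:?G|lborel. iter_deriv bs u x * iter_deriv bs v x)
        \<le> t powr (real m - real DIM('a) / 2) * (LINT x:\<Omega>|lborel. (iter_deriv bs u x)\<^sup>2)" .
  qed
  finally show ?thesis by (simp add: energy_identity sum_distrib_left)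
qed

lemma set_integrable_comp_solution:
  fixes g :: "real \<Rightarrow> real"
  assumes "continuous_on UNIV g"
  shows "set_integrable lborel \<Omega> (\<lambda>x. g (u x))"
proof (rule set_integrable_bounded_continuous[OF open_domain bounded])
  show "continuous_on \<Omega> (\<lambda>x. g (u x))"
    by (rule continuous_on_compose2[OF assms solution_facts(5)]) auto
  have "compact (closure (u ` \<Omega>))" using solution_facts(6) by simp
  then have "bounded (g ` closure (u ` \<Omega>))"
    using assms by (intro compact_imp_bounded compact_continuous_image) (auto intro: continuous_on_subset)
  then show "bounded ((\<lambda>x. g (u x)) ` \<Omega>)"
    by (rule bounded_subset) (use closure_subset in force)
qed

text \<open>Dilation changes \<integral> H(u) by exactly (t powr (-N) - 1) E. To first order this
  change is \<integral> h(u) (u_t - u), which the energy comparison bounds by (t powr (-\<alpha>) -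
  1) A. The remainder is e times a multiple of t - 1, because the zero extension of u is Lipschitz.
  The right derivative at t = 1, followed by e to 0, gives the claim; u itself is never
  differentiated radially.\<close>

theorem Pohozaev_inequality:
  assumes star: "\<And>x. x \<in> frontier \<Omega> \<Longrightarrow> (x - y) \<bullet> outer_normal \<Omega> x \<ge> 0"
    and H: "\<And>s. (H has_real_derivative h s) (at s)" "H 0 = 0"
  shows "(real DIM('a) / 2 - real m) * (LINT x:\<Omega>|lborel. h (u x) * u x)
    \<le> real DIM('a) * (LINT x:\<Omega>|lborel. H (u x))"
proof -
  define A where "A = (LINT x:\<Omega>|lborel. h (u x) * u x)"
  define E where "E = (LINT x:\<Omega>|lborel. H (u x))"
  define N where "N = real DIM('a)"
  define U where "U = zext \<Omega> u"
  have contU: "continuous_on UNIV U" unfolding U_def by (rule solution_facts(7))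
  have cH: "continuous_on UNIV H" using H(1) by (meson DERIV_continuous_on has_field_derivative_at_within)
  have C1: "Ck_on 1 \<Omega> u" using m by (intro Ck_on_le[OF solution_facts(1)]) simp
  have "bounded (dir_deriv b u ` \<Omega>)" for b using solution_facts(2)[of "[b]"] m by simp
  then obtain M where M: "M \<ge> 0" "\<And>x z. \<bar>U x - U z\<bar> \<le> M * norm (x - z)"
    using zext_lipschitz[OF open_domain C1 _ solution_facts(7)] unfolding U_def by metis
  obtain B0 where B0: "\<And>x. x \<in> \<Omega> \<Longrightarrow> \<bar>u x\<bar> \<le> B0" using solution_facts(6) by (auto simp: bounded_iff)
  define B where "B = max B0 0"
  have B: "\<bar>U x\<bar> \<le> B" for x using B0[of x] by (auto simp: U_def zext_def B_def)
  obtain D where D: "\<And>x. x \<in> \<Omega> \<Longrightarrow> norm x \<le> D" using bounded by (auto simp: bounded_iff)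
  then have D: "norm (x - y) \<le> D + norm y" if "x \<in> \<Omega>" for x
    using that norm_triangle_ineq4[of x y] by fastforce
  define D' where "D' = max (D + norm y) 0"
  have D': "D' \<ge> 0" "\<And>x. x \<in> \<Omega> \<Longrightarrow> norm (x - y) \<le> D'" using D by (auto simp: D'_def le_max_iff_disj)
  define \<mu> where "\<mu> = measure lborel \<Omega>"
  have main: "(N / 2 - m) * A \<le> N * E + e * (M * D' * \<mu>)" if e: "e > 0" for e
  proof -
    have "uniformly_continuous_on {- B..B} h"
      using h by (intro compact_uniformly_continuous) (auto intro: continuous_on_subset)
    then obtain d where d: "d > 0" "\<And>a b. a \<in> {- B..B} \<Longrightarrow> b \<in> {- B..B} \<Longrightarrow> dist a b < d \<Longrightarrow> dist (h a) (h b) < e"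
      using e unfolding uniformly_continuous_on_def by metis
    \<comment> \<open>The mean value theorem replaces h b by h at an intermediate point; uniform
      continuity of h on the range of u makes this cost at most e per unit of |a - b|.\<close>
    have taylor: "H a - H b \<le> h b * (a - b) + e * \<bar>a - b\<bar>"
      if ab: "a \<in> {- B..B}" "b \<in> {- B..B}" "\<bar>a - b\<bar> < d" for a b
    proof -
      have "\<exists>z. z \<in> {min a b..max a b} \<and> H a - H b = (a - b) * h z"
      proof (cases a b rule: linorder_cases)
        case less
        from MVT2[OF this, of H h] H(1) obtain z where "a < z" "z < b" "H b - H a = (b - a) * h z" by auto
        then show ?thesis using less by (intro exI[of _ z]) (auto simp: algebra_simps)
      next
        case greater
        from MVT2[OF this, of H h] H(1) obtain z where "b < z" "z < a" "H a - H b = (a - b) * h z" by auto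
        then show ?thesis using greater by (intro exI[of _ z]) auto
      qed (auto intro!: exI[of _ a])
      then obtain z where z: "z \<in> {min a b..max a b}" "H a - H b = (a - b) * h z" by blast
      have "dist (h z) (h b) < e" using ab z(1) by (intro d(2)) (auto simp: dist_real_def)
      then have "\<bar>(a - b) * (h z - h b)\<bar> \<le> \<bar>a - b\<bar> * e"
        unfolding abs_mult dist_real_def by (intro mult_left_mono) auto
      then show ?thesis unfolding z(2) by (simp add: algebra_simps abs_le_iff)
    qed
    \<comment> \<open>For t < 1 + q the dilation changes the values of U by less than d on \<Omega>,
      so \<open>taylor\<close> applies; the summand 1 covers M * D' = 0.\<close>
    define q where "q = d / (M * D' + 1)"
    have MD: "M * D' \<ge> 0" using M D' by simp
    then have q: "q > 0" using d(1) by (simp add: q_def)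
    have est: "E * t powr (- N) - E \<le> (t powr (m - N / 2) - 1) * A + e * (M * D' * \<mu>) * (t - 1)"
      if t: "1 < t" "t < 1 + q" for t
    proof -
      have t0: "t > 0" using t by simp
      let ?d = "dilation y t"
      have ddef: "?d x = y + t *\<^sub>R (x - y)" for x by (rule dilation_def)
      have sub: "?d -` \<Omega> \<subseteq> \<Omega>"
      proof
        fix x assume "x \<in> ?d -` \<Omega>"
        then have "y + (1 / t) *\<^sub>R (?d x - y) \<in> \<Omega>"
          using t by (intro star_shaped_scaling[OF smooth star]) auto
        then show "x \<in> \<Omega>" using t by (simp add: ddef)
      qed
      have cd: "continuous_on UNIV ?d" unfolding ddef by (intro continuous_intros)
      have cU: "continuous_on \<Omega> (\<lambda>x. U (?d x))"
        using continuous_on_compose2[OF contU cd] by (auto intro: continuous_on_subset)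
      have bU: "bounded ((\<lambda>x. U (?d x)) ` \<Omega>)" using B by (auto simp: bounded_iff)
      have diff: "\<bar>U (?d x) - u x\<bar> \<le> M * D' * (t - 1)" if x: "x \<in> \<Omega>" for x
      proof -
        have "?d x - x = (t - 1) *\<^sub>R (x - y)" by (simp add: ddef algebra_simps)
        then have "\<bar>U (?d x) - U x\<bar> \<le> M * ((t - 1) * norm (x - y))" using M(2)[of "?d x" x] t by simp
        also have "\<dots> \<le> M * ((t - 1) * D')" using M(1) D'(2)[OF x] t by (intro mult_left_mono) auto
        finally show ?thesis using x by (simp add: U_def zext_def mult_ac)
      qed
      have "(t - 1) * (M * D') \<le> q * (M * D')" using t MD by (intro mult_right_mono) auto
      also have "\<dots> < q * (M * D' + 1)" using q by simp
      also have "\<dots> = d" using MD by (simp add: q_def)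
      finally have small: "M * D' * (t - 1) < d" by (simp add: mult.commute)
      have ihu: "set_integrable lborel \<Omega> (\<lambda>x. h (u x) * u x)"
        by (rule set_integrable_comp_solution[of "\<lambda>s. h s * s"]) (intro continuous_intros h)
      have bh: "bounded ((\<lambda>x. h (u x)) ` \<Omega>)"
        by (rule bounded_image_cong[OF solution_facts(8) solution_facts(4)])
      have ihU: "set_integrable lborel \<Omega> (\<lambda>x. h (u x) * U (?d x))"
        by (intro set_integrable_bounded_continuous open_domain bounded continuous_on_mult cU bounded_image_mult bU bh
            continuous_on_compose2[OF h solution_facts(5)]) auto
      have iH: "set_integrable lborel \<Omega> (\<lambda>x. H (u x))" by (rule set_integrable_comp_solution[OF cH])
      have iHU: "set_integrable lborel \<Omega> (\<lambda>x. H (U (?d x)))"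
      proof (rule set_integrable_bounded_continuous[OF open_domain bounded])
        show "continuous_on \<Omega> (\<lambda>x. H (U (?d x)))" by (rule continuous_on_compose2[OF cH cU]) auto
        have "bounded (H ` {- B..B})"
          using cH by (intro compact_imp_bounded compact_continuous_image) (auto intro: continuous_on_subset)
        then show "bounded ((\<lambda>x. H (U (?d x))) ` \<Omega>)"
          by (rule bounded_subset) (use B in \<open>auto simp: abs_le_iff minus_le_iff\<close>)
      qed
      have i1: "set_integrable lborel \<Omega> (\<lambda>_. 1 :: real)"
        by (intro set_integrable_bounded_continuous open_domain bounded) (auto simp: bounded_iff)
      \<comment> \<open>Where the dilated point leaves \<Omega> the integrand is H 0 = 0, so the
        integral reduces to the preimage of \<Omega>.\<close>
      have "(LINT x:\<Omega>|lborel. H (U (?d x))) = (LINT x:?d -` \<Omega>|lborel. H (u (?d x)))"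
        unfolding set_lebesgue_integral_def
        by (rule Bochner_Integration.integral_cong) (use sub H(2) in \<open>auto simp: indicator_def U_def zext_def\<close>)
      also have "\<dots> = E / t ^ DIM('a)"
        unfolding E_def by (rule integral_dilation[OF open_domain t0 continuous_on_compose2[OF cH solution_facts(5)]]) auto
      also have "\<dots> = E * t powr (- N)" using t0 by (simp add: N_def powr_minus powr_realpow divide_inverse)
      finally have HU: "(LINT x:\<Omega>|lborel. H (U (?d x))) = E * t powr (- N)" .
      have "E * t powr (- N) \<le> (LINT x:\<Omega>|lborel. (H (u x) + (h (u x) * U (?d x) - h (u x) * u x)) + e * (M * D') * (t - 1) * 1)"
        unfolding HU[symmetric]
      proof (rule set_integral_mono[OF iHU])
        show "set_integrable lborel \<Omega> (\<lambda>x. (H (u x) + (h (u x) * U (?d x) - h (u x) * u x)) + e * (M * D') * (t - 1) * 1)"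
          by (intro set_integral_add set_integral_diff set_integrable_mult_right iH ihu ihU i1)
        fix x assume x: "x \<in> \<Omega>"
        have u: "u x = U x" using x by (simp add: U_def zext_def)
        have "H (U (?d x)) - H (u x) \<le> h (u x) * (U (?d x) - u x) + e * \<bar>U (?d x) - u x\<bar>"
          using B[of x] B[of "?d x"] diff[OF x] small by (intro taylor) (auto simp: u abs_le_iff)
        also have "e * \<bar>U (?d x) - u x\<bar> \<le> e * (M * D' * (t - 1))" using diff[OF x] e by (intro mult_left_mono) auto
        finally show "H (U (?d x)) \<le> (H (u x) + (h (u x) * U (?d x) - h (u x) * u x)) + e * (M * D') * (t - 1) * 1"
          by (simp add: algebra_simps)
      qed
      also have "\<dots> = (E + ((LINT x:\<Omega>|lborel. h (u x) * U (?d x)) - A)) + e * (M * D') * (t - 1) * (LINT x:\<Omega>|lborel. 1)"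
      proof -
        have d: "set_integrable lborel \<Omega> (\<lambda>x. h (u x) * U (?d x) - h (u x) * u x)"
          by (rule set_integral_diff(1)[OF ihU ihu])
        have s: "set_integrable lborel \<Omega> (\<lambda>x. H (u x) + (h (u x) * U (?d x) - h (u x) * u x))"
          by (rule set_integral_add(1)[OF iH d])
        have c: "set_integrable lborel \<Omega> (\<lambda>x. e * (M * D') * (t - 1) * 1)"
          using i1 by (rule set_integrable_mult_right)
        show ?thesis
          by (simp only: set_integral_add(2)[OF s c] set_integral_add(2)[OF iH d]
              set_integral_diff(2)[OF ihU ihu] set_integral_mult_right E_def A_def)
      qed
      also have "(LINT x:\<Omega>|lborel. 1) = \<mu>"
        by (simp add: set_lebesgue_integral_def \<mu>_def open_domain)
      finally have "E * t powr (- N) \<le> (E + ((LINT x:\<Omega>|lborel. h (u x) * U (?d x)) - A)) + e * (M * D') * (t - 1) * \<mu>" .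
      moreover have "(LINT x:\<Omega>|lborel. h (u x) * U (?d x)) \<le> t powr (m - N / 2) * A"
        unfolding U_def A_def N_def by (rule dilation_energy_le[OF t0 sub])
      ultimately show ?thesis by (simp add: algebra_simps)
    qed
    \<comment> \<open>\<open>est\<close> says that \<phi> t \<le> \<phi> 1 just to the right of 1,
      hence \<phi>'(1) \<le> 0, which is the desired inequality up to the error in e.\<close>
    define \<phi> where "\<phi> t = E * t powr (- N) - t powr (m - N / 2) * A - e * (M * D' * \<mu>) * t" for t
    have "(\<phi> has_real_derivative (- N * E + (N / 2 - m) * A - e * (M * D' * \<mu>))) (at 1)"
      unfolding \<phi>_def by (auto intro!: derivative_eq_intros simp: algebra_simps)
    moreover have "\<phi> t \<le> \<phi> 1" if "1 < t" "t < 1 + q" for t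
      using est[OF that] by (simp add: \<phi>_def algebra_simps)
    ultimately have "- N * E + (N / 2 - m) * A - e * (M * D' * \<mu>) \<le> 0"
    proof -
      assume der: "(\<phi> has_real_derivative (- N * E + (N / 2 - m) * A - e * (M * D' * \<mu>))) (at 1)"
        and le: "\<And>t. 1 < t \<Longrightarrow> t < 1 + q \<Longrightarrow> \<phi> t \<le> \<phi> 1"
      show ?thesis
      proof (rule ccontr)
        assume "\<not> ?thesis"
        then obtain r where r: "r > 0" "\<And>s. 0 < s \<Longrightarrow> s < r \<Longrightarrow> \<phi> 1 < \<phi> (1 + s)"
          using DERIV_pos_inc_right[OF der] by (auto simp: not_le)
        then have "\<phi> 1 < \<phi> (1 + min r q / 2)" using q by auto
        moreover have "\<phi> (1 + min r q / 2) \<le> \<phi> 1" using q r(1) by (intro le) (auto simp: min_def)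
        ultimately show False by simp
      qed
    qed
    then show ?thesis by simp
  qed
  have "(N / 2 - m) * A \<le> N * E + r" if r: "r > 0" for r
  proof -
    have c: "M * D' * \<mu> \<ge> 0" using M D' by (simp add: \<mu>_def)
    then have pos: "M * D' * \<mu> + 1 > 0" by simp
    have "(N / 2 - m) * A \<le> N * E + r / (M * D' * \<mu> + 1) * (M * D' * \<mu>)" using r pos by (intro main) simp
    also have "r / (M * D' * \<mu> + 1) * (M * D' * \<mu>) \<le> r / (M * D' * \<mu> + 1) * (M * D' * \<mu> + 1)"
      using r pos by (intro mult_left_mono) auto
    also have "\<dots> = r" using pos by simp
    finally show ?thesis by simp
  qed
  then show ?thesis unfolding A_def E_def N_def by (rule field_le_epsilon)
qed

end

section \<open>Nonexistence\<close>

lemma DERIV_abs_powr: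
  assumes "1 \<le> (p::real)"
  shows "((\<lambda>s. \<bar>s\<bar> powr (p + 1) / (p + 1)) has_real_derivative \<bar>s\<bar> powr (p - 1) * s) (at s)"
proof -
  consider "s > 0" | "s < 0" | "s = 0" by linarith
  then show ?thesis
  proof cases
    case 1
    have "((\<lambda>s. s powr (p + 1) / (p + 1)) has_real_derivative s powr (p - 1) * s) (at s)"
      using 1 assms powr_mult_base[of s "p - 1"]
      by (auto intro!: derivative_eq_intros simp: mult.commute)
    then show ?thesis
      using has_field_derivative_transform_within_open[of "\<lambda>s. s powr (p + 1) / (p + 1)" _ s "{0<..}"] 1 by simp
  next
    case 2
    have "((\<lambda>s. (- s) powr (p + 1) / (p + 1)) has_real_derivative (- s) powr (p - 1) * s) (at s)"
      using 2 assms powr_mult_base[of "- s" "p - 1"]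
      by (auto intro!: derivative_eq_intros simp: mult.commute)
    then show ?thesis
      using has_field_derivative_transform_within_open[of "\<lambda>s. (- s) powr (p + 1) / (p + 1)" _ s "{..<0}"] 2 by simp
  next
    case 3
    have "(\<lambda>h. (\<bar>0 + h\<bar> powr (p + 1) / (p + 1) - \<bar>0\<bar> powr (p + 1) / (p + 1)) / h) \<midarrow>0\<rightarrow> (0::real)"
    proof (rule Lim_null_comparison)
      have "norm ((\<bar>0 + h\<bar> powr (p + 1) / (p + 1) - \<bar>0\<bar> powr (p + 1) / (p + 1)) / h) \<le> \<bar>h\<bar>"
        if h: "h \<noteq> 0" "\<bar>h\<bar> < 1" for h
      proof -
        have "\<bar>h\<bar> powr (p + 1) \<le> \<bar>h\<bar> powr 2" using h assms by (intro powr_mono') auto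
        also have "\<dots> = \<bar>h\<bar> * \<bar>h\<bar>" using h by (simp add: powr_numeral power2_eq_square)
        finally have le: "\<bar>h\<bar> powr (p + 1) / \<bar>h\<bar> \<le> \<bar>h\<bar>" using h by (simp add: divide_le_eq)
        have "norm ((\<bar>0 + h\<bar> powr (p + 1) / (p + 1) - \<bar>0\<bar> powr (p + 1) / (p + 1)) / h)
            = \<bar>h\<bar> powr (p + 1) / \<bar>h\<bar> / (p + 1)"
          using assms by (simp add: abs_mult mult.commute)
        also have "\<dots> \<le> \<bar>h\<bar> powr (p + 1) / \<bar>h\<bar> / 1"
          using assms by (intro divide_left_mono) auto
        also have "\<dots> \<le> \<bar>h\<bar>" using le by simp
        finally show ?thesis .
      qed
      then show "\<forall>\<^sub>F h in at 0. norm ((\<bar>0 + h\<bar> powr (p + 1) / (p + 1) - \<bar>0\<bar> powr (p + 1) / (p + 1)) / h) \<le> \<bar>h\<bar>"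
        unfolding eventually_at by (intro exI[of _ 1]) (auto simp: dist_real_def)
      show "((\<lambda>h. \<bar>h\<bar>) \<longlongrightarrow> 0) (at (0::real))" by (auto intro!: tendsto_eq_intros)
    qed
    then show ?thesis using 3 by (simp add: DERIV_def)
  qed
qed

lemma continuous_on_abs_powr_mult:
  assumes "1 \<le> (p::real)"
  shows "continuous_on UNIV (\<lambda>s. \<bar>s\<bar> powr (p - 1) * s)"
proof (cases "p = 1")
  case True
  \<comment> \<open>As \<open>0 powr 0\<close> is 0, for p = 1 the first factor jumps at 0; the
    factor s hides the jump.\<close>
  have eq: "(\<lambda>s::real. \<bar>s\<bar> powr (p - 1) * s) = (\<lambda>s. s)" using True by auto
  show ?thesis unfolding eq by (rule continuous_on_id)
next
  case False
  then show ?thesis using assms by (intro continuous_intros continuous_on_powr') auto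
qed

text \<open>The bound is stated for F because F is what propagates: up to \<open>s\<^sub>0\<close>
  it follows by integrating the lower bound on f from 0, and beyond \<open>s\<^sub>0\<close> the
  derivative of F(s) s powr -(q+1) has the sign of f(s) s - (q+1) F(s).\<close>

lemma supercritical_lower_bound_pos:
  fixes f F :: "real \<Rightarrow> real"
  assumes F: "\<And>s. (F has_real_derivative f s) (at s)" "F 0 = 0" and q: "q > 0" and "s\<^sub>0 > 0"
    and AR: "\<And>s. f s * s - (q + 1) * F s \<ge> 0"
    and low: "\<And>s. 0 < s \<Longrightarrow> s \<le> s\<^sub>0 \<Longrightarrow> f s * s \<ge> C * s powr (q + 1)"
    and s: "s > 0"
  shows "(q + 1) * F s \<ge> C * s powr (q + 1)"
proof -
  have small: "(q + 1) * F s \<ge> C * s powr (q + 1)" if s: "0 < s" "s \<le> s\<^sub>0" for s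
  proof -
    let ?g = "\<lambda>s. (q + 1) * F s - C * s powr (q + 1)"
    have "continuous_on {0..s} F"
      using F(1) by (meson DERIV_continuous_on has_field_derivative_at_within)
    then have "continuous_on {0..s} ?g"
      using q by (intro continuous_intros continuous_on_powr') auto
    moreover have D: "(?g has_real_derivative (q + 1) * (f t - C * t powr q)) (at t)" if "0 < t" for t
      using that q by (auto intro!: derivative_eq_intros F(1) simp: algebra_simps)
    ultimately obtain l z where z: "0 < z" "z < s" "(?g has_real_derivative l) (at z)" "?g s - ?g 0 = (s - 0) * l"
      using MVT[of 0 s ?g] s real_differentiable_def by (metis (no_types, lifting))
    then have l: "l = (q + 1) * (f z - C * z powr q)" using DERIV_unique D by blast
    have "C * z powr q * z \<le> f z * z" using low[of z] z(1,2) s powr_mult_base[of z q] by (simp add: mult_ac add.commute)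
    then have "l \<ge> 0" using z q unfolding l by simp
    then have "0 \<le> s * l" using s by simp
    then show ?thesis using z(4) F(2) by simp
  qed
  show ?thesis
  proof (cases "s \<le> s\<^sub>0")
    case False
    let ?g = "\<lambda>s. F s * s powr (- (q + 1))"
    have "?g s\<^sub>0 \<le> ?g s"
    proof (rule DERIV_nonneg_imp_nondecreasing[of s\<^sub>0 s ?g])
      show "s\<^sub>0 \<le> s" using False by simp
      fix t assume "s\<^sub>0 \<le> t" "t \<le> s"
      then have t: "t > 0" using \<open>s\<^sub>0 > 0\<close> by simp
      have "1 + (- (q + 1) - 1) = - (q + 1)" by simp
      then have e: "t powr (- (q + 1)) = t powr (- (q + 1) - 1) * t"
        using powr_mult_base[OF less_imp_le[OF t], of "- (q + 1) - 1"] by (simp only: mult.commute)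
      have "(?g has_real_derivative f t * t powr (- (q + 1)) + F t * (- (q + 1) * t powr (- (q + 1) - 1))) (at t)"
        using t by (auto intro!: derivative_eq_intros F(1) simp: algebra_simps)
      moreover have "f t * t powr (- (q + 1)) + F t * (- (q + 1) * t powr (- (q + 1) - 1))
          = (f t * t - (q + 1) * F t) * t powr (- (q + 1) - 1)"
        unfolding e by (simp add: algebra_simps)
      moreover have "\<dots> \<ge> 0" using AR[of t] by simp
      ultimately show "\<exists>y. (?g has_real_derivative y) (at t) \<and> 0 \<le> y" by metis
    qed
    then have le: "(q + 1) * ?g s\<^sub>0 \<le> (q + 1) * ?g s" using q by (intro mult_left_mono) auto
    have inv: "t powr (q + 1) * t powr (- (q + 1)) = 1" if "t > 0" for t using that by (simp flip: powr_add)
    have "C = C * s\<^sub>0 powr (q + 1) * s\<^sub>0 powr (- (q + 1))"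
      unfolding mult.assoc inv[OF \<open>s\<^sub>0 > 0\<close>] by (rule mult_1_right[symmetric])
    also have "\<dots> \<le> (q + 1) * F s\<^sub>0 * s\<^sub>0 powr (- (q + 1))"
      using small[of s\<^sub>0] \<open>s\<^sub>0 > 0\<close> by (intro mult_right_mono) auto
    also have "\<dots> = (q + 1) * ?g s\<^sub>0" by (rule mult.assoc)
    also note le
    finally have "C * s powr (q + 1) \<le> (q + 1) * ?g s * s powr (q + 1)" by (rule mult_right_mono) simp
    also have "\<dots> = (q + 1) * F s * (s powr (q + 1) * s powr (- (q + 1)))" by (simp only: mult_ac)
    also have "\<dots> = (q + 1) * F s" unfolding inv[OF s] by (rule mult_1_right)
    finally show ?thesis .
  qed (use small s in auto)
qed

lemma supercritical_lower_bound:
  fixes f F :: "real \<Rightarrow> real"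
  assumes F: "\<And>s. (F has_real_derivative f s) (at s)" "F 0 = 0" and q: "q > 0" and "s\<^sub>0 > 0"
    and AR: "\<And>s. f s * s - (q + 1) * F s \<ge> 0"
    and low: "\<And>s. \<bar>s\<bar> \<le> s\<^sub>0 \<Longrightarrow> f s * s \<ge> C * \<bar>s\<bar> powr (q + 1)"
  shows "f s * s \<ge> C * \<bar>s\<bar> powr (q + 1)"
proof -
  consider "s > 0" | "s < 0" | "s = 0" by linarith
  then have "(q + 1) * F s \<ge> C * \<bar>s\<bar> powr (q + 1)"
  proof cases
    case 1
    have "f t * t \<ge> C * t powr (q + 1)" if "0 < t" "t \<le> s\<^sub>0" for t using low[of t] that by simp
    from supercritical_lower_bound_pos[OF F q \<open>s\<^sub>0 > 0\<close> AR this 1] 1 show ?thesis by simp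
  next
    case 2
    \<comment> \<open>Reflection: F(-s) has derivative -f(-s), and both hypotheses on the
      nonlinearity carry over to this pair.\<close>
    have "((\<lambda>s. F (- s)) has_real_derivative - f (- s)) (at s)" for s
      using DERIV_chain2[of F "f (- s)" uminus s "- 1" UNIV, OF F(1) DERIV_minus[OF DERIV_ident]] by simp
    moreover have "- f (- t) * t - (q + 1) * F (- t) \<ge> 0" for t using AR[of "- t"] by simp
    moreover have "- f (- t) * t \<ge> C * t powr (q + 1)" if "0 < t" "t \<le> s\<^sub>0" for t
      using low[of "- t"] that by simp
    ultimately have "(q + 1) * F (- (- s)) \<ge> C * (- s) powr (q + 1)"
      using F(2) q \<open>s\<^sub>0 > 0\<close> 2
      by (intro supercritical_lower_bound_pos[of "\<lambda>s. F (- s)" "\<lambda>s. - f (- s)" q s\<^sub>0 C "- s"]) auto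
    then show ?thesis using 2 by simp
  next
    case 3
    then show ?thesis using F(2) q by simp
  qed
  then show ?thesis using AR[of s] by simp
qed

lemma set_integral_pos:
  fixes g :: "'a::euclidean_space \<Rightarrow> real"
  assumes G: "open G" and int: "set_integrable lborel G g" and cont: "continuous_on G g"
    and nonneg: "\<And>x. x \<in> G \<Longrightarrow> 0 \<le> g x" and x: "x \<in> G" "0 < g x"
  shows "0 < (LINT x:G|lborel. g x)"
proof -
  obtain d where d: "d > 0" "\<And>z. z \<in> G \<Longrightarrow> dist z x < d \<Longrightarrow> dist (g z) (g x) < g x / 2"
    using cont x unfolding continuous_on_iff by (metis half_gt_zero)
  obtain r0 where r0: "r0 > 0" "ball x r0 \<subseteq> G" using G x(1) openE by blast
  define r where "r = min d r0"
  have r: "r > 0" "ball x r \<subseteq> G" using d r0 by (auto simp: r_def)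
  have lowb: "g x / 2 \<le> g z" if "z \<in> ball x r" for z
  proof -
    have "\<bar>g z - g x\<bar> < g x / 2"
      using d(2)[of z] subsetD[OF r(2) that] that by (simp add: r_def dist_commute[of z] dist_real_def)
    then show ?thesis unfolding abs_less_iff by linarith
  qed
  have fin: "emeasure lborel (ball x r) < \<infinity>" by (rule emeasure_bounded_finite) simp
  have "0 < g x / 2 * measure lborel (ball x r)"
    using content_ball_pos[OF r(1), of x] x(2) by simp
  also have "\<dots> = (\<integral>z. g x / 2 * indicator (ball x r) z \<partial>lborel)" using fin by simp
  also have "\<dots> \<le> (LINT x:G|lborel. g x)"
    unfolding set_lebesgue_integral_def
  proof (rule integral_mono)
    show "integrable lborel (\<lambda>z. g x / 2 * indicator (ball x r) z)" using fin by simp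
    show "integrable lborel (\<lambda>x. indicator G x *\<^sub>R g x)" using int by (simp add: set_integrable_def)
    show "g x / 2 * indicator (ball x r) z \<le> indicator G z *\<^sub>R g z" for z
      using lowb[of z] nonneg[of z] r(2) by (auto simp: indicator_def)
  qed
  finally show ?thesis .
qed

lemma abs_powr_interpolation:
  assumes "1 \<le> p" "p \<le> (q::real)"
  shows "\<bar>s\<bar> powr (p + 1) \<le> s\<^sup>2 + \<bar>s\<bar> powr (q + 1)"
proof (cases "\<bar>s\<bar> \<le> 1")
  case True
  have "\<bar>s\<bar> powr (p + 1) \<le> s\<^sup>2"
    using powr_mono'[of 2 "p + 1" "\<bar>s\<bar>"] assms True by (cases "s = 0") auto
  then show ?thesis by (simp add: add_increasing2)
next
  case False
  then have "\<bar>s\<bar> powr (p + 1) \<le> \<bar>s\<bar> powr (q + 1)" using assms by (intro powr_mono) auto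
  then show ?thesis by (simp add: add_increasing)
qed

lemma DERIV_interval_integral:
  fixes f :: "real \<Rightarrow> real"
  assumes "continuous_on UNIV f"
  shows "((\<lambda>s. LBINT t=ereal 0..ereal s. f t) has_real_derivative f s) (at s)"
proof -
  define a where "a = - (\<bar>s\<bar> + 1)"
  define b where "b = \<bar>s\<bar> + 1"
  have "((\<lambda>s. LBINT t=ereal 0..ereal s. f t) has_vector_derivative f s) (at s within {a..b})"
    by (rule interval_integral_FTC2) (auto simp: a_def b_def intro: continuous_on_subset[OF assms])
  then have "((\<lambda>s. LBINT t=ereal 0..ereal s. f t) has_real_derivative f s) (at s within {a..b})"
    by (simp add: has_real_derivative_iff_has_vector_derivative)
  moreover have "a < s" "s < b" unfolding a_def b_def by linarith+
  ultimately show ?thesis by (simp add: at_within_Icc_at)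
qed

theorem theorem1p2:
  fixes \<Omega> :: "'a::euclidean_space set"
    and m :: nat and p q s\<^sub>0 C\<^sub>0 :: real and f F :: "real \<Rightarrow> real"
  defines "N \<equiv> DIM('a)"
  assumes "m \<ge> 1" and "N \<ge> 2 * m + 1"
    and "smooth_domain \<Omega>" and "bounded \<Omega>" and "star_shaped \<Omega>"
    and "1 \<le> p" and "p < (real N + 2 * real m) / (real N - 2 * real m)"
    and "continuous_on UNIV f"
    and "\<And>s. F s = (LBINT t=ereal 0..ereal s. f t)"
    and "q > (real N + 2 * real m) / (real N - 2 * real m)" and "s\<^sub>0 > 0" and "C\<^sub>0 > 0"
    and "\<And>s. f s * s - (q + 1) * F s \<ge> 0"
    and "\<And>s. \<bar>s\<bar> \<le> s\<^sub>0 \<Longrightarrow> f s * s \<ge> C\<^sub>0 * \<bar>s\<bar> powr (q + 1)"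
  shows "\<exists>L>0. \<forall>l<L. \<not> (\<exists>u. regular_solution m \<Omega> (\<lambda>s. f s + l * \<bar>s\<bar> powr (p - 1) * s) u
                            \<and> (\<exists>x\<in>\<Omega>. u x \<noteq> 0))"
proof -
  note m = assms(2) and N2m = assms(3) and smooth = assms(4) and bdd = assms(5) and p1 = assms(7)
    and pc = assms(8) and f = assms(9) and Fdef = assms(10) and qc = assms(11) and AR = assms(14) and low = assms(15)
  have \<Omega>: "open \<Omega>" by (rule smooth_domainD(1)[OF smooth])
  obtain y where star: "\<And>x. x \<in> frontier \<Omega> \<Longrightarrow> (x - y) \<bullet> outer_normal \<Omega> x \<ge> 0"
    using assms(6) unfolding star_shaped_def by blast
  have Feq: "F = (\<lambda>s. LBINT t=ereal 0..ereal s. f t)" using Fdef by blast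
  have F: "(F has_real_derivative f s) (at s)" for s unfolding Feq by (rule DERIV_interval_integral[OF f])
  have F0: "F 0 = 0" by (simp add: Feq)
  have cF: "continuous_on UNIV F" using F by (meson DERIV_continuous_on has_field_derivative_at_within)
  have Nm: "real N - 2 * real m > 0" using N2m by linarith
  have q1: "q > p" using pc qc by linarith
  have q0: "q > 0" using q1 p1 by simp
  have fs: "f s * s \<ge> C\<^sub>0 * \<bar>s\<bar> powr (q + 1)" for s
    by (rule supercritical_lower_bound[OF F F0 q0 \<open>s\<^sub>0 > 0\<close> AR low])
  define \<alpha> where "\<alpha> = real N / 2 - real m"
  \<comment> \<open>a and b are the coefficients left in the Pohozaev inequality after F is bounded
    by f(s) s/(q+1). a > 0 expresses that q is supercritical, b > 0 that p is subcritical.\<close>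
  define a where "a = \<alpha> - real N / (q + 1)"
  define b where "b = real N / (p + 1) - \<alpha>"
  have a: "a > 0"
  proof -
    have "real N + 2 * real m < q * (real N - 2 * real m)" using qc Nm by (simp add: divide_less_eq)
    then show ?thesis using q0 by (simp add: a_def \<alpha>_def field_simps)
  qed
  have b: "b > 0"
  proof -
    have "p * (real N - 2 * real m) < real N + 2 * real m" using pc Nm by (simp add: less_divide_eq)
    then show ?thesis using p1 by (simp add: b_def \<alpha>_def field_simps)
  qed
  obtain R where R: "\<And>x. x \<in> \<Omega> \<Longrightarrow> norm x \<le> R" using bdd by (auto simp: bounded_iff)
  define P where "P = (4 * R\<^sup>2) ^ m"
  have P: "P \<ge> 0" by (simp add: P_def)
  \<comment> \<open>K is the constant in X \<le> Z + Y \<le> l K X: the first summand comes from the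
    Poincare inequality for Z, the second from the lower bound of f for Y. It is fixed before l and
    u are chosen.\<close>
  define K where "K = P * (b / a + 1) + b / (a * C\<^sub>0)"
  have K: "K \<ge> 0" using P a b \<open>C\<^sub>0 > 0\<close> by (simp add: K_def)
  have "False" if l: "l < 1 / (K + 1)" and reg: "regular_solution m \<Omega> (\<lambda>s. f s + l * \<bar>s\<bar> powr (p - 1) * s) u"
    and z: "z \<in> \<Omega>" "u z \<noteq> 0" for l u z
  proof -
    define h where "h s = f s + l * \<bar>s\<bar> powr (p - 1) * s" for s
    have ch: "continuous_on UNIV h"
      unfolding h_def mult.assoc by (intro continuous_intros f continuous_on_abs_powr_mult p1)
    have reg: "regular_solution m \<Omega> h u" using reg by (simp add: h_def[abs_def])
    note sol = solution_facts[OF smooth bdd m reg ch] and si = set_integrable_comp_solution[OF smooth bdd m reg ch]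
    define H where "H s = F s + l * (\<bar>s\<bar> powr (p + 1) / (p + 1))" for s
    have H: "(H has_real_derivative h s) (at s)" for s
      unfolding H_def h_def mult.assoc by (intro DERIV_add F DERIV_cmult DERIV_abs_powr p1)
    have H0: "H 0 = 0" using F0 by (simp add: H_def)
    define X where "X = (LINT x:\<Omega>|lborel. \<bar>u x\<bar> powr (p + 1))"
    define Y where "Y = (LINT x:\<Omega>|lborel. \<bar>u x\<bar> powr (q + 1))"
    define Z where "Z = (LINT x:\<Omega>|lborel. (u x)\<^sup>2)"
    define \<Phi> where "\<Phi> = (LINT x:\<Omega>|lborel. f (u x) * u x)"
    have cpow: "continuous_on UNIV (\<lambda>s::real. \<bar>s\<bar> powr r)" if "r > 0" for r
      using that by (intro continuous_on_powr' continuous_intros) auto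
    have iX: "set_integrable lborel \<Omega> (\<lambda>x. \<bar>u x\<bar> powr (p + 1))" using p1 by (intro si cpow) simp
    have iY: "set_integrable lborel \<Omega> (\<lambda>x. \<bar>u x\<bar> powr (q + 1))" using q0 by (intro si cpow) simp
    have iZ: "set_integrable lborel \<Omega> (\<lambda>x. (u x)\<^sup>2)" by (intro si continuous_intros)
    have i\<Phi>: "set_integrable lborel \<Omega> (\<lambda>x. f (u x) * u x)"
      by (rule si[of "\<lambda>s. f s * s"]) (intro continuous_intros f)
    have iF: "set_integrable lborel \<Omega> (\<lambda>x. F (u x))" by (rule si[OF cF])
    have "\<bar>s\<bar> powr (p - 1) * s * s = \<bar>s\<bar> powr (p + 1)" for s
    proof (cases "s = 0")
      case False
      have "\<bar>s\<bar> powr (p + 1) = \<bar>s\<bar> powr (p - 1) * \<bar>s\<bar> powr 2" using powr_add[of "\<bar>s\<bar>" "p - 1" 2] by (simp add: add.commute)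
      also have "\<bar>s\<bar> powr 2 = s * s" using False by (simp add: powr_numeral power2_eq_square)
      finally show ?thesis by (simp only: mult.assoc)
    qed simp
    then have hs: "h s * s = f s * s + l * \<bar>s\<bar> powr (p + 1)" for s by (simp add: h_def algebra_simps)
    have A: "(LINT x:\<Omega>|lborel. h (u x) * u x) = \<Phi> + l * X"
      unfolding hs \<Phi>_def X_def using i\<Phi> iX by (simp add: set_integral_add)
    have E: "(LINT x:\<Omega>|lborel. H (u x)) = (LINT x:\<Omega>|lborel. F (u x)) + l * (X / (p + 1))"
      unfolding H_def X_def using iF iX by (simp add: set_integral_add)
    have "(LINT x:\<Omega>|lborel. F (u x)) \<le> (LINT x:\<Omega>|lborel. 1 / (q + 1) * (f (u x) * u x))"
    proof (rule set_integral_mono[OF iF])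
      show "F (u x) \<le> 1 / (q + 1) * (f (u x) * u x)" for x using AR[of "u x"] q0 by (simp add: field_simps)
    qed (use i\<Phi> in simp)
    then have IF: "(LINT x:\<Omega>|lborel. F (u x)) \<le> \<Phi> / (q + 1)" by (simp add: \<Phi>_def)
    have "\<alpha> * (\<Phi> + l * X) \<le> real N * ((LINT x:\<Omega>|lborel. F (u x)) + l * (X / (p + 1)))"
      using Pohozaev_inequality[OF smooth bdd m reg ch star H H0] unfolding A E \<alpha>_def N_def .
    also have "\<dots> \<le> real N * (\<Phi> / (q + 1) + l * (X / (p + 1)))" using IF by (intro mult_left_mono) auto
    finally have poh: "a * \<Phi> \<le> l * b * X" by (simp add: a_def b_def algebra_simps)
    have C0Y: "C\<^sub>0 * Y \<le> \<Phi>"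
    proof -
      have "(LINT x:\<Omega>|lborel. C\<^sub>0 * \<bar>u x\<bar> powr (q + 1)) \<le> \<Phi>"
        unfolding \<Phi>_def by (rule set_integral_mono[OF _ i\<Phi> fs]) (use iY in simp)
      then show ?thesis by (simp add: Y_def)
    qed
    have pos: "0 < (LINT x:\<Omega>|lborel. \<bar>u x\<bar> powr (r + 1))" if "r > 0" "set_integrable lborel \<Omega> (\<lambda>x. \<bar>u x\<bar> powr (r + 1))" for r
    proof (rule set_integral_pos[OF \<Omega> that(2) _ _ z(1)])
      show "continuous_on \<Omega> (\<lambda>x. \<bar>u x\<bar> powr (r + 1))"
        using that(1) by (intro continuous_on_compose2[OF cpow sol(5)]) auto
    qed (use z in auto)
    have X: "X > 0" unfolding X_def using p1 iX by (intro pos) auto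
    have Y: "Y > 0" unfolding Y_def using q0 iY by (intro pos) auto
    \<comment> \<open>The sign of l is settled here: a \<Phi> is positive and at most l b X.\<close>
    have "\<Phi> > 0" using C0Y mult_pos_pos[OF \<open>C\<^sub>0 > 0\<close> Y] by linarith
    then have "0 < l * b * X" using poh mult_pos_pos[OF a] by fastforce
    then have l0: "l > 0" using b X by (simp add: zero_less_mult_iff)
    have \<Phi>: "\<Phi> \<le> l * (b / a) * X" using poh a by (simp add: field_simps)
    have "Z \<le> P * (\<Phi> + l * X)"
      using energy_ge_L2[OF smooth bdd m reg ch R] unfolding A P_def Z_def .
    also have "\<dots> \<le> P * (l * (b / a) * X + l * X)" using \<Phi> P by (intro mult_left_mono) auto
    finally have Z: "Z \<le> l * (P * (b / a + 1)) * X" by (simp add: algebra_simps)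
    have "Y \<le> \<Phi> / C\<^sub>0" using C0Y \<open>C\<^sub>0 > 0\<close> by (simp add: field_simps)
    also have "\<dots> \<le> l * (b / a) * X / C\<^sub>0" using \<Phi> \<open>C\<^sub>0 > 0\<close> by (intro divide_right_mono) auto
    finally have Yle: "Y \<le> l * (b / (a * C\<^sub>0)) * X" by (simp add: field_simps)
    have "X \<le> (LINT x:\<Omega>|lborel. (u x)\<^sup>2 + \<bar>u x\<bar> powr (q + 1))"
      unfolding X_def using p1 q1
      by (intro set_integral_mono iX set_integral_add iZ iY abs_powr_interpolation) auto
    also have "\<dots> = Z + Y" unfolding Z_def Y_def by (rule set_integral_add(2)[OF iZ iY])
    also have "\<dots> \<le> l * K * X" using Z Yle by (simp add: K_def algebra_simps)
    finally have "1 \<le> l * K" using X by simp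
    moreover have "l * K < 1"
    proof -
      have "l * (K + 1) < 1" using l K by (simp add: less_divide_eq)
      then show ?thesis using l0 by (simp add: algebra_simps)
    qed
    ultimately show False by simp
  qed
  then show ?thesis using K by (intro exI[of _ "1 / (K + 1)"]) auto
qed

end
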